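(* Let $F:\mathbb{R}^m\to\mathbb{R}^m$ be a $C^1$ globally integrable vector field with induced flow $\Phi=\{\Phi_t\}$, which is gradient-like with a $C^1$ strict Lyapounov function $V:\mathbb{R}^m\to\mathbb{R}$. Let $X:\mathbb{R}^+\to\mathbb{R}^m$ be a bounded asymptotic pseudotrajectory of $\Phi$, with limit set $\mathcal{L}=\mathcal{L}(X)$, error rate $e(X)$, and let $\mathcal{R}(\mathcal{L})$ be the Sacker–Sell resolvent of $\mathcal{L}$. Assume that: (i) $V$ satisfies a Lojasiewicz inequality (with constants $\theta\in\,]0,1/2]$ and $c_0$) and $(F,V)$ satisfies an angle condition at some point $p\in\mathcal{L}\cap\mathsf{Eq}(F)$; (ii) $]e(X),0[\;\cap\;\mathcal{R}(\mathcal{L})\neq\emptyset$. Then $\mathcal{L}=\{p\}$. If furthermore, for some $\beta>0$, $|\langle\nabla V(x),F(x)\rangle|\ge\beta\|\nabla V(x)\|^2$ for all $x$ in a neighborhood of $p$, then, as $t\to\infty$, $$\|X(t)-p\|=\begin{cases}O(e^{ct}) & \text{if }\theta=1/2,\\ O\bigl(t^{-\theta/(1-2\theta)}\bigr) & \text{if }0<\theta<1/2,\end{cases}$$ where $c=\max\Bigl(-\dfrac{\beta}{2c_0^2},\ \inf\bigl(\,]e(X),0[\;\cap\;\mathcal{R}(\mathcal{L})\bigr)\Bigr)$.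
   Context: $\mathsf{Eq}(F)=\{x\in\mathbb{R}^m:F(x)=0\}$. "Globally integrable" means that the flow $\Phi_t(x)$ is defined for all $t\in\mathbb{R}$ and $x\in\mathbb{R}^m$. A strict Lyapounov function for $\Phi$ (or $F$) is a continuous map $V:\mathbb{R}^m\to\mathbb{R}$ with $V(\Phi_t(x))<V(x)$ for all $x\in\mathbb{R}^m\setminus\mathsf{Eq}(F)$ and $t>0$; $F$ is gradient-like if such a $V$ exists. A continuous $X:\mathbb{R}^+\to\mathbb{R}^m$ is an asymptotic pseudotrajectory of $\Phi$ if for all $T>0$, $\lim_{t\to\infty}\sup_{0\le h\le T}\|X(t+h)-\Phi_h(X(t))\|=0$. Its limit set is $\mathcal{L}(X)=\bigcap_{t\ge0}\overline{\{X(t+s):s\ge0\}}$. The error rate of a bounded asymptotic pseudotrajectory $X$ is $$e(X)=\limsup_{t\to\infty}\frac1t\log\Bigl(\sup_{0\le h\le T}\|X(t+h)-\Phi_h(X(t))\|\Bigr)\in[-\infty,0],$$ which does not depend on the choice of $T>0$. $V$ satisfies a Lojasiewicz inequality at $p$ if there exist a neighborhood $U$ of $p$ and constants $0<\theta\le1/2$, $c_0\ge0$ such that $|V(x)-V(p)|^{1-\theta}\le c_0\|\nabla V(x)\|$ for all $x\in U$. $(F,V)$ satisfies an angle condition at $p$ if there exist a neighborhood $U$ of $p$ and $c_1>0$ such that $|\langle\nabla V(x),F(x)\rangle|\ge c_1\|\nabla V(x)\|\,\|F(x)\|$ for all $x\in U$. The Sacker–Sell resolvent $\mathcal{R}(\mathcal{L})$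 is the set of $\lambda\in\mathbb{R}$ such that for all $x\in\mathcal{L}$ and $v\in\mathbb{R}^m\setminus\{0\}$, $\sup_{t\in\mathbb{R}}\|e^{-\lambda t}D\Phi_t(x)v\|=\infty$. $]a,b[$ denotes the open interval.
   Formalization: For θ=1/2, O(e^{ct}) is claimed with exactly c only if the infimum is < c; otherwise O(e^{c't}) for every real c'>c, since O(e^{ct}) can fail (F=0, V=0, X(t)=te^{-t}, c=-1). If c_0=0, -β/(2c_0^2) is read as -∞. *)

theory Defs
  imports "HOL-Analysis.Analysis" "HOL-Library.Landau_Symbols"
begin

definition C1_map :: "('a::real_normed_vector \<Rightarrow> 'b::real_normed_vector) \<Rightarrow> bool" where
  "C1_map f \<longleftrightarrow>
     (\<exists>D :: 'a \<Rightarrow> ('a \<Rightarrow>\<^sub>L 'b).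
        (\<forall>x. (f has_derivative blinfun_apply (D x)) (at x)) \<and> continuous_on UNIV D)"

definition grad :: "('a::real_inner \<Rightarrow> real) \<Rightarrow> 'a \<Rightarrow> 'a" where
  "grad V x = (THE D. GDERIV V x :> D)"

definition Eq :: "('a::real_normed_vector \<Rightarrow> 'a) \<Rightarrow> 'a set" where
  "Eq F = {x. F x = 0}"

text \<open>\<open>\<Phi> t x\<close> is the flow at time \<open>t\<close> started at \<open>x\<close>. That the solution is defined for all
  \<open>t\<close> and all \<open>x\<close> is global integrability of \<open>F\<close>; if \<open>F\<close> is \<open>C\<^sup>1\<close>, then \<open>\<Phi>\<close> is determined
  by \<open>F\<close>.\<close>

definition global_flow ::
    "('a::real_normed_vector \<Rightarrow> 'a) \<Rightarrow> (real \<Rightarrow> 'a \<Rightarrow> 'a) \<Rightarrow> bool" where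
  "global_flow F \<Phi> \<longleftrightarrow>
     (\<forall>x. \<Phi> 0 x = x \<and> (\<forall>t. ((\<lambda>s. \<Phi> s x) has_vector_derivative F (\<Phi> t x)) (at t)))"

definition strict_Lyapounov ::
    "('a::real_normed_vector \<Rightarrow> 'a) \<Rightarrow> (real \<Rightarrow> 'a \<Rightarrow> 'a) \<Rightarrow> ('a \<Rightarrow> real) \<Rightarrow> bool" where
  "strict_Lyapounov F \<Phi> V \<longleftrightarrow>
     continuous_on UNIV V \<and> (\<forall>x. x \<notin> Eq F \<longrightarrow> (\<forall>t>0. V (\<Phi> t x) < V x))"

text \<open>Trajectories on \<open>[0, \<infinity>)\<close> are functions on all of \<open>real\<close> whose values at negative times are
  irrelevant.\<close>

definition shadow_error ::
    "(real \<Rightarrow> 'a::real_normed_vector \<Rightarrow> 'a) \<Rightarrow> (real \<Rightarrow> 'a) \<Rightarrow> real \<Rightarrow> real \<Rightarrow> real" where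
  "shadow_error \<Phi> X T t = (SUP h\<in>{0..T}. norm (X (t + h) - \<Phi> h (X t)))"

definition asymptotic_pseudotrajectory ::
    "(real \<Rightarrow> 'a::real_normed_vector \<Rightarrow> 'a) \<Rightarrow> (real \<Rightarrow> 'a) \<Rightarrow> bool" where
  "asymptotic_pseudotrajectory \<Phi> X \<longleftrightarrow>
     continuous_on {0..} X \<and> (\<forall>T>0. (shadow_error \<Phi> X T \<longlongrightarrow> 0) at_top)"

definition limit_set :: "(real \<Rightarrow> 'a::topological_space) \<Rightarrow> 'a set" where
  "limit_set X = (\<Inter>t\<in>{0..}. closure {X (t + s) | s. s \<ge> 0})"

text \<open>The logarithm with \<open>log 0 = -\<infinity>\<close>, whereas \<open>ln 0 = 0\<close>.\<close>

definition ext_log :: "real \<Rightarrow> ereal" where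
  "ext_log y = (if y = 0 then -\<infinity> else ereal (ln y))"

text \<open>For a bounded asymptotic pseudotrajectory the value does not depend on \<open>T > 0\<close>.\<close>

definition error_rate ::
    "(real \<Rightarrow> 'a::real_normed_vector \<Rightarrow> 'a) \<Rightarrow> real \<Rightarrow> (real \<Rightarrow> 'a) \<Rightarrow> ereal" where
  "error_rate \<Phi> T X = Limsup at_top (\<lambda>t. ereal (1 / t) * ext_log (shadow_error \<Phi> X T t))"

definition Lojasiewicz_at ::
    "('a::real_inner \<Rightarrow> real) \<Rightarrow> 'a \<Rightarrow> real \<Rightarrow> real \<Rightarrow> bool" where
  "Lojasiewicz_at V p \<theta> c\<^sub>0 \<longleftrightarrow>
     0 < \<theta> \<and> \<theta> \<le> 1/2 \<and> c\<^sub>0 \<ge> 0 \<and>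
     (\<forall>\<^sub>F x in nhds p. \<bar>V x - V p\<bar> powr (1 - \<theta>) \<le> c\<^sub>0 * norm (grad V x))"

definition angle_condition_at ::
    "('a::real_inner \<Rightarrow> 'a) \<Rightarrow> ('a \<Rightarrow> real) \<Rightarrow> 'a \<Rightarrow> bool" where
  "angle_condition_at F V p \<longleftrightarrow>
     (\<exists>c\<^sub>1>0. \<forall>\<^sub>F x in nhds p. \<bar>grad V x \<bullet> F x\<bar> \<ge> c\<^sub>1 * norm (grad V x) * norm (F x))"

definition Sacker_Sell_resolvent ::
    "(real \<Rightarrow> 'a::real_normed_vector \<Rightarrow> 'a) \<Rightarrow> 'a set \<Rightarrow> real set" where
  "Sacker_Sell_resolvent \<Phi> L =
     {\<mu>. \<forall>x\<in>L. \<forall>v. v \<noteq> 0 \<longrightarrow>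
        (SUP t. ereal (norm (exp (- \<mu> * t) *\<^sub>R frechet_derivative (\<Phi> t) (at x) v))) = \<infinity>}"

text \<open>The set \<open>]e(X), 0[ \<inter> \<R>(\<L>)\<close>.\<close>

definition admissible_rates ::
    "(real \<Rightarrow> 'a::real_normed_vector \<Rightarrow> 'a) \<Rightarrow> real \<Rightarrow> (real \<Rightarrow> 'a) \<Rightarrow> real set" where
  "admissible_rates \<Phi> T X =
     {\<mu>. error_rate \<Phi> T X < ereal \<mu> \<and> \<mu> < 0} \<inter> Sacker_Sell_resolvent \<Phi> (limit_set X)"

text \<open>The infimum can be \<open>-\<infinity>\<close> (if \<open>e(X) = -\<infinity>\<close>), and \<open>c\<^sub>0 = 0\<close> is allowed, in which case the
  quotient in \<open>ereal\<close> is \<open>-\<infinity>\<close>; both are why the exponent \<open>c\<close> is an extended real.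

  If the infimum is strictly below \<open>-\<beta> / (2 c\<^sub>0\<^sup>2)\<close>, then \<open>c\<close> is real and the decay is
  \<open>O(e\<^sup>c\<^sup>t)\<close>. Otherwise \<open>c\<close> is only the infimum of the possible exponents and need not be attained:
  for \<open>F = 0\<close>, \<open>V = 0\<close> on the line and \<open>X(t) = t e\<^sup>-\<^sup>t\<close> one has \<open>e(X) = -1\<close>,
  \<open>\<R>({0}) = {\<mu>. \<mu> \<noteq> 0}\<close>, and \<open>c = -1\<close> for \<open>\<beta> \<ge> 2 c\<^sub>0\<^sup>2\<close>. The decay
  is then \<open>O(e\<^sup>c\<^sup>'\<^sup>t)\<close> for every real \<open>c' > c\<close>.\<close>

definition decay_exponent ::
    "(real \<Rightarrow> 'a::real_normed_vector \<Rightarrow> 'a) \<Rightarrow> real \<Rightarrow> (real \<Rightarrow> 'a) \<Rightarrow> real \<Rightarrow> real \<Rightarrow> ereal" where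
  "decay_exponent \<Phi> T X \<beta> c\<^sub>0 =
     max (- ereal \<beta> / ereal (2 * c\<^sub>0\<^sup>2)) (INF \<mu>\<in>admissible_rates \<Phi> T X. ereal \<mu>)"

end

theory Submission
  imports Defs "HOL-Real_Asymp.Real_Asymp"
begin

text \<open>
  The rate \<open>\<mu> \<in> ]e(X), 0[ \<inter> \<R>(\<L>)\<close> makes the pseudotrajectory shadow a genuine orbit up to
  \<open>O(e\<^sup>\<mu>\<^sup>t)\<close>. Sampling \<open>x\<^sub>n = X(nT)\<close> and rescaling the correction by \<open>e\<^sup>\<mu>\<^sup>n\<^sup>T\<close>, one looks for a
  bounded solution of \<open>u\<^sub>n\<^sub>+\<^sub>1 = A\<^sub>n u\<^sub>n + G\<^sub>n(u\<^sub>n)\<close> with \<open>A\<^sub>n = e\<^sup>-\<^sup>\<mu>\<^sup>T D\<Phi>\<^sub>T(x\<^sub>n)\<close> and \<open>G\<^sub>n\<close> a small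
  Lipschitz map. That no orbit of the rescaled linear cocycle over \<open>\<L>\<close> is bounded on \<open>\<int>\<close> yields, by
  compactness, Coppel's condition: a solution of the linear recursion is at time \<open>n\<close> at most half its
  maximum over a window \<open>[n - W, n + W]\<close>. On a half line this alone gives the bounded solutions of
  the inhomogeneous recursion, so neither exponential dichotomies nor chain transitivity of \<open>\<L>\<close>
  are needed.

  The shadowing orbit accumulates at \<open>p\<close>, so by the Lojasiewicz argument it has finite length and
  converges to \<open>p\<close>, with \<open>\<parallel>\<Phi>\<^sub>t(y) - p\<parallel>\<close> bounded by a multiple of \<open>(V(\<Phi>\<^sub>t(y)) - V(p))\<^sup>\<theta>\<close>. The rates come
  from integrating \<open>v' \<le> - (\<beta> / c\<^sub>0\<^sup>2) v\<^sup>2\<^sup>(\<^sup>1\<^sup>-\<^sup>\<theta>\<^sup>)\<close>.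
\<close>

text \<open>\<open>V\<close> need not decrease along \<open>X\<close>, so the Lojasiewicz argument
  cannot be run on the pseudotrajectory itself; a genuine orbit has to come first. The small
  Lipschitz constant of the nonlinearity is an effect of the rescaling: corrections have size
  \<open>\<rho> ^ n\<close>, and on such small balls the time \<open>T\<close> map differs from its
  linear part by a map with small Lipschitz constant. This requires differentiability of the flow in
  a form uniform over the bounded set of samples, which is derived from the vector field. The errors
  of \<open>X\<close> are bounded by \<open>exp (\<nu> * t)\<close> with \<open>\<nu>\<close>
  strictly between the error rate and \<open>\<mu>\<close>, so they still vanish after division by
  \<open>exp (\<mu> * t)\<close>. Coppel's condition only bounds solutions already known to be
  bounded. Existence is separate: finitely supported forcing is handled through surjectivity of the
  linear maps, general forcing by compactness. Keeping initial values in a complement of the bounded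
  homogeneous solutions makes the solution unique and controlled by the forcing, which is what the
  contraction argument rests on.\<close>

section \<open>The flow of a continuously differentiable vector field\<close>

text \<open>Bootstrap principle: the set where \<open>r\<close> is reached is closed, so it would
  have a first point, which \<open>step\<close> rules out. It turns estimates valid only inside a
  ball into invariance of the ball. At \<open>t = a\<close> the inner premise of \<open>step\<close>
  is vacuous, so the start is covered too.\<close>

lemma first_exit:
  fixes f :: "real \<Rightarrow> real"
  assumes cont: "continuous_on {a..b} f"
    and step: "\<And>t. a \<le> t \<Longrightarrow> t \<le> b \<Longrightarrow> (\<And>s. a \<le> s \<Longrightarrow> s < t \<Longrightarrow> f s < r) \<Longrightarrow> f t < r"
    and t: "a \<le> t" "t \<le> b"
  shows "f t < r"
proof (rule ccontr)
  assume neg: "\<not> f t < r"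
  define S where "S = {s \<in> {a..b}. r \<le> f s}"
  have "closed S" unfolding S_def
    by (intro continuous_closed_preimage_constant continuous_on_closed_Collect_le cont) auto
  moreover have "S \<noteq> {}" using neg t by (auto simp: S_def)
  moreover have bb: "bdd_below S" by (auto simp: S_def intro!: bdd_belowI[of _ a])
  ultimately have "Inf S \<in> S" by (rule closed_contains_Inf[rotated 2])
  moreover have "f (Inf S) < r"
  proof (rule step)
    fix s assume s: "a \<le> s" "s < Inf S"
    with \<open>Inf S \<in> S\<close> have "s \<in> {a..b}" by (auto simp: S_def)
    moreover have "s \<notin> S" using s bb by (meson cInf_lower leD)
    ultimately show "f s < r" by (auto simp: S_def)
  qed (use \<open>Inf S \<in> S\<close> in \<open>auto simp: S_def\<close>)
  ultimately show False by (auto simp: S_def)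
qed

text \<open>The bound on \<open>e'\<close> is asked only on the open interval, because bootstrap
  arguments supply it only for times strictly before the final one.\<close>

lemma gronwall:
  fixes e :: "real \<Rightarrow> 'a::real_inner"
  assumes T: "0 \<le> T" and K: "0 \<le> K" and \<eta>: "0 \<le> \<eta>"
    and der: "\<And>t. (e has_vector_derivative e' t) (at t)"
    and bd: "\<And>t. 0 < t \<Longrightarrow> t < T \<Longrightarrow> norm (e' t) \<le> K * norm (e t) + \<eta>"
  shows "norm (e T) \<le> (norm (e 0) + \<eta> * T) * exp (K * T)"
proof (rule field_le_epsilon)
  fix \<epsilon> :: real assume "\<epsilon> > 0"
  \<comment> \<open>smooth surrogate \<open>N\<close> for the norm, which is not differentiable at \<open>0\<close>\<close>
  define \<delta> where "\<delta> = \<epsilon> / exp (K * T)"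
  have d: "\<delta> > 0" using \<open>\<epsilon> > 0\<close> by (simp add: \<delta>_def)
  define N where "N t = sqrt (e t \<bullet> e t + \<delta>\<^sup>2)" for t
  have Npos: "N t > 0" for t unfolding N_def using d by (intro real_sqrt_gt_zero add_nonneg_pos) auto
  have Nge: "norm (e t) \<le> N t" for t unfolding N_def norm_eq_sqrt_inner by (rule real_sqrt_le_mono) simp
  have N': "(N has_real_derivative (e t \<bullet> e' t) / N t) (at t)" for t
  proof -
    have a: "((\<lambda>t. e t \<bullet> e t + \<delta>\<^sup>2) has_real_derivative (e t \<bullet> e' t + e' t \<bullet> e t)) (at t)"
      using der[of t] unfolding has_vector_derivative_def has_field_derivative_def
      by (auto intro!: derivative_eq_intros simp: algebra_simps)
    have "0 < e t \<bullet> e t + \<delta>\<^sup>2" using d by (intro add_nonneg_pos) auto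
    from DERIV_chain2[OF DERIV_real_sqrt[OF this] a] show ?thesis
      unfolding N_def[abs_def] by (simp add: inner_commute field_simps)
  qed
  \<comment> \<open>Integrating factor; the forcing can be subtracted as \<open>\<eta> * t\<close>
    because \<open>exp (- K * t)\<close> is at most 1.\<close>
  define g where "g t = exp (- K * t) * N t - \<eta> * t" for t
  have g': "(g has_real_derivative (exp (- K * t) * ((e t \<bullet> e' t) / N t - K * N t) - \<eta>)) (at t)" for t
    unfolding g_def by (rule derivative_eq_intros N' refl | simp add: algebra_simps)+
  have "g T \<le> g 0"
  proof (rule DERIV_nonpos_imp_decreasing_open[OF T])
    fix t assume t: "0 < t" "t < T"
    have "e t \<bullet> e' t \<le> norm (e t) * norm (e' t)" by (rule norm_cauchy_schwarz)
    also have "\<dots> \<le> N t * (K * N t + \<eta>)"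
      using bd[OF t] Nge[of t] K by (intro mult_mono order.trans[OF bd[OF t]]) (auto intro!: mult_left_mono simp: order.trans[OF norm_ge_zero Nge])
    finally have "(e t \<bullet> e' t) / N t - K * N t \<le> \<eta>" using Npos[of t] by (simp add: field_simps)
    then have "exp (- K * t) * ((e t \<bullet> e' t) / N t - K * N t) \<le> exp (- K * t) * \<eta>" by simp
    also have "\<dots> \<le> 1 * \<eta>" using K t \<eta> by (intro mult_right_mono) auto
    finally show "\<exists>y. (g has_real_derivative y) (at t) \<and> y \<le> 0" using g'[of t] by force
  next
    show "continuous_on {0..T} g" by (intro continuous_at_imp_continuous_on ballI DERIV_isCont[OF g'])
  qed
  then have "N T \<le> (N 0 + \<eta> * T) * exp (K * T)" by (simp add: g_def exp_minus field_simps)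
  moreover have "N 0 \<le> norm (e 0) + \<delta>"
    unfolding N_def power2_norm_eq_inner[symmetric] using sqrt_sum_squares_le_sum[of "norm (e 0)" \<delta>] d by simp
  ultimately have "norm (e T) \<le> (norm (e 0) + \<delta> + \<eta> * T) * exp (K * T)"
    using Nge[of T] by (smt (verit) exp_ge_zero mult_right_mono)
  then show "norm (e T) \<le> (norm (e 0) + \<eta> * T) * exp (K * T) + \<epsilon>" by (simp add: \<delta>_def algebra_simps)
qed

section \<open>Lipschitz bounds and strict differentiability of C1 maps on balls\<close>

lemma C1_map_bound_on_cball:
  fixes f :: "'a::euclidean_space \<Rightarrow> 'b::euclidean_space"
  assumes D: "continuous_on UNIV (D :: 'a \<Rightarrow> 'a \<Rightarrow>\<^sub>L 'b)"
  obtains L where "L > 0" "\<And>x. x \<in> cball 0 R \<Longrightarrow> norm (D x) \<le> L"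
proof -
  have "compact (D ` cball 0 R)" by (intro compact_continuous_image continuous_on_subset[OF D]) auto
  then show thesis using that compact_imp_bounded[of "D ` cball 0 R"] unfolding bounded_pos by auto
qed

lemma C1_lipschitz_on_cball:
  fixes f :: "'a::euclidean_space \<Rightarrow> 'b::euclidean_space"
  assumes f: "\<And>x. (f has_derivative blinfun_apply (D x)) (at x)"
    and L: "\<And>x. x \<in> cball 0 R \<Longrightarrow> norm (D x) \<le> L"
    and xy: "x \<in> cball 0 R" "y \<in> cball 0 R"
  shows "norm (f x - f y) \<le> L * norm (x - y)"
  by (rule differentiable_bound[of "cball 0 R"])
     (use L xy in \<open>auto simp: norm_blinfun.rep_eq[symmetric] intro: has_derivative_at_withinI[OF f]\<close>)

text \<open>Mean value inequality for \<open>f - D x\<close>, whose derivative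
  \<open>D y - D x\<close> is small near \<open>x\<close>. Uniform continuity of \<open>D\<close> on
  the compact ball makes \<open>\<delta>\<close> independent of \<open>x\<close>.\<close>

lemma C1_strict_differentiability:
  fixes f :: "'a::euclidean_space \<Rightarrow> 'b::euclidean_space"
  assumes f: "\<And>x. (f has_derivative blinfun_apply (D x)) (at x)"
    and D: "continuous_on UNIV D" and "\<epsilon> > 0"
  obtains \<delta> where "\<delta> > 0"
    "\<And>x a b. x \<in> cball 0 R \<Longrightarrow> a \<in> cball 0 R \<Longrightarrow> b \<in> cball 0 R \<Longrightarrow> dist a x < \<delta> \<Longrightarrow> dist b x < \<delta> \<Longrightarrow>
      norm (f a - f b - D x (a - b)) \<le> \<epsilon> * norm (a - b)"
proof -
  have "uniformly_continuous_on (cball 0 R) D"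
    by (intro compact_uniformly_continuous continuous_on_subset[OF D]) auto
  then obtain \<delta> where d: "\<delta> > 0" and
    u: "\<And>x y. x \<in> cball 0 R \<Longrightarrow> y \<in> cball 0 R \<Longrightarrow> dist y x < \<delta> \<Longrightarrow> dist (D y) (D x) < \<epsilon>"
    using \<open>\<epsilon> > 0\<close> unfolding uniformly_continuous_on_def by meson
  show thesis
  proof (rule that[OF d])
    fix x a b :: "'a" assume A: "x \<in> cball 0 R" "a \<in> cball 0 R" "b \<in> cball 0 R" "dist a x < \<delta>" "dist b x < \<delta>"
    have "norm ((f a - D x a) - (f b - D x b)) \<le> \<epsilon> * norm (a - b)"
    proof (rule differentiable_bound[of "ball x \<delta> \<inter> cball 0 R" _ "\<lambda>y. blinfun_apply (D y - D x)"])
      show "convex (ball x \<delta> \<inter> cball 0 R)" by (intro convex_Int convex_ball convex_cball)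
      fix y assume "y \<in> ball x \<delta> \<inter> cball 0 R"
      then show "onorm (blinfun_apply (D y - D x)) \<le> \<epsilon>"
        using u[of x y] A(1) by (simp add: norm_blinfun.rep_eq[symmetric] dist_norm norm_minus_commute)
      show "((\<lambda>y. f y - D x y) has_derivative blinfun_apply (D y - D x)) (at y within ball x \<delta> \<inter> cball 0 R)"
        by (auto intro!: derivative_eq_intros has_derivative_at_withinI[OF f] simp: blinfun.diff_left)
    qed (use A in \<open>auto simp: dist_commute\<close>)
    then show "norm (f a - f b - D x (a - b)) \<le> \<epsilon> * norm (a - b)"
      by (simp add: blinfun.diff_right algebra_simps)
  qed
qed

text \<open>Facts proved for nonnegative times pass to negative times by applying them to the
  reversed field.\<close>

lemma global_flow_reverse:
  assumes "global_flow F \<Phi>"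
  shows "global_flow (\<lambda>x. - F x) (\<lambda>t. \<Phi> (- t))"
  unfolding global_flow_def
proof (intro allI conjI)
  fix x t
  show "\<Phi> (- 0) x = x" using assms by (simp add: global_flow_def)
  have a: "((\<lambda>s. \<Phi> s x) has_vector_derivative F (\<Phi> (- t) x)) (at (- t))"
    using assms by (simp add: global_flow_def)
  have "(uminus has_vector_derivative (- 1 :: real)) (at t)" by (auto intro!: derivative_eq_intros)
  from vector_diff_chain_at[of uminus "- 1" t "\<lambda>s. \<Phi> s x", OF this a]
  have "((\<lambda>s. \<Phi> s x) \<circ> uminus has_vector_derivative (- 1) *\<^sub>R F (\<Phi> (- t) x)) (at t)" .
  then show "((\<lambda>s. \<Phi> (- s) x) has_vector_derivative - F (\<Phi> (- t) x)) (at t)"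
    by (simp add: o_def)
qed

lemma C1_map_uminus: "C1_map f \<Longrightarrow> C1_map (\<lambda>x. - f x)"
  unfolding C1_map_def
proof (elim exE conjE)
  fix D assume "\<forall>x. (f has_derivative blinfun_apply (D x)) (at x)" "continuous_on UNIV D"
  then show "\<exists>D. (\<forall>x. ((\<lambda>x. - f x) has_derivative blinfun_apply (D x)) (at x)) \<and> continuous_on UNIV D"
    by (intro exI[of _ "\<lambda>x. - D x"])
       (auto intro!: continuous_intros derivative_eq_intros simp: blinfun.minus_left fun_eq_iff)
qed

section \<open>Uniqueness of solutions and the group law\<close>

locale C1_flow =
  fixes F :: "'a::euclidean_space \<Rightarrow> 'a" and \<Phi> :: "real \<Rightarrow> 'a \<Rightarrow> 'a"
  assumes C1_F: "C1_map F" and flow: "global_flow F \<Phi>"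
begin

lemma reverse: "C1_flow (\<lambda>x. - F x) (\<lambda>t. \<Phi> (- t))"
  by standard (auto intro: C1_map_uminus C1_F global_flow_reverse flow)

lemma flow_0[simp]: "\<Phi> 0 x = x"
  using flow by (simp add: global_flow_def)

lemma flow_has_vector_derivative: "((\<lambda>s. \<Phi> s x) has_vector_derivative F (\<Phi> t x)) (at t)"
  using flow by (simp add: global_flow_def)

lemma continuous_on_flow_time: "continuous_on S (\<lambda>t. \<Phi> t x)"
  by (intro continuous_at_imp_continuous_on ballI has_vector_derivative_continuous[OF flow_has_vector_derivative])

lemma F_lipschitz_on_cball:
  obtains L where "L > 0" "\<And>x y. x \<in> cball 0 R \<Longrightarrow> y \<in> cball 0 R \<Longrightarrow> norm (F x - F y) \<le> L * norm (x - y)"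
proof -
  obtain D where D: "\<And>x. (F has_derivative blinfun_apply (D x)) (at x)" "continuous_on UNIV D"
    using C1_F by (auto simp: C1_map_def)
  obtain L where "L > 0" "\<And>x. x \<in> cball 0 R \<Longrightarrow> norm (D x) \<le> L"
    using C1_map_bound_on_cball[OF D(2)] by blast
  then show thesis using that C1_lipschitz_on_cball[OF D(1)] by blast
qed

lemma flow_unique:
  assumes e: "\<And>t. (y has_vector_derivative F (y t)) (at t)" and "0 \<le> T"
  shows "y T = \<Phi> T (y 0)"
proof -
  have cy: "continuous_on {0..T} y"
    by (intro continuous_at_imp_continuous_on ballI has_vector_derivative_continuous[OF e])
  have "bounded (y ` {0..T} \<union> (\<lambda>t. \<Phi> t (y 0)) ` {0..T})"
    by (intro bounded_Un[THEN iffD2] conjI compact_imp_bounded compact_continuous_image cy continuous_on_flow_time) auto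
  then obtain R where R: "\<And>t. t \<in> {0..T} \<Longrightarrow> y t \<in> cball 0 R \<and> \<Phi> t (y 0) \<in> cball 0 R"
    unfolding bounded_iff by force
  obtain L where L: "L > 0" "\<And>x y. x \<in> cball 0 R \<Longrightarrow> y \<in> cball 0 R \<Longrightarrow> norm (F x - F y) \<le> L * norm (x - y)"
    using F_lipschitz_on_cball by blast
  have "norm (y T - \<Phi> T (y 0)) \<le> (norm (y 0 - \<Phi> 0 (y 0)) + 0 * T) * exp (L * T)"
  proof (rule gronwall[OF \<open>0 \<le> T\<close>])
    show "((\<lambda>t. y t - \<Phi> t (y 0)) has_vector_derivative F (y t) - F (\<Phi> t (y 0))) (at t)" for t
      by (intro has_vector_derivative_diff e flow_has_vector_derivative)
  qed (use L R in auto)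
  then show ?thesis by simp
qed

lemma flow_add_nonneg:
  assumes "0 \<le> t"
  shows "\<Phi> (t + s) x = \<Phi> t (\<Phi> s x)"
proof -
  have "((\<lambda>r. \<Phi> (r + s) x) has_vector_derivative F (\<Phi> (r + s) x)) (at r)" for r
  proof -
    have "((\<lambda>t. \<Phi> t x) \<circ> (\<lambda>r. r + s) has_vector_derivative 1 *\<^sub>R F (\<Phi> (r + s) x)) (at r)"
      by (rule vector_diff_chain_at[where g="\<lambda>t. \<Phi> t x", OF _ flow_has_vector_derivative]) (auto intro!: derivative_eq_intros)
    then show ?thesis by (simp add: o_def)
  qed
  from flow_unique[OF this assms] show ?thesis by simp
qed

end

context C1_flow
begin

interpretation rev: C1_flow "\<lambda>x. - F x" "\<lambda>t. \<Phi> (- t)" by (rule reverse)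

lemma flow_add: "\<Phi> (t + s) x = \<Phi> t (\<Phi> s x)"
proof (cases "0 \<le> t")
  case False
  then show ?thesis using rev.flow_add_nonneg[of "- t" "- s" x] by (simp add: add.commute)
qed (simp add: flow_add_nonneg)

lemma flow_inverse[simp]: "\<Phi> (- t) (\<Phi> t x) = x" "\<Phi> t (\<Phi> (- t) x) = x"
  by (simp_all flip: flow_add)

lemma flow_fixed: "x \<in> Eq F \<Longrightarrow> \<Phi> t x = x"
proof -
  assume "x \<in> Eq F"
  then have F: "F x = 0" by (simp add: Eq_def)
  show ?thesis
  proof (cases "0 \<le> t")
    case True
    then show ?thesis using flow_unique[of "\<lambda>_. x" t] F by simp
  next
    case False
    then show ?thesis using rev.flow_unique[of "\<lambda>_. x" "- t"] F by simp
  qed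
qed

end

section \<open>Uniform estimates for the flow on bounded sets\<close>

context C1_flow
begin

text \<open>A Lipschitz constant of \<open>F\<close> is available only on a ball that must already
  be known to contain the perturbed orbits. Allowing distance 1 from the reference orbit breaks the
  circle: while the distance stays below 1, Gronwall keeps it strictly below 1.\<close>

lemma flow_tube:
  assumes "0 \<le> T"
  obtains \<delta> R where "\<delta> > 0" "\<And>a t. a \<in> ball x \<delta> \<Longrightarrow> 0 \<le> t \<Longrightarrow> t \<le> T \<Longrightarrow> \<Phi> t a \<in> cball 0 R"
proof -
  have "bounded ((\<lambda>t. \<Phi> t x) ` {0..T})"
    by (intro compact_imp_bounded compact_continuous_image continuous_on_flow_time) auto
  then obtain R where R: "\<And>t. t \<in> {0..T} \<Longrightarrow> norm (\<Phi> t x) \<le> R" unfolding bounded_iff by force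
  obtain L where L: "L > 0" "\<And>x y. x \<in> cball 0 (R+1) \<Longrightarrow> y \<in> cball 0 (R+1) \<Longrightarrow> norm (F x - F y) \<le> L * norm (x - y)"
    using F_lipschitz_on_cball by blast
  \<comment> \<open>The radius \<open>exp (- L * T)\<close> is the inverse of the Gronwall factor
    over time \<open>T\<close>.\<close>
  have close: "norm (\<Phi> t a - \<Phi> t x) < 1" if a: "a \<in> ball x (exp (- L * T))" and t: "0 \<le> t" "t \<le> T" for a t
  proof (rule first_exit[OF _ _ t])
    show "continuous_on {0..T} (\<lambda>t. norm (\<Phi> t a - \<Phi> t x))"
      by (intro continuous_intros continuous_on_flow_time)
    fix t assume t: "0 \<le> t" "t \<le> T" and less: "\<And>s. 0 \<le> s \<Longrightarrow> s < t \<Longrightarrow> norm (\<Phi> s a - \<Phi> s x) < 1"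
    have "norm (\<Phi> t a - \<Phi> t x) \<le> (norm (\<Phi> 0 a - \<Phi> 0 x) + 0 * t) * exp (L * t)"
    proof (rule gronwall[OF t(1)])
      show "((\<lambda>t. \<Phi> t a - \<Phi> t x) has_vector_derivative F (\<Phi> t a) - F (\<Phi> t x)) (at t)" for t
        by (intro has_vector_derivative_diff flow_has_vector_derivative)
      fix s assume s: "0 < s" "s < t"
      have "norm (\<Phi> s a) \<le> norm (\<Phi> s a - \<Phi> s x) + norm (\<Phi> s x)" by norm
      then have "norm (\<Phi> s a) \<le> R + 1" using less[of s] R[of s] s t by simp
      then show "norm (F (\<Phi> s a) - F (\<Phi> s x)) \<le> L * norm (\<Phi> s a - \<Phi> s x) + 0"
        using R[of s] s t L(2) by force
    qed (use L in auto)
    also have "\<dots> \<le> norm (a - x) * exp (L * T)" using t L by (simp add: mult_left_mono)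
    also have "\<dots> < exp (- L * T) * exp (L * T)" using a by (simp add: dist_norm norm_minus_commute)
    finally show "norm (\<Phi> t a - \<Phi> t x) < 1" by (simp flip: exp_add)
  qed
  show thesis
  proof (rule that)
    fix a t assume *: "a \<in> ball x (exp (- L * T))" "0 \<le> t" "t \<le> T"
    have "norm (\<Phi> t a) \<le> norm (\<Phi> t a - \<Phi> t x) + norm (\<Phi> t x)" by norm
    then show "\<Phi> t a \<in> cball 0 (R+1)" using close[OF *] R[of t] * by simp
  qed simp
qed

text \<open>Tubes around single orbits, made uniform by a finite subcover of the compact
  ball.\<close>

lemma flow_bounded:
  assumes "0 \<le> T"
  obtains R where "\<And>a t. a \<in> cball 0 r \<Longrightarrow> 0 \<le> t \<Longrightarrow> t \<le> T \<Longrightarrow> \<Phi> t a \<in> cball 0 R"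
proof -
  have "\<forall>x. \<exists>\<delta> R. \<delta> > 0 \<and> (\<forall>a\<in>ball x \<delta>. \<forall>t\<in>{0..T}. \<Phi> t a \<in> cball 0 R)"
    using flow_tube[OF assms] by (metis atLeastAtMost_iff)
  then obtain \<delta> R where dR: "\<And>x. \<delta> x > 0" "\<And>x a t. a\<in>ball x (\<delta> x) \<Longrightarrow> t\<in>{0..T} \<Longrightarrow> \<Phi> t a \<in> cball 0 (R x)"
    by metis
  have cover: "cball (0::'a) r \<subseteq> (\<Union>x\<in>UNIV. ball x (\<delta> x))"
    using dR(1) by (auto intro: centre_in_ball[THEN iffD2] UN_I[OF UNIV_I] simp del: mem_ball)
  obtain C where C: "finite C" "cball (0::'a) r \<subseteq> (\<Union>x\<in>C. ball x (\<delta> x))"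
    using compactE_image[of "cball (0::'a) r" UNIV "\<lambda>x. ball x (\<delta> x)"]
    by (metis compact_cball open_ball cover)
  show thesis
  proof (rule that)
    fix a :: 'a and t :: real assume "a \<in> cball 0 r" "0 \<le> t" "t \<le> T"
    then have "a \<in> (\<Union>x\<in>C. ball x (\<delta> x))" using C(2) by (rule_tac subsetD)
    then obtain x where "x \<in> C" "a \<in> ball x (\<delta> x)" by (rule UN_E)
    then have x: "x \<in> C" "\<Phi> t a \<in> cball 0 (R x)" using dR(2)[of a x t] \<open>0 \<le> t\<close> \<open>t \<le> T\<close> by simp_all
    have "R x \<le> (\<Sum>x\<in>C. \<bar>R x\<bar>)" using member_le_sum[OF x(1), of "\<lambda>x. \<bar>R x\<bar>"] C by auto
    then show "\<Phi> t a \<in> cball 0 (\<Sum>x\<in>C. \<bar>R x\<bar>)" using x by auto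
  qed
qed

lemma flow_lipschitz:
  assumes "0 \<le> T"
  obtains C where "C > 0"
    "\<And>a b t. a \<in> cball 0 r \<Longrightarrow> b \<in> cball 0 r \<Longrightarrow> 0 \<le> t \<Longrightarrow> t \<le> T \<Longrightarrow> norm (\<Phi> t a - \<Phi> t b) \<le> C * norm (a - b)"
proof -
  obtain R where R: "\<And>a t. a \<in> cball 0 r \<Longrightarrow> 0 \<le> t \<Longrightarrow> t \<le> T \<Longrightarrow> \<Phi> t a \<in> cball 0 R"
    using flow_bounded[OF assms] by blast
  obtain L where L: "L > 0" "\<And>x y. x \<in> cball 0 R \<Longrightarrow> y \<in> cball 0 R \<Longrightarrow> norm (F x - F y) \<le> L * norm (x - y)"
    using F_lipschitz_on_cball by blast
  show thesis
  proof (rule that)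
    fix a b :: 'a and t :: real assume ab: "a \<in> cball 0 r" "b \<in> cball 0 r" and t: "0 \<le> t" "t \<le> T"
    have "norm (\<Phi> t a - \<Phi> t b) \<le> (norm (\<Phi> 0 a - \<Phi> 0 b) + 0 * t) * exp (L * t)"
    proof (rule gronwall[OF t(1)])
      show "((\<lambda>t. \<Phi> t a - \<Phi> t b) has_vector_derivative F (\<Phi> t a) - F (\<Phi> t b)) (at t)" for t
        by (intro has_vector_derivative_diff flow_has_vector_derivative)
    qed (use L R ab t in auto)
    also have "\<dots> \<le> norm (a - b) * exp (L * T)" using t L by (simp add: mult_left_mono)
    finally show "norm (\<Phi> t a - \<Phi> t b) \<le> exp (L * T) * norm (a - b)" by (simp add: mult.commute)
  qed simp
qed

text \<open>Gronwall for linear combinations of differences of orbits. It replaces the variational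
  equation: applied to difference quotients it shows that these converge, that the limit is linear,
  and that the convergence is locally uniform, without solving a linear differential equation.\<close>

lemma flow_strict_combination:
  fixes n :: nat
  assumes "0 \<le> T" "\<epsilon> > 0"
  obtains \<delta> where "\<delta> > 0"
    "\<And>x a b c t. \<lbrakk>x \<in> cball 0 r; \<And>i. i < n \<Longrightarrow> dist (a i) x < \<delta>; \<And>i. i < n \<Longrightarrow> dist (b i) x < \<delta>;
        (\<Sum>i<n. c i *\<^sub>R (a i - b i)) = 0; 0 \<le> t; t \<le> T\<rbrakk>
      \<Longrightarrow> norm (\<Sum>i<n. c i *\<^sub>R (\<Phi> t (a i) - \<Phi> t (b i))) \<le> \<epsilon> * (\<Sum>i<n. \<bar>c i\<bar> * norm (a i - b i))"
proof -
  obtain R where R: "\<And>a t. a \<in> cball 0 (r+1) \<Longrightarrow> 0 \<le> t \<Longrightarrow> t \<le> T \<Longrightarrow> \<Phi> t a \<in> cball 0 R"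
    using flow_bounded[OF assms(1)] by blast
  obtain C where C: "C > 0" "\<And>a b t. a \<in> cball 0 (r+1) \<Longrightarrow> b \<in> cball 0 (r+1) \<Longrightarrow> 0 \<le> t \<Longrightarrow> t \<le> T \<Longrightarrow> norm (\<Phi> t a - \<Phi> t b) \<le> C * norm (a - b)"
    using flow_lipschitz[OF assms(1)] by blast
  obtain D where D: "\<And>x. (F has_derivative blinfun_apply (D x)) (at x)" "continuous_on UNIV D"
    using C1_F by (auto simp: C1_map_def)
  obtain M where M: "M > 0" "\<And>x. x \<in> cball 0 R \<Longrightarrow> norm (D x) \<le> M"
    using C1_map_bound_on_cball[OF D(2)] by blast
  \<comment> \<open>Inverse of the factor lost in Gronwall; \<open>T + 1\<close> in place of
    \<open>T\<close> keeps the denominator positive when \<open>T = 0\<close>.\<close>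
  define \<epsilon>1 where "\<epsilon>1 = \<epsilon> / (C * (T + 1) * exp (M * T))"
  have e1: "\<epsilon>1 > 0" using assms C by (simp add: \<epsilon>1_def)
  obtain d where d: "d > 0"
    "\<And>x a b. x \<in> cball 0 R \<Longrightarrow> a \<in> cball 0 R \<Longrightarrow> b \<in> cball 0 R \<Longrightarrow> dist a x < d \<Longrightarrow> dist b x < d \<Longrightarrow>
      norm (F a - F b - D x (a - b)) \<le> \<epsilon>1 * norm (a - b)"
    using C1_strict_differentiability[OF D e1, of R] by blast
  \<comment> \<open>The 1 keeps start points in the ball of radius \<open>r + 1\<close>;
    \<open>d / C\<close> keeps their orbits within \<open>d\<close> of the orbit of
    \<open>x\<close>.\<close>
  define \<delta> where "\<delta> = min 1 (d / C)"
  show thesis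
  proof (rule that[of \<delta>])
    show "\<delta> > 0" using d C by (simp add: \<delta>_def)
    fix x :: 'a and a b c and t :: real
    assume x: "x \<in> cball 0 r" and a: "\<And>i. i < n \<Longrightarrow> dist (a i) x < \<delta>" and b: "\<And>i. i < n \<Longrightarrow> dist (b i) x < \<delta>"
      and s0: "(\<Sum>i<n. c i *\<^sub>R (a i - b i)) = 0" and t: "0 \<le> t" "t \<le> T"
    have near: "y \<in> cball 0 (r+1) \<and> (\<forall>s. 0 \<le> s \<longrightarrow> s \<le> T \<longrightarrow> dist (\<Phi> s y) (\<Phi> s x) < d)" if y: "dist y x < \<delta>" for y
    proof -
      have "norm y \<le> dist y x + norm x" unfolding dist_norm by norm
      then have y1: "y \<in> cball 0 (r+1)" using y x by (simp add: \<delta>_def)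
      moreover have "x \<in> cball 0 (r+1)" using x by simp
      ultimately have "norm (\<Phi> s y - \<Phi> s x) \<le> C * norm (y - x)" if "0 \<le> s" "s \<le> T" for s
        using C(2) that by blast
      moreover have "C * norm (y - x) < d"
        using y C(1) by (simp add: \<delta>_def dist_norm pos_less_divide_eq mult.commute)
      ultimately show ?thesis using y1 by (force simp: dist_norm)
    qed
    define S where "S = (\<Sum>i<n. \<bar>c i\<bar> * norm (a i - b i))"
    have S: "S \<ge> 0" by (simp add: S_def sum_nonneg)
    define e where "e s = (\<Sum>i<n. c i *\<^sub>R (\<Phi> s (a i) - \<Phi> s (b i)))" for s
    define e' where "e' s = (\<Sum>i<n. c i *\<^sub>R (F (\<Phi> s (a i)) - F (\<Phi> s (b i))))" for s
    have "norm (e t) \<le> (norm (e 0) + (\<epsilon>1 * C * S) * t) * exp (M * t)"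
    proof (rule gronwall[OF t(1)])
      show "(e has_vector_derivative e' s) (at s)" for s
        unfolding e_def e'_def
        by (intro has_vector_derivative_sum bounded_linear.has_vector_derivative[OF bounded_linear_scaleR_right]
            has_vector_derivative_diff flow_has_vector_derivative)
    next
      fix s assume s: "0 < s" "s < t"
      define z where "z = \<Phi> s x"
      have zR: "z \<in> cball 0 R" unfolding z_def using R x s t by simp
      \<comment> \<open>The linear part acts on the combination as a whole, which starts at 0; only
        the remainders are estimated term by term.\<close>
      have "e' s = D z (e s) + (\<Sum>i<n. c i *\<^sub>R (F (\<Phi> s (a i)) - F (\<Phi> s (b i)) - D z (\<Phi> s (a i) - \<Phi> s (b i))))"
        unfolding e'_def e_def blinfun.sum_right blinfun.scaleR_right sum.distrib[symmetric]
        by (intro sum.cong refl) (simp add: algebra_simps)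
      also have "norm \<dots> \<le> norm (D z (e s)) + norm (\<Sum>i<n. c i *\<^sub>R (F (\<Phi> s (a i)) - F (\<Phi> s (b i)) - D z (\<Phi> s (a i) - \<Phi> s (b i))))"
        by (rule norm_triangle_ineq)
      also have "norm (D z (e s)) \<le> M * norm (e s)"
        using norm_blinfun[of "D z" "e s"] M(2)[OF zR] by (meson mult_right_mono norm_ge_zero order_trans)
      also have "norm (\<Sum>i<n. c i *\<^sub>R (F (\<Phi> s (a i)) - F (\<Phi> s (b i)) - D z (\<Phi> s (a i) - \<Phi> s (b i))))
          \<le> (\<Sum>i<n. \<bar>c i\<bar> * (\<epsilon>1 * (C * norm (a i - b i))))"
      proof (rule sum_norm_le)
        fix i assume "i \<in> {..<n}"
        then have i: "i < n" by simp
        note na = near[OF a[OF i]] and nb = near[OF b[OF i]]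
        have "norm (F (\<Phi> s (a i)) - F (\<Phi> s (b i)) - D z (\<Phi> s (a i) - \<Phi> s (b i))) \<le> \<epsilon>1 * norm (\<Phi> s (a i) - \<Phi> s (b i))"
          by (intro d(2)) (use na nb s t zR R in \<open>simp_all add: z_def\<close>)
        also have "\<dots> \<le> \<epsilon>1 * (C * norm (a i - b i))"
          by (intro mult_left_mono C(2)) (use na nb s t e1 in simp_all)
        finally show "norm (c i *\<^sub>R (F (\<Phi> s (a i)) - F (\<Phi> s (b i)) - D z (\<Phi> s (a i) - \<Phi> s (b i)))) \<le> \<bar>c i\<bar> * (\<epsilon>1 * (C * norm (a i - b i)))"
          by (simp add: mult_left_mono)
      qed
      also have "\<dots> = \<epsilon>1 * C * S" by (simp add: S_def sum_distrib_left mult_ac)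
      finally show "norm (e' s) \<le> M * norm (e s) + \<epsilon>1 * C * S" by simp
    qed (use M e1 C S in auto)
    also have "e 0 = 0" using s0 by (simp add: e_def)
    also have "(norm (0::'a) + (\<epsilon>1 * C * S) * t) * exp (M * t) \<le> (\<epsilon>1 * C * S) * (T + 1) * exp (M * T)"
      by (intro mult_mono add_nonneg_nonneg mult_nonneg_nonneg) (use t M e1 C S assms in \<open>auto intro!: mult_left_mono\<close>)
    also have "\<dots> = (\<epsilon>1 * (C * (T + 1) * exp (M * T))) * S" by (simp add: mult_ac)
    also have "\<dots> = \<epsilon> * S" using assms C by (simp add: \<epsilon>1_def)
    finally show "norm (\<Sum>i<n. c i *\<^sub>R (\<Phi> t (a i) - \<Phi> t (b i))) \<le> \<epsilon> * (\<Sum>i<n. \<bar>c i\<bar> * norm (a i - b i))"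
      by (simp add: e_def S_def)
  qed
qed

end

lemma ex_small_scaleR:
  fixes v :: "'a::real_normed_vector"
  assumes "d > 0"
  obtains s where "s > 0" "norm (s *\<^sub>R v) < d"
proof (rule that[of "d / (norm v + 1)"])
  have pos: "norm v + 1 > 0" by (simp add: add_nonneg_pos)
  then show s: "d / (norm v + 1) > 0" using assms by simp
  have "norm ((d / (norm v + 1)) *\<^sub>R v) = d / (norm v + 1) * norm v"
    unfolding norm_scaleR abs_of_pos[OF s] ..
  also have "\<dots> < d / (norm v + 1) * (norm v + 1)" using s by (intro mult_strict_left_mono) auto
  finally show "norm ((d / (norm v + 1)) *\<^sub>R v) < d" using pos by simp
qed

section \<open>Differentiability of the flow maps and their derivative cocycle\<close>

context C1_flow
begin

text \<open>One pattern for three uses: quotients of different step (Cauchy property), quotients in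
  the directions \<open>v\<close>, \<open>w\<close> and a linear combination of them (linearity),
  and an increment between two other points against a quotient at \<open>x\<close> (strict
  differentiability). The last use needs \<open>b1\<close> different from \<open>b\<close>.\<close>

lemma flow_strict_combination3:
  assumes "0 \<le> t" "\<epsilon> > 0"
  shows "\<exists>\<delta>>0. \<forall>x\<in>cball 0 r. \<forall>a1\<in>ball x \<delta>. \<forall>a2\<in>ball x \<delta>. \<forall>a3\<in>ball x \<delta>. \<forall>b1\<in>ball x \<delta>. \<forall>b\<in>ball x \<delta>. \<forall>c1 c2 c3.
      c1 *\<^sub>R (a1 - b1) + c2 *\<^sub>R (a2 - b) + c3 *\<^sub>R (a3 - b) = 0 \<longrightarrow>
      norm (c1 *\<^sub>R (\<Phi> t a1 - \<Phi> t b1) + c2 *\<^sub>R (\<Phi> t a2 - \<Phi> t b) + c3 *\<^sub>R (\<Phi> t a3 - \<Phi> t b))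
        \<le> \<epsilon> * (\<bar>c1\<bar> * norm (a1 - b1) + \<bar>c2\<bar> * norm (a2 - b) + \<bar>c3\<bar> * norm (a3 - b))"
proof (rule flow_strict_combination[OF assms, of r 3])
  fix \<delta> :: real
  assume d: "\<delta> > 0" and comb:
    "\<And>x a b c s. \<lbrakk>x \<in> cball 0 r; \<And>i. i < 3 \<Longrightarrow> dist (a i) x < \<delta>; \<And>i. i < 3 \<Longrightarrow> dist (b i) x < \<delta>;
        (\<Sum>i<3. c i *\<^sub>R (a i - b i)) = 0; 0 \<le> s; s \<le> t\<rbrakk>
      \<Longrightarrow> norm (\<Sum>i<3. c i *\<^sub>R (\<Phi> s (a i) - \<Phi> s (b i))) \<le> \<epsilon> * (\<Sum>i<(3::nat). \<bar>c i\<bar> * norm (a i - b i))"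
  have three: "(\<Sum>i<3. f i) = f 0 + f 1 + f 2" for f :: "nat \<Rightarrow> 'z::comm_monoid_add"
    by (simp add: eval_nat_numeral)
  have all3: "P ([u, v, w] ! i)" if "P u" "P v" "P w" "i < 3" for P and u v w :: 'a and i
    using that by (auto simp: less_Suc_eq eval_nat_numeral)
  show ?thesis
  proof (intro exI[of _ \<delta>] conjI d ballI allI impI)
    fix x a1 a2 a3 b1 b :: 'a and c1 c2 c3 :: real
    assume A: "x \<in> cball 0 r" "a1 \<in> ball x \<delta>" "a2 \<in> ball x \<delta>" "a3 \<in> ball x \<delta>" "b1 \<in> ball x \<delta>" "b \<in> ball x \<delta>"
        "c1 *\<^sub>R (a1 - b1) + c2 *\<^sub>R (a2 - b) + c3 *\<^sub>R (a3 - b) = 0"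
    show "norm (c1 *\<^sub>R (\<Phi> t a1 - \<Phi> t b1) + c2 *\<^sub>R (\<Phi> t a2 - \<Phi> t b) + c3 *\<^sub>R (\<Phi> t a3 - \<Phi> t b))
        \<le> \<epsilon> * (\<bar>c1\<bar> * norm (a1 - b1) + \<bar>c2\<bar> * norm (a2 - b) + \<bar>c3\<bar> * norm (a3 - b))"
      using comb[of x "\<lambda>i. [a1, a2, a3] ! i" "\<lambda>i. [b1, b, b] ! i" "\<lambda>i. [c1, c2, c3] ! i" t] A assms(1)
        all3[of "\<lambda>y. dist y x < \<delta>"]
      unfolding three by (simp add: dist_commute)
  qed
qed

text \<open>The derivative is the limit of difference quotients of step \<open>1 / Suc j\<close>.
  Convergence, linearity and the strict estimate each say that a combination of flow increments is
  small when the same combination of initial increments vanishes.\<close>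

lemma flow_strictly_differentiable_nonneg:
  assumes "0 \<le> t"
  shows "\<exists>D. (\<forall>x. linear (D x)) \<and> (\<forall>r. \<forall>\<epsilon>>0. \<exists>\<delta>>0. \<forall>x\<in>cball 0 r. \<forall>a\<in>ball x \<delta>. \<forall>b\<in>ball x \<delta>.
           norm (\<Phi> t a - \<Phi> t b - D x (a - b)) \<le> \<epsilon> * norm (a - b))"
proof -
  define k where "k j = real (Suc j)" for j
  have k: "k j > 0" "k j \<noteq> 0" "\<bar>k j\<bar> = k j" for j by (simp_all add: k_def)
  define q where "q x v j = k j *\<^sub>R (\<Phi> t (x + (1 / k j) *\<^sub>R v) - \<Phi> t x)" for x v j
  have near: "\<forall>\<^sub>F j in sequentially. x + (1 / k j) *\<^sub>R v \<in> ball x \<delta>" if "\<delta> > 0" for x v :: 'a and \<delta>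
  proof -
    have "(\<lambda>j. inverse (real (Suc j)) *\<^sub>R v) \<longlonglongrightarrow> 0 *\<^sub>R v" 
      by (intro tendsto_intros LIMSEQ_inverse_real_of_nat)
    then have "(\<lambda>j. x + inverse (real (Suc j)) *\<^sub>R v) \<longlonglongrightarrow> x + 0 *\<^sub>R v"
      by (rule tendsto_add[OF tendsto_const])
    then have "(\<lambda>j. x + (1 / k j) *\<^sub>R v) \<longlonglongrightarrow> x" unfolding k_def inverse_eq_divide by simp
    then show ?thesis using that by (auto dest!: tendstoD simp: dist_commute)
  qed
  have Cau: "Cauchy (q x v)" for x v
  proof (rule metric_CauchyI)
    fix \<eta> :: real assume \<eta>: "\<eta> > 0"
    define \<epsilon> where "\<epsilon> = \<eta> / (2 * norm v + 1)"
    have e: "\<epsilon> > 0" using \<eta> by (simp add: \<epsilon>_def add_nonneg_pos)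
    from flow_strict_combination3[OF assms e, of "norm x"]
    obtain \<delta> where d: "\<delta> > 0" and comb: "\<And>x' a1 a2 a3 b1 b c1 c2 c3. \<lbrakk>x' \<in> cball 0 (norm x);
        a1 \<in> ball x' \<delta>; a2 \<in> ball x' \<delta>; a3 \<in> ball x' \<delta>; b1 \<in> ball x' \<delta>; b \<in> ball x' \<delta>;
        c1 *\<^sub>R (a1 - b1) + c2 *\<^sub>R (a2 - b) + c3 *\<^sub>R (a3 - b) = 0\<rbrakk> \<Longrightarrow>
      norm (c1 *\<^sub>R (\<Phi> t a1 - \<Phi> t b1) + c2 *\<^sub>R (\<Phi> t a2 - \<Phi> t b) + c3 *\<^sub>R (\<Phi> t a3 - \<Phi> t b))
        \<le> \<epsilon> * (\<bar>c1\<bar> * norm (a1 - b1) + \<bar>c2\<bar> * norm (a2 - b) + \<bar>c3\<bar> * norm (a3 - b))"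
      by (elim exE conjE) blast
    obtain N where N: "\<And>j. j \<ge> N \<Longrightarrow> x + (1 / k j) *\<^sub>R v \<in> ball x \<delta>"
      using near[OF d] unfolding eventually_sequentially by blast
    show "\<exists>M. \<forall>m\<ge>M. \<forall>n\<ge>M. dist (q x v m) (q x v n) < \<eta>"
    proof (intro exI[of _ N] allI impI)
      fix m n assume mn: "m \<ge> N" "n \<ge> N"
      \<comment> \<open>\<open>k m\<close> times the first initial increment and \<open>k n\<close>
        times the second both equal \<open>v\<close>, so the combination vanishes.\<close>
      have "dist (q x v m) (q x v n) \<le> \<epsilon> * (norm v + norm v)"
        using comb[of x "x + (1 / k m) *\<^sub>R v" "x + (1 / k n) *\<^sub>R v" x x x "k m" "- k n" 0] N[OF mn(1)] N[OF mn(2)] d k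
        by (simp add: q_def dist_norm)
      also have "\<dots> < \<epsilon> * (2 * norm v + 1)" using e by (intro mult_strict_left_mono) auto
      also have "\<dots> = \<eta>" unfolding \<epsilon>_def using norm_ge_zero[of v] by (simp add: add_nonneg_eq_0_iff)
      finally show "dist (q x v m) (q x v n) < \<eta>" .
    qed
  qed
  define D where "D x v = lim (q x v)" for x v
  have D: "q x v \<longlonglongrightarrow> D x v" for x v
    unfolding D_def using Cau by (simp add: Cauchy_convergent_iff convergent_LIMSEQ_iff)
  have lin2: "D x (c *\<^sub>R v + d *\<^sub>R w) = c *\<^sub>R D x v + d *\<^sub>R D x w" for x v w c d
  proof -
    define M where "M = norm (c *\<^sub>R v + d *\<^sub>R w) + \<bar>c\<bar> * norm v + \<bar>d\<bar> * norm w"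
    have "(\<lambda>j. q x (c *\<^sub>R v + d *\<^sub>R w) j - c *\<^sub>R q x v j - d *\<^sub>R q x w j) \<longlonglongrightarrow> 0"
      unfolding tendsto_iff
    proof (intro allI impI)
      fix \<eta> :: real assume \<eta>: "\<eta> > 0"
      define \<epsilon> where "\<epsilon> = \<eta> / (M + 1)"
      have M: "M \<ge> 0" by (simp add: M_def)
      then have e: "\<epsilon> > 0" using \<eta> by (simp add: \<epsilon>_def)
      from flow_strict_combination3[OF assms e, of "norm x"]
    obtain \<delta> where dl: "\<delta> > 0" and comb: "\<And>x' a1 a2 a3 b1 b c1 c2 c3. \<lbrakk>x' \<in> cball 0 (norm x);
        a1 \<in> ball x' \<delta>; a2 \<in> ball x' \<delta>; a3 \<in> ball x' \<delta>; b1 \<in> ball x' \<delta>; b \<in> ball x' \<delta>;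
        c1 *\<^sub>R (a1 - b1) + c2 *\<^sub>R (a2 - b) + c3 *\<^sub>R (a3 - b) = 0\<rbrakk> \<Longrightarrow>
      norm (c1 *\<^sub>R (\<Phi> t a1 - \<Phi> t b1) + c2 *\<^sub>R (\<Phi> t a2 - \<Phi> t b) + c3 *\<^sub>R (\<Phi> t a3 - \<Phi> t b))
        \<le> \<epsilon> * (\<bar>c1\<bar> * norm (a1 - b1) + \<bar>c2\<bar> * norm (a2 - b) + \<bar>c3\<bar> * norm (a3 - b))"
      by (elim exE conjE) blast
      show "\<forall>\<^sub>F j in sequentially. dist (q x (c *\<^sub>R v + d *\<^sub>R w) j - c *\<^sub>R q x v j - d *\<^sub>R q x w j) 0 < \<eta>"
        using near[OF dl, of x "c *\<^sub>R v + d *\<^sub>R w"] near[OF dl, of x v] near[OF dl, of x w]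
      proof eventually_elim
        case (elim j)
        define u where "u = c *\<^sub>R v + d *\<^sub>R w"
        let ?p = "\<lambda>y. x + (1 / k j) *\<^sub>R y"
        have z: "k j *\<^sub>R (?p u - x) + (- (c * k j)) *\<^sub>R (?p v - x) + (- (d * k j)) *\<^sub>R (?p w - x) = 0"
          using k[of j] by (simp add: u_def algebra_simps)
        have n: "norm (?p y - x) = norm y / k j" for y using k[of j] by simp
        have x: "x \<in> cball 0 (norm x)" "x \<in> ball x \<delta>" using dl by auto
        have "q x u j - c *\<^sub>R q x v j - d *\<^sub>R q x w j = k j *\<^sub>R (\<Phi> t (?p u) - \<Phi> t x)
            + (- (c * k j)) *\<^sub>R (\<Phi> t (?p v) - \<Phi> t x) + (- (d * k j)) *\<^sub>R (\<Phi> t (?p w) - \<Phi> t x)"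
          by (simp add: q_def algebra_simps)
        also have "norm \<dots> \<le> \<epsilon> * (\<bar>k j\<bar> * norm (?p u - x) + \<bar>- (c * k j)\<bar> * norm (?p v - x) + \<bar>- (d * k j)\<bar> * norm (?p w - x))"
          using comb[OF x(1) _ _ _ x(2) x(2) z] elim by (simp only: u_def)
        also have "\<dots> = \<epsilon> * M"
          unfolding n using k[of j] by (simp add: M_def u_def abs_mult)
        finally have "norm (q x u j - c *\<^sub>R q x v j - d *\<^sub>R q x w j) \<le> \<epsilon> * M" .
        then have "norm (q x (c *\<^sub>R v + d *\<^sub>R w) j - c *\<^sub>R q x v j - d *\<^sub>R q x w j) \<le> \<epsilon> * M"
          by (simp only: u_def)
        also have "\<dots> < \<eta>" unfolding \<epsilon>_def using \<eta> M by (simp add: field_simps)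
        finally show ?case by simp
      qed
    qed
    moreover have "(\<lambda>j. q x (c *\<^sub>R v + d *\<^sub>R w) j - c *\<^sub>R q x v j - d *\<^sub>R q x w j)
        \<longlonglongrightarrow> D x (c *\<^sub>R v + d *\<^sub>R w) - c *\<^sub>R D x v - d *\<^sub>R D x w"
      by (intro tendsto_diff tendsto_scaleR tendsto_const D)
    ultimately have "D x (c *\<^sub>R v + d *\<^sub>R w) - c *\<^sub>R D x v - d *\<^sub>R D x w = 0"
      by (rule LIMSEQ_unique[rotated])
    then show ?thesis unfolding diff_diff_eq by simp
  qed
  have lin: "linear (D x)" for x
  proof (rule linearI)
    show "D x (v + w) = D x v + D x w" for v w using lin2[of x 1 v 1 w] by simp
    show "D x (c *\<^sub>R v) = c *\<^sub>R D x v" for c v using lin2[of x c v 0 v] by simp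
  qed
  show ?thesis
  proof (intro exI[of _ D] conjI allI impI lin)
    fix r \<epsilon> :: real assume "\<epsilon> > 0"
    then have e2: "\<epsilon> / 2 > 0" by simp
    from flow_strict_combination3[OF assms e2, of r]
    obtain \<delta> where dl: "\<delta> > 0" and comb: "\<And>x' a1 a2 a3 b1 b c1 c2 c3. \<lbrakk>x' \<in> cball 0 (r);
        a1 \<in> ball x' \<delta>; a2 \<in> ball x' \<delta>; a3 \<in> ball x' \<delta>; b1 \<in> ball x' \<delta>; b \<in> ball x' \<delta>;
        c1 *\<^sub>R (a1 - b1) + c2 *\<^sub>R (a2 - b) + c3 *\<^sub>R (a3 - b) = 0\<rbrakk> \<Longrightarrow>
      norm (c1 *\<^sub>R (\<Phi> t a1 - \<Phi> t b1) + c2 *\<^sub>R (\<Phi> t a2 - \<Phi> t b) + c3 *\<^sub>R (\<Phi> t a3 - \<Phi> t b))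
        \<le> \<epsilon> / 2 * (\<bar>c1\<bar> * norm (a1 - b1) + \<bar>c2\<bar> * norm (a2 - b) + \<bar>c3\<bar> * norm (a3 - b))"
      by (elim exE conjE) blast
    show "\<exists>\<delta>>0. \<forall>x\<in>cball 0 r. \<forall>a\<in>ball x \<delta>. \<forall>b\<in>ball x \<delta>. norm (\<Phi> t a - \<Phi> t b - D x (a - b)) \<le> \<epsilon> * norm (a - b)"
    proof (intro exI[of _ \<delta>] conjI dl ballI)
      fix x a b :: 'a assume x: "x \<in> cball 0 r" and ab: "a \<in> ball x \<delta>" "b \<in> ball x \<delta>"
      have lim: "(\<lambda>j. norm (\<Phi> t a - \<Phi> t b - q x (a - b) j)) \<longlonglongrightarrow> norm (\<Phi> t a - \<Phi> t b - D x (a - b))"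
        by (intro tendsto_norm tendsto_diff tendsto_const D)
      have "\<forall>\<^sub>F j in sequentially. norm (\<Phi> t a - \<Phi> t b - q x (a - b) j) \<le> \<epsilon> * norm (a - b)"
        using near[OF dl, of x "a - b"]
      proof eventually_elim
        case (elim j)
        \<comment> \<open>The increment \<open>a - b\<close> with weight 1 and the quotient
          increment with weight \<open>- k j\<close> each contribute \<open>norm (a - b)\<close>;
          hence the halved \<open>\<epsilon>\<close>.\<close>
        then show ?case
          using comb[OF x ab(1) elim _ ab(2), of x x 1 "- k j" 0] k[of j] dl by (simp add: q_def)
      qed
      then show "norm (\<Phi> t a - \<Phi> t b - D x (a - b)) \<le> \<epsilon> * norm (a - b)"
        by (rule tendsto_upperbound[OF lim]) simp
    qed
  qed
qed

text \<open>This is the expression inside \<open>Sacker_Sell_resolvent\<close>, so the resolvent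
  hypothesis applies after unfolding.\<close>

definition DP :: "real \<Rightarrow> 'a \<Rightarrow> 'a \<Rightarrow> 'a" where
  "DP t x = frechet_derivative (\<Phi> t) (at x)"

end

context C1_flow
begin

interpretation rev: C1_flow "\<lambda>x. - F x" "\<lambda>t. \<Phi> (- t)" by (rule reverse)

lemma flow_strictly_differentiable_ex:
  "\<exists>D. (\<forall>x. linear (D x)) \<and> (\<forall>r. \<forall>\<epsilon>>0. \<exists>\<delta>>0. \<forall>x\<in>cball 0 r. \<forall>a\<in>ball x \<delta>. \<forall>b\<in>ball x \<delta>.
           norm (\<Phi> t a - \<Phi> t b - D x (a - b)) \<le> \<epsilon> * norm (a - b))"
  using flow_strictly_differentiable_nonneg[of t] rev.flow_strictly_differentiable_nonneg[of "- t"]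
  by (cases "0 \<le> t") simp_all

text \<open>Uniqueness of the Frechet derivative identifies the limit of quotients with
  \<open>DP\<close>. The uniform estimate serves twice: for continuity of \<open>DP\<close> in the
  base point, and for the small Lipschitz constant in the shadowing argument.\<close>

lemma flow_has_derivative_strict:
  shows flow_has_derivative: "(\<Phi> t has_derivative DP t x) (at x)"
    and flow_strictly_differentiable: "\<epsilon> > 0 \<Longrightarrow> \<exists>\<delta>>0. \<forall>x\<in>cball 0 r. \<forall>a\<in>ball x \<delta>. \<forall>b\<in>ball x \<delta>.
           norm (\<Phi> t a - \<Phi> t b - DP t x (a - b)) \<le> \<epsilon> * norm (a - b)"
proof -
  obtain D where lin: "\<And>x. linear (D x)" and D: "\<And>r \<epsilon>. \<epsilon> > 0 \<Longrightarrow> \<exists>\<delta>>0. \<forall>x\<in>cball 0 r. \<forall>a\<in>ball x \<delta>. \<forall>b\<in>ball x \<delta>.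
           norm (\<Phi> t a - \<Phi> t b - D x (a - b)) \<le> \<epsilon> * norm (a - b)"
    using flow_strictly_differentiable_ex[of t] by metis
  have der: "(\<Phi> t has_derivative D x) (at x)" for x
    unfolding has_derivative_at_alt
  proof (intro conjI allI impI)
    show "bounded_linear (D x)" using lin by (simp add: linear_conv_bounded_linear)
    fix e :: real assume "e > 0"
    obtain \<delta> where d: "\<delta> > 0" "\<And>a b. a\<in>ball x \<delta> \<Longrightarrow> b\<in>ball x \<delta> \<Longrightarrow> norm (\<Phi> t a - \<Phi> t b - D x (a - b)) \<le> e * norm (a - b)"
      using D[OF \<open>e > 0\<close>, of "norm x"] by auto
    then show "\<exists>d>0. \<forall>y. norm (y - x) < d \<longrightarrow> norm (\<Phi> t y - \<Phi> t x - D x (y - x)) \<le> e * norm (y - x)"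
      by (intro exI[of _ \<delta>]) (auto simp: dist_norm norm_minus_commute)
  qed
  then have eq: "DP t x = D x" for x
    unfolding DP_def by (metis frechet_derivative_at)
  show "(\<Phi> t has_derivative DP t x) (at x)" using der eq by simp
  show "\<epsilon> > 0 \<Longrightarrow> \<exists>\<delta>>0. \<forall>x\<in>cball 0 r. \<forall>a\<in>ball x \<delta>. \<forall>b\<in>ball x \<delta>.
           norm (\<Phi> t a - \<Phi> t b - DP t x (a - b)) \<le> \<epsilon> * norm (a - b)"
    using D eq by simp
qed

lemma linear_DP: "linear (DP t x)"
  using flow_has_derivative has_derivative_linear by blast

lemma DP_0: "DP 0 x v = v"
proof -
  have "\<Phi> 0 = (\<lambda>x. x)" by (simp add: fun_eq_iff)
  then show ?thesis by (simp add: DP_def frechet_derivative_ident)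
qed

lemma DP_add: "DP (t + s) x v = DP t (\<Phi> s x) (DP s x v)"
proof -
  have "(\<Phi> t \<circ> \<Phi> s has_derivative DP t (\<Phi> s x) \<circ> DP s x) (at x)"
    by (rule diff_chain_at[OF flow_has_derivative flow_has_derivative])
  moreover have "\<Phi> t \<circ> \<Phi> s = \<Phi> (t + s)" by (simp add: fun_eq_iff flow_add)
  ultimately show ?thesis using frechet_derivative_at unfolding DP_def by (metis comp_apply)
qed

lemma DP_inverse[simp]: "DP (- t) (\<Phi> t x) (DP t x v) = v" "DP t (\<Phi> (- t) x) (DP (- t) x v) = v"
  by (simp_all flip: DP_add add: DP_0)

lemma continuous_flow: "isCont (\<Phi> t) x"
  using flow_has_derivative has_derivative_continuous by blast

text \<open>A Lipschitz constant of the flow bounds its derivative. The radius \<open>d\<close>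
  depends on \<open>t\<close> and \<open>x\<close>, but the vector is scaled into it and the scale
  cancels by linearity, so the constant is uniform.\<close>

lemma DP_bounded:
  assumes "0 \<le> T"
  obtains C where "C > 0" "\<And>x t v. x \<in> cball 0 r \<Longrightarrow> 0 \<le> t \<Longrightarrow> t \<le> T \<Longrightarrow> norm (DP t x v) \<le> C * norm v"
proof -
  obtain C where C: "C > 0"
    "\<And>a b t. a \<in> cball 0 (r+1) \<Longrightarrow> b \<in> cball 0 (r+1) \<Longrightarrow> 0 \<le> t \<Longrightarrow> t \<le> T \<Longrightarrow> norm (\<Phi> t a - \<Phi> t b) \<le> C * norm (a - b)"
    using flow_lipschitz[OF assms] by blast
  show thesis
  proof (rule that)
    show "C + 1 > 0" using C by simp
    fix x v :: 'a and t :: real assume x: "x \<in> cball 0 r" and t: "0 \<le> t" "t \<le> T"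
    obtain d where d: "d > 0" "\<forall>y\<in>cball 0 (norm x). \<forall>a\<in>ball y d. \<forall>b\<in>ball y d.
           norm (\<Phi> t a - \<Phi> t b - DP t y (a - b)) \<le> 1 * norm (a - b)"
      using flow_strictly_differentiable[of 1 "norm x" t] by auto
    have "min d 1 > 0" using d(1) by simp
    from ex_small_scaleR[OF this, of v] obtain s where s: "s > 0" and "norm (s *\<^sub>R v) < min d 1" .
    then have small: "norm (s *\<^sub>R v) < d" "norm (s *\<^sub>R v) < 1" by (simp_all only: min_less_iff_conj)
    have "norm (x + s *\<^sub>R v) \<le> norm x + norm (s *\<^sub>R v)" by (rule norm_triangle_ineq)
    then have "norm (\<Phi> t (x + s *\<^sub>R v) - \<Phi> t x) \<le> C * norm (x + s *\<^sub>R v - x)"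
      using C(2)[of "x + s *\<^sub>R v" x t] small x t by simp
    moreover have "norm (\<Phi> t (x + s *\<^sub>R v) - \<Phi> t x - DP t x (s *\<^sub>R v)) \<le> norm (s *\<^sub>R v)"
      using d(2)[rule_format, of x "x + s *\<^sub>R v" x] d(1) small by (simp add: dist_norm del: norm_scaleR)
    ultimately have "norm (DP t x (s *\<^sub>R v)) \<le> (C + 1) * norm (s *\<^sub>R v)"
      using norm_triangle_ineq3[of "\<Phi> t (x + s *\<^sub>R v) - \<Phi> t x" "DP t x (s *\<^sub>R v)"] by (simp add: algebra_simps)
    then show "norm (DP t x v) \<le> (C + 1) * norm v"
      using s linear_scale[OF linear_DP, of t x s v] by (simp add: mult.left_commute)
  qed
qed

text \<open>\<open>DP t (x n)\<close> and \<open>DP t x0\<close> both approximate the same small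
  increments of the flow near \<open>x0\<close>, hence are close in operator norm; this replaces an
  appeal to the variational equation.\<close>

lemma DP_tendsto:
  assumes x: "x \<longlonglongrightarrow> x0" and v: "v \<longlonglongrightarrow> v0"
  shows "(\<lambda>n. DP t (x n) (v n)) \<longlonglongrightarrow> DP t x0 v0"
proof -
  have op: "(\<lambda>n. onorm (\<lambda>w. DP t (x n) w - DP t x0 w)) \<longlonglongrightarrow> 0"
    unfolding tendsto_iff
  proof (intro allI impI)
    fix \<eta> :: real assume "\<eta> > 0"
    \<comment> \<open>Two approximations with error \<open>\<eta> / 4\<close> give an operator
      distance at most \<open>\<eta> / 2\<close>, strictly below \<open>\<eta>\<close>.\<close>
    then have e: "\<eta> / 4 > 0" by simp
    obtain d where d: "d > 0" and D: "\<And>y a b. y\<in>cball 0 (norm x0 + 1) \<Longrightarrow> a\<in>ball y d \<Longrightarrow> b\<in>ball y d \<Longrightarrow>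
           norm (\<Phi> t a - \<Phi> t b - DP t y (a - b)) \<le> \<eta>/4 * norm (a - b)"
      using flow_strictly_differentiable[OF e, of "norm x0 + 1" t] by auto
    have "\<forall>\<^sub>F n in sequentially. dist (x n) x0 < min d 1 / 2" using tendstoD[OF x, of "min d 1 / 2"] d by simp
    then show "\<forall>\<^sub>F n in sequentially. dist (onorm (\<lambda>w. DP t (x n) w - DP t x0 w)) 0 < \<eta>"
    proof eventually_elim
      case (elim n)
      have "norm (DP t (x n) w - DP t x0 w) \<le> \<eta>/2 * norm w" for w
      proof -
        from ex_small_scaleR[OF half_gt_zero[OF d], of w]
        obtain s where s: "s > 0" and sw: "norm (s *\<^sub>R w) < d / 2" .
        define a where "a = x n + s *\<^sub>R w"
        have "dist a x0 \<le> norm (s *\<^sub>R w) + dist (x n) x0" 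
          using norm_triangle_ineq[of "s *\<^sub>R w" "x n - x0"] by (simp add: a_def dist_norm algebra_simps)
        then have a: "a \<in> ball x0 d" "a \<in> ball (x n) d" "x n \<in> ball x0 d" "x n \<in> ball (x n) d"
          using sw elim d by (auto simp: dist_norm norm_minus_commute a_def)
        have "norm (x n) \<le> dist (x n) x0 + norm x0" unfolding dist_norm by norm
        then have xn: "x n \<in> cball 0 (norm x0 + 1)" using elim by simp
        have tri: "norm (u - u') \<le> e1 + e2" if "norm (y - u) \<le> e1" "norm (y - u') \<le> e2" for y u u' :: 'a and e1 e2
          using that by norm
        have "norm (\<Phi> t a - \<Phi> t (x n) - DP t (x n) (s *\<^sub>R w)) \<le> \<eta>/4 * norm (s *\<^sub>R w)"
          using D[OF xn a(2) a(4)] by (simp add: a_def)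
        moreover have "norm (\<Phi> t a - \<Phi> t (x n) - DP t x0 (s *\<^sub>R w)) \<le> \<eta>/4 * norm (s *\<^sub>R w)"
          using D[OF _ a(1) a(3)] by (simp add: a_def)
        ultimately have "norm (DP t (x n) (s *\<^sub>R w) - DP t x0 (s *\<^sub>R w)) \<le> \<eta>/4 * norm (s *\<^sub>R w) + \<eta>/4 * norm (s *\<^sub>R w)"
          by (rule tri)
        then have "s * norm (DP t (x n) w - DP t x0 w) \<le> s * (\<eta>/2 * norm w)"
          using s by (simp add: linear_scale[OF linear_DP] flip: scaleR_diff_right)
        then show ?thesis using s by simp
      qed
      then have "onorm (\<lambda>w. DP t (x n) w - DP t x0 w) \<le> \<eta>/2" using \<open>\<eta> > 0\<close> by (intro onorm_bound) auto
      moreover have "0 \<le> onorm (\<lambda>w. DP t (x n) w - DP t x0 w)"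
        by (intro onorm_pos_le bounded_linear_sub) (simp_all add: linear_DP linear_conv_bounded_linear[symmetric])
      ultimately show ?case using \<open>\<eta> > 0\<close> by simp
    qed
  qed
  have bl: "bounded_linear (\<lambda>w. DP t (x n) w - DP t x0 w)" for n
    by (intro bounded_linear_sub) (simp_all add: linear_DP linear_conv_bounded_linear[symmetric])
  have "(\<lambda>n. DP t (x n) (v n) - DP t x0 (v n)) \<longlonglongrightarrow> 0"
  proof (rule Lim_null_comparison)
    show "\<forall>\<^sub>F n in sequentially. norm (DP t (x n) (v n) - DP t x0 (v n)) \<le> onorm (\<lambda>w. DP t (x n) w - DP t x0 w) * norm (v n)"
      using onorm[OF bl] by auto
    show "(\<lambda>n. onorm (\<lambda>w. DP t (x n) w - DP t x0 w) * norm (v n)) \<longlonglongrightarrow> 0"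
      using tendsto_mult[OF op tendsto_norm[OF v]] by simp
  qed
  moreover have "(\<lambda>n. DP t x0 (v n)) \<longlonglongrightarrow> DP t x0 v0"
    using linear_continuous_at[of "DP t x0" v0] linear_DP[of t x0] v
    by (metis isCont_tendsto_compose linear_conv_bounded_linear)
  ultimately show ?thesis using tendsto_add by fastforce
qed

end

section \<open>Bounded solutions of nonautonomous linear recursions\<close>

primrec cocycle :: "(nat \<Rightarrow> 'a \<Rightarrow> 'a) \<Rightarrow> nat \<Rightarrow> nat \<Rightarrow> 'a \<Rightarrow> 'a" where
  "cocycle A m 0 v = v"
| "cocycle A m (Suc i) v = A (m + i) (cocycle A m i v)"

text \<open>\<open>contract\<close> is Coppel's condition, asked only for \<open>W \<le> n\<close>,
  where the left half of the window exists. Its solutions continue beyond the window, which loses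
  nothing because the recursion can always be run forward.\<close>

locale hyperbolic_sequence =
  fixes A :: "nat \<Rightarrow> 'a::euclidean_space \<Rightarrow> 'a" and \<Lambda> :: real and W :: nat
  assumes linear_A: "linear (A n)" and surj_A: "surj (A n)"
    and A_le: "norm (A n v) \<le> \<Lambda> * norm v" and \<Lambda>_ge_1: "1 \<le> \<Lambda>"
    and contract: "\<lbrakk>W \<le> n; \<And>k. n - W \<le> k \<Longrightarrow> u (Suc k) = A k (u k);
        \<And>k. n - W \<le> k \<Longrightarrow> k \<le> n + W \<Longrightarrow> norm (u k) \<le> B\<rbrakk> \<Longrightarrow> norm (u n) \<le> B / 2"
begin

lemma linear_cocycle: "linear (cocycle A m i)"
proof (induction i)
  case (Suc i)
  have eq: "cocycle A m (Suc i) = A (m + i) \<circ> cocycle A m i" by (simp add: fun_eq_iff)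
  show ?case unfolding eq by (rule linear_compose[OF Suc linear_A])
qed (simp add: linear_iff)

lemma surj_cocycle: "surj (cocycle A m i)"
proof (induction i)
  case (Suc i)
  have eq: "cocycle A m (Suc i) = A (m + i) \<circ> cocycle A m i" by (simp add: fun_eq_iff)
  show ?case unfolding eq by (rule comp_surj[OF Suc surj_A])
qed (simp add: surj_def)

text \<open>Discrete Gronwall: each of the \<open>i\<close> forcing terms is amplified by at most
  \<open>\<Lambda> ^ i\<close>, as \<open>1 \<le> \<Lambda>\<close>.\<close>

lemma perturbation_bound:
  assumes u: "\<And>j. j < i \<Longrightarrow> u (Suc (m + j)) = A (m + j) (u (m + j)) + g (m + j)"
    and g: "\<And>j. j < i \<Longrightarrow> norm (g (m + j)) \<le> \<gamma>" and "0 \<le> \<gamma>"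
  shows "norm (u (m + i) - cocycle A m i (u m)) \<le> i * \<Lambda> ^ i * \<gamma>"
  using u g
proof (induction i)
  case (Suc i)
  have "u (m + Suc i) - cocycle A m (Suc i) (u m) = A (m + i) (u (m + i) - cocycle A m i (u m)) + g (m + i)"
    using Suc.prems(1)[of i] by (simp add: linear_diff[OF linear_A])
  also have "norm \<dots> \<le> \<Lambda> * norm (u (m + i) - cocycle A m i (u m)) + \<gamma>"
    using norm_triangle_ineq A_le Suc.prems(2)[of i] by (smt (verit) lessI)
  also have "\<dots> \<le> \<Lambda> * (i * \<Lambda> ^ i * \<gamma>) + \<Lambda> ^ Suc i * \<gamma>"
    using Suc \<Lambda>_ge_1 one_le_power[OF \<Lambda>_ge_1, of "Suc i"] mult_right_mono[OF _ \<open>0 \<le> \<gamma>\<close>, of 1 "\<Lambda> ^ Suc i"]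
    by (intro add_mono mult_left_mono) auto
  also have "\<dots> = Suc i * \<Lambda> ^ Suc i * \<gamma>" by (simp add: algebra_simps)
  finally show ?case .
qed simp

definition D :: real where "D = 2 * W * \<Lambda> ^ (2 * W)"

lemma D_ge_0: "0 \<le> D"
  using \<Lambda>_ge_1 by (simp add: D_def)

lemma perturbation_bound_D:
  assumes u: "\<And>n. u (Suc n) = A n (u n) + g n" and g: "\<And>n. norm (g n) \<le> \<gamma>" and "i \<le> 2 * W"
  shows "norm (u (m + i) - cocycle A m i (u m)) \<le> D * \<gamma>"
proof -
  have "0 \<le> \<gamma>" using g[of 0] norm_ge_zero order_trans by blast
  have "norm (u (m + i) - cocycle A m i (u m)) \<le> i * \<Lambda> ^ i * \<gamma>"
    using u g \<open>0 \<le> \<gamma>\<close> by (intro perturbation_bound[where g=g]) auto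
  also have "\<dots> \<le> (real (2 * W)) * \<Lambda> ^ (2 * W) * \<gamma>"
    using assms(3) \<Lambda>_ge_1 \<open>0 \<le> \<gamma>\<close> by (intro mult_right_mono mult_mono power_increasing) auto
  finally show ?thesis by (simp add: D_def)
qed

text \<open>Over one window \<open>u\<close> differs from a homogeneous solution by at most
  \<open>D * \<gamma>\<close>, and that solution is halved at the midpoint; before time
  \<open>W\<close> the initial value controls \<open>u\<close>. Boundedness of \<open>u\<close>
  makes the supremum \<open>B\<close> finite, so that \<open>B / 2\<close> can be absorbed.\<close>

lemma bounded_solution_estimate:
  assumes u: "\<And>n. u (Suc n) = A n (u n) + g n" and g: "\<And>n. norm (g n) \<le> \<gamma>"
    and bdd: "bounded (range u)"
  shows "norm (u n) \<le> \<Lambda> ^ W * norm (u 0) + 3 * D * \<gamma>"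
proof -
  have \<gamma>: "0 \<le> \<gamma>" using g[of 0] norm_ge_zero order_trans by blast
  define B where "B = (SUP n. norm (u n))"
  have bb: "bdd_above (range (\<lambda>n. norm (u n)))"
    using bdd unfolding bounded_iff bdd_above_def by auto
  then have B: "norm (u n) \<le> B" for n unfolding B_def by (rule cSUP_upper[OF UNIV_I])
  \<comment> \<open>Of the 3/2, one half comes from halving the bound
    \<open>B + D * \<gamma>\<close> of the comparison solution, and 1 from returning to
    \<open>u\<close>.\<close>
  have late: "norm (u n) \<le> B / 2 + 3 / 2 * D * \<gamma>" if n: "W \<le> n" for n
  proof -
    define m where "m = n - W"
    define h where "h k = cocycle A m (k - m) (u m)" for k
    have uh: "norm (u k - h k) \<le> D * \<gamma>" if "m \<le> k" "k \<le> n + W" for k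
      using perturbation_bound_D[OF u g, of "k - m" m] that by (simp add: h_def m_def)
    have "norm (h n) \<le> (B + D * \<gamma>) / 2"
    proof (rule contract[OF n])
      fix k assume k: "n - W \<le> k"
      then show "h (Suc k) = A k (h k)" by (simp add: h_def m_def Suc_diff_le)
      assume "k \<le> n + W"
      then have "norm (u k - h k) \<le> D * \<gamma>" using uh k by (simp add: m_def)
      then show "norm (h k) \<le> B + D * \<gamma>" using B[of k] norm_triangle_sub[of "h k" "u k"]
        by (simp add: norm_minus_commute)
    qed
    moreover have "norm (u n - h n) \<le> D * \<gamma>" using uh[of n] by (simp add: m_def)
    ultimately show ?thesis using norm_triangle_sub[of "u n" "h n"] by (simp add: field_simps)
  qed
  have early: "norm (u n) \<le> \<Lambda> ^ W * norm (u 0) + D * \<gamma>" if "n < W" for n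
  proof -
    have "norm (cocycle A 0 n v) \<le> \<Lambda> ^ n * norm v" for v
    proof (induction n)
      case (Suc n)
      have "norm (cocycle A 0 (Suc n) v) \<le> \<Lambda> * norm (cocycle A 0 n v)" using A_le by simp
      also have "\<dots> \<le> \<Lambda> * (\<Lambda> ^ n * norm v)" using Suc \<Lambda>_ge_1 by (intro mult_left_mono) auto
      finally show ?case by simp
    qed simp
    then have "norm (cocycle A 0 n (u 0)) \<le> \<Lambda> ^ W * norm (u 0)"
      using power_increasing[of n W \<Lambda>] that \<Lambda>_ge_1 by (meson less_imp_le mult_right_mono norm_ge_zero order_trans)
    moreover have "norm (u n - cocycle A 0 n (u 0)) \<le> D * \<gamma>"
      using perturbation_bound_D[OF u g, of n 0] that by simp
    ultimately show ?thesis using norm_triangle_sub[of "u n" "cocycle A 0 n (u 0)"] by simp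
  qed
  have D\<gamma>: "0 \<le> D * \<gamma>" using D_ge_0 \<gamma> by simp
  have L: "0 \<le> \<Lambda> ^ W * norm (u 0)" using \<Lambda>_ge_1 by simp
  have "B \<le> max (\<Lambda> ^ W * norm (u 0) + D * \<gamma>) (B / 2 + 3 / 2 * D * \<gamma>)"
    unfolding B_def
  proof (rule cSUP_least)
    fix n show "norm (u n) \<le> max (\<Lambda> ^ W * norm (u 0) + D * \<gamma>) ((SUP n. norm (u n)) / 2 + 3 / 2 * D * \<gamma>)"
      using early[of n] late[of n] by (fold B_def) linarith
  qed simp
  then have "B \<le> \<Lambda> ^ W * norm (u 0) + 3 * D * \<gamma>" using D\<gamma> L by linarith
  then show ?thesis using B order_trans by blast
qed

definition S :: "'a set" where
  "S = {v. bounded (range (\<lambda>i. cocycle A 0 i v))}"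

text \<open>A complement of \<open>S\<close> removes the freedom of adding bounded homogeneous
  solutions; the orthogonal one is visibly closed, so it survives limits.\<close>

definition U :: "'a set" where
  "U = {w. \<forall>v\<in>S. v \<bullet> w = 0}"

lemma subspace_S: "subspace S"
proof -
  have "bounded (range (\<lambda>i. cocycle A 0 i (v + w)))" if "v \<in> S" "w \<in> S" for v w
    using that bounded_plus_comp[of "\<lambda>i. cocycle A 0 i v" UNIV "\<lambda>i. cocycle A 0 i w"]
    by (simp add: S_def linear_add[OF linear_cocycle])
  moreover have "bounded (range (\<lambda>i. cocycle A 0 i (c *\<^sub>R v)))" if "v \<in> S" for c v
    using that bounded_scaling[of "range (\<lambda>i. cocycle A 0 i v)" c]
    by (simp add: S_def linear_scale[OF linear_cocycle] image_image)
  moreover have "0 \<in> S" by (simp add: S_def linear_0[OF linear_cocycle])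
  ultimately show ?thesis by (auto simp: subspace_def S_def)
qed

lemma decompose: obtains s w where "s \<in> S" "w \<in> U" "v = s + w"
proof -
  obtain s w where "s \<in> span S" "\<And>z. z \<in> span S \<Longrightarrow> orthogonal w z" "v = s + w"
    using orthogonal_subspace_decomp_exists[of S v] by blast
  then show thesis using that[of s w] subspace_S
    by (simp add: span_eq_iff[THEN iffD2] U_def orthogonal_def inner_commute)
qed

lemma closed_U: "closed U"
proof -
  have "U = (\<Inter>v\<in>S. {w. v \<bullet> w = 0})" by (auto simp: U_def)
  then show ?thesis by (auto intro!: closed_INT closed_hyperplane)
qed

lemma scaleR_U: "w \<in> U \<Longrightarrow> c *\<^sub>R w \<in> U"
  by (simp add: U_def)

text \<open>If no constant works, normalised solutions with forcing tending to 0 have initial values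
  accumulating at a unit vector \<open>w\<close> of \<open>U\<close>. The a priori estimate survives
  in the limit, so the homogeneous orbit of \<open>w\<close> is bounded and \<open>w\<close> lies in
  \<open>S\<close> too, hence is orthogonal to itself.\<close>

lemma start_estimate:
  "\<exists>C>0. \<forall>u g \<gamma>. (\<forall>n. u (Suc n) = A n (u n) + g n) \<longrightarrow> (\<forall>n. norm (g n) \<le> \<gamma>) \<longrightarrow> bounded (range u) \<longrightarrow> u 0 \<in> U
      \<longrightarrow> norm (u 0) \<le> C * \<gamma>"
proof (rule ccontr)
  assume neg: "\<not> ?thesis"
  have "\<exists>u g. (\<forall>n. u (Suc n) = A n (u n) + g n) \<and> (\<forall>n. norm (g n) \<le> inverse (real (Suc j))) \<and> bounded (range u)
      \<and> u 0 \<in> U \<and> norm (u 0) = 1" for j :: nat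
  proof -
    have "\<not> (\<forall>u g \<gamma>. (\<forall>n. u (Suc n) = A n (u n) + g n) \<longrightarrow> (\<forall>n. norm (g n) \<le> \<gamma>) \<longrightarrow> bounded (range u) \<longrightarrow> u 0 \<in> U
      \<longrightarrow> norm (u 0) \<le> real (Suc j) * \<gamma>)"
      (is "\<not> ?P")
    proof
      assume ?P
      then have "\<exists>C>0. \<forall>u g \<gamma>. (\<forall>n. u (Suc n) = A n (u n) + g n) \<longrightarrow> (\<forall>n. norm (g n) \<le> \<gamma>) \<longrightarrow> bounded (range u) \<longrightarrow> u 0 \<in> U
          \<longrightarrow> norm (u 0) \<le> C * \<gamma>"
        by (intro exI[of _ "real (Suc j)"] conjI) simp_all
      then show False using neg by contradiction
    qed
    then obtain u g \<gamma> where ug: "\<forall>n. u (Suc n) = A n (u n) + g n" "\<forall>n. norm (g n) \<le> \<gamma>"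
      and bdd: "bounded (range u)" and U: "u 0 \<in> U" and big: "\<not> norm (u 0) \<le> real (Suc j) * \<gamma>"
      unfolding not_all not_imp by blast
    note u = ug(1)[rule_format] and g = ug(2)[rule_format]
    from big have big: "norm (u 0) > real (Suc j) * \<gamma>" by simp
    have "0 \<le> \<gamma>" using g[of 0] norm_ge_zero order_trans by blast
    define c where "c = inverse (norm (u 0))"
    have n0: "norm (u 0) > 0" using big \<open>0 \<le> \<gamma>\<close> by (smt (verit) of_nat_0_le_iff zero_le_mult_iff)
    then have c: "c > 0" by (simp add: c_def)
    show ?thesis
    proof (rule exI[of _ "\<lambda>n. c *\<^sub>R u n"], rule exI[of _ "\<lambda>n. c *\<^sub>R g n"], intro conjI allI)
      show "c *\<^sub>R u (Suc n) = A n (c *\<^sub>R u n) + c *\<^sub>R g n" for n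
        by (simp add: u linear_scale[OF linear_A] scaleR_add_right)
      show "norm (c *\<^sub>R g n) \<le> inverse (real (Suc j))" for n
      proof -
        have "norm (c *\<^sub>R g n) \<le> c * \<gamma>" using c g[of n] by simp
        also have "\<dots> \<le> inverse (real (Suc j))" using big n0 by (simp add: c_def field_simps)
        finally show ?thesis .
      qed
      show "bounded (range (\<lambda>n. c *\<^sub>R u n))" using bounded_scaling[OF bdd, of c] by (simp add: image_image)
      show "c *\<^sub>R u 0 \<in> U" using scaleR_U[OF U] .
      show "norm (c *\<^sub>R u 0) = 1" using n0 by (simp add: c_def)
    qed
  qed
  then obtain u g where u: "\<And>j n. u j (Suc n) = A n (u j n) + g j n"
    and g: "\<And>j n. norm (g j n) \<le> inverse (real (Suc j))" and bdd: "\<And>j. bounded (range (u j))"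
    and U: "\<And>j. u j 0 \<in> U" and n1: "\<And>j. norm (u j 0) = 1"
    by metis
  have "\<forall>j. u j 0 \<in> sphere 0 1" using n1 by simp
  then obtain w r where w: "w \<in> sphere 0 1" and r: "strict_mono r" and lim: "((\<lambda>j. u j 0) \<circ> r) \<longlonglongrightarrow> w"
    using compact_sphere[of "0::'a" 1] unfolding compact_def by meson
  have lim': "(\<lambda>j. u (r j) 0) \<longlonglongrightarrow> w" using lim by (simp add: o_def)
  have "w \<in> U" using closed_sequentially[OF closed_U _ lim'] U by simp
  moreover have "w \<in> S"
    unfolding S_def
  proof (rule CollectI, rule boundedI, elim imageE, hypsubst)
    fix i
    let ?e = "\<lambda>j. i * \<Lambda> ^ i * inverse (real (Suc (r j)))"
    \<comment> \<open>The last term grows with \<open>i\<close>, but for fixed \<open>i\<close> it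
      vanishes as \<open>j\<close> grows; what remains does not depend on \<open>i\<close>.\<close>
    have "norm (cocycle A 0 i (u j 0)) \<le> \<Lambda> ^ W + 3 * D + i * \<Lambda> ^ i * inverse (real (Suc j))" for j
    proof -
      have "norm (u j (0 + i) - cocycle A 0 i (u j 0)) \<le> i * \<Lambda> ^ i * inverse (real (Suc j))"
        using u g by (intro perturbation_bound[where g="g j"]) auto
      moreover have "norm (u j i) \<le> \<Lambda> ^ W * norm (u j 0) + 3 * D * inverse (real (Suc j))"
        by (rule bounded_solution_estimate[OF u g bdd])
      moreover have "3 * D * inverse (real (Suc j)) \<le> 3 * D * 1"
        using D_ge_0 by (intro mult_left_mono) (auto simp: field_simps)
      ultimately show ?thesis using n1[of j] norm_triangle_sub[of "cocycle A 0 i (u j 0)" "u j i"]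
        by (simp add: norm_minus_commute)
    qed
    then have le: "norm (cocycle A 0 i (u (r j) 0)) \<le> \<Lambda> ^ W + 3 * D + ?e j" for j .
    have l1: "(\<lambda>j. norm (cocycle A 0 i (u (r j) 0))) \<longlonglongrightarrow> norm (cocycle A 0 i w)"
      by (intro tendsto_norm isCont_tendsto_compose[OF _ lim'] linear_continuous_at)
         (use linear_cocycle linear_conv_bounded_linear in blast)
    have "(\<lambda>j. inverse (real (Suc (r j)))) \<longlonglongrightarrow> 0"
      using LIMSEQ_subseq_LIMSEQ[OF LIMSEQ_inverse_real_of_nat r] by (simp add: o_def)
    then have "(\<lambda>j. \<Lambda> ^ W + 3 * D + ?e j) \<longlonglongrightarrow> \<Lambda> ^ W + 3 * D + i * \<Lambda> ^ i * 0"
      by (intro tendsto_add tendsto_mult tendsto_const)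
    then show "norm (cocycle A 0 i w) \<le> \<Lambda> ^ W + 3 * D"
      using LIMSEQ_le[OF l1] le by fastforce
  qed
  ultimately have "w \<bullet> w = 0" by (simp add: U_def)
  then show False using w by simp
qed

text \<open>The forcing vanishes from \<^term>\<open>M\<close> on, so the solution is bounded once its value at \<^term>\<open>M\<close>
  is the image of an element of \<^term>\<open>S\<close>; the initial value in \<^term>\<open>U\<close> is chosen to achieve this.\<close>

lemma finite_support_solution:
  assumes g: "\<And>n. M \<le> n \<Longrightarrow> g n = 0"
  obtains u where "\<And>n. u (Suc n) = A n (u n) + g n" "bounded (range u)" "u 0 \<in> U"
proof -
  define q where "q = rec_nat 0 (\<lambda>n v. A n v + g n)"
  have q: "q 0 = 0" "q (Suc n) = A n (q n) + g n" for n by (simp_all add: q_def)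
  \<comment> \<open>\<open>v\<close> starts the homogeneous orbit that meets \<open>q\<close> at
    time \<open>M\<close>. Subtracting only the orbit of its component in \<open>U\<close> leaves,
    from \<open>M\<close> on, the bounded orbit of its component in \<open>S\<close>.\<close>
  obtain v where v: "cocycle A 0 M v = q M" using surj_cocycle[of 0 M] by (metis surjD)
  obtain s w where s: "s \<in> S" and w: "w \<in> U" and vsw: "v = s + w" by (rule decompose)
  define u where "u n = q n - cocycle A 0 n w" for n
  show thesis
  proof (rule that)
    show "u (Suc n) = A n (u n) + g n" for n by (simp add: u_def q linear_diff[OF linear_A])
    have "- 1 *\<^sub>R w \<in> U" by (rule scaleR_U[OF w])
    then show "u 0 \<in> U" by (simp add: u_def q)
    have late: "u (M + i) = cocycle A 0 (M + i) s" for i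
    proof (induction i)
      case 0
      then show ?case unfolding u_def add_0_right v[symmetric] vsw by (simp add: linear_add[OF linear_cocycle])
    next
      case (Suc i)
      then show ?case using g[of "M + i"] by (simp add: u_def q flip: linear_diff[OF linear_A])
    qed
    have sub: "range u \<subseteq> u ` {..<M} \<union> range (\<lambda>i. cocycle A 0 i s)"
    proof
      fix y assume "y \<in> range u"
      then obtain n where "y = u n" by auto
      then show "y \<in> u ` {..<M} \<union> range (\<lambda>i. cocycle A 0 i s)" using late[of "n - M"] by (cases "n < M") auto
    qed
    have "bounded (u ` {..<M} \<union> range (\<lambda>i. cocycle A 0 i s))"
      using s by (simp add: S_def finite_imp_bounded)
    then show "bounded (range u)" using sub by (rule bounded_subset)
  qed
qed

text \<open>Truncated forcing has solutions bounded by \<open>C * \<gamma>\<close> whatever the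
  truncation. Their initial values converge along a subsequence, and continuity of the recursion
  carries this to every time. The final estimate, applied to differences, also gives
  uniqueness.\<close>

lemma bounded_solution:
  obtains C where "C > 0"
    "\<And>g \<gamma>. (\<And>n. norm (g n) \<le> \<gamma>) \<Longrightarrow> \<exists>u. (\<forall>n. u (Suc n) = A n (u n) + g n) \<and> bounded (range u) \<and> u 0 \<in> U"
    "\<And>u g \<gamma> n. \<lbrakk>\<And>n. u (Suc n) = A n (u n) + g n; \<And>n. norm (g n) \<le> \<gamma>; bounded (range u); u 0 \<in> U\<rbrakk>
      \<Longrightarrow> norm (u n) \<le> C * \<gamma>"
proof -
  obtain C0 where C0: "C0 > 0" and start:
    "\<And>u g \<gamma>. \<lbrakk>\<And>n. u (Suc n) = A n (u n) + g n; \<And>n. norm (g n) \<le> \<gamma>; bounded (range u); u 0 \<in> U\<rbrakk>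
      \<Longrightarrow> norm (u 0) \<le> C0 * \<gamma>"
    using start_estimate by blast
  define C where "C = \<Lambda> ^ W * C0 + 3 * D"
  have C: "C > 0" using C0 \<Lambda>_ge_1 D_ge_0 by (simp add: C_def add_pos_nonneg)
  have est: "norm (u n) \<le> C * \<gamma>" if "\<And>n. u (Suc n) = A n (u n) + g n" "\<And>n. norm (g n) \<le> \<gamma>" "bounded (range u)" "u 0 \<in> U" for u g \<gamma> n
  proof -
    have "norm (u n) \<le> \<Lambda> ^ W * norm (u 0) + 3 * D * \<gamma>" by (rule bounded_solution_estimate[OF that(1-3)])
    also have "\<dots> \<le> \<Lambda> ^ W * (C0 * \<gamma>) + 3 * D * \<gamma>"
      using start[OF that] \<Lambda>_ge_1 by (intro add_right_mono mult_left_mono) auto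
    finally show ?thesis by (simp add: C_def algebra_simps)
  qed
  have ex: "\<exists>u. (\<forall>n. u (Suc n) = A n (u n) + g n) \<and> bounded (range u) \<and> u 0 \<in> U" if g: "\<And>n. norm (g n) \<le> \<gamma>" for g \<gamma>
  proof -
    have "0 \<le> \<gamma>" using g[of 0] norm_ge_zero order_trans by blast
    define gt where "gt M n = (if n < M then g n else 0)" for M n
    have gt: "norm (gt M n) \<le> \<gamma>" for M n using g \<open>0 \<le> \<gamma>\<close> by (simp add: gt_def)
    have "\<exists>u. (\<forall>n. u (Suc n) = A n (u n) + gt M n) \<and> bounded (range u) \<and> u 0 \<in> U" for M
      using finite_support_solution[of M "gt M"] by (metis gt_def not_less)
    then obtain u where u: "\<And>M n. u M (Suc n) = A n (u M n) + gt M n" and bdd: "\<And>M. bounded (range (u M))"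
      and U: "\<And>M. u M 0 \<in> U" by metis
    have uC: "norm (u M n) \<le> C * \<gamma>" for M n by (rule est[OF u gt bdd U])
    have "\<forall>M. u M 0 \<in> cball 0 (C * \<gamma>)" using uC by simp
    then obtain w r where r: "strict_mono r" and lim: "((\<lambda>M. u M 0) \<circ> r) \<longlonglongrightarrow> w"
      using compact_cball[of "0::'a" "C * \<gamma>"] unfolding compact_def by meson
    have lim': "(\<lambda>j. u (r j) 0) \<longlonglongrightarrow> w" using lim by (simp add: o_def)
    define y where "y = rec_nat w (\<lambda>n v. A n v + g n)"
    have y: "y 0 = w" "y (Suc n) = A n (y n) + g n" for n by (simp_all add: y_def)
    have limn: "(\<lambda>j. u (r j) n) \<longlonglongrightarrow> y n" for n
    proof (induction n)
      case 0
      then show ?case using lim' y by simp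
    next
      case (Suc n)
      have "(\<lambda>j. A n (u (r j) n) + g n) \<longlonglongrightarrow> A n (y n) + g n"
        by (intro tendsto_add tendsto_const isCont_tendsto_compose[OF _ Suc] linear_continuous_at)
           (use linear_A linear_conv_bounded_linear in blast)
      moreover have "\<forall>\<^sub>F j in sequentially. A n (u (r j) n) + g n = u (r j) (Suc n)"
        using eventually_gt_at_top[of n]
      proof eventually_elim
        case (elim j)
        then have "n < r j" using seq_suble[OF r, of j] by simp
        then show ?case by (simp add: u gt_def)
      qed
      ultimately show ?case unfolding y by (rule Lim_transform_eventually)
    qed
    have "norm (y n) \<le> C * \<gamma>" for n
      by (rule LIMSEQ_le_const2[OF tendsto_norm[OF limn[of n]]]) (use uC in blast)
    then have "bounded (range y)" by (auto intro: boundedI)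
    moreover have "y 0 \<in> U" using closed_sequentially[OF closed_U _ lim'] U y by simp
    ultimately show ?thesis using y by blast
  qed
  show thesis
  proof (rule that[OF C])
    fix g :: "nat \<Rightarrow> 'a" and \<gamma> assume "\<And>n. norm (g n) \<le> \<gamma>"
    then show "\<exists>u. (\<forall>n. u (Suc n) = A n (u n) + g n) \<and> bounded (range u) \<and> u 0 \<in> U" by (rule ex)
  next
    fix u g :: "nat \<Rightarrow> 'a" and \<gamma> n
    assume "\<And>n. u (Suc n) = A n (u n) + g n" "\<And>n. norm (g n) \<le> \<gamma>" "bounded (range u)" "u 0 \<in> U"
    then show "norm (u n) \<le> C * \<gamma>" by (rule est)
  qed
qed

text \<open>Picard iteration: substituting a sequence into \<open>G\<close> and solving the linear
  problem with initial value in \<open>U\<close> preserves the unit ball and halves uniform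
  distances. The limit is taken at each time separately.\<close>

lemma nonlinear_bounded_solution:
  obtains \<kappa> where "\<kappa> > 0"
    "\<And>G. \<lbrakk>\<And>n. norm (G n 0) \<le> \<kappa>;
           \<And>n v w. norm v \<le> 1 \<Longrightarrow> norm w \<le> 1 \<Longrightarrow> norm (G n v - G n w) \<le> \<kappa> * norm (v - w)\<rbrakk>
      \<Longrightarrow> \<exists>u. (\<forall>n. u (Suc n) = A n (u n) + G n (u n)) \<and> (\<forall>n. norm (u n) \<le> 1)"
proof -
  obtain C where C: "C > 0" and
    ex: "\<And>g \<gamma>. (\<And>n. norm (g n) \<le> \<gamma>) \<Longrightarrow> \<exists>u. (\<forall>n. u (Suc n) = A n (u n) + g n) \<and> bounded (range u) \<and> u 0 \<in> U" and
    est: "\<And>u g \<gamma> n. \<lbrakk>\<And>n. u (Suc n) = A n (u n) + g n; \<And>n. norm (g n) \<le> \<gamma>; bounded (range u); u 0 \<in> U\<rbrakk>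
      \<Longrightarrow> norm (u n) \<le> C * \<gamma>"
    using bounded_solution by blast
  have UD: "v - w \<in> U" if "v \<in> U" "w \<in> U" for v w using that by (simp add: U_def inner_diff_right)
  \<comment> \<open>Since \<open>C * \<kappa> = 1/2\<close>, distances are halved, and the bound
    \<open>2 * \<kappa>\<close> for \<open>G\<close> on the unit ball yields solutions of norm at
    most 1.\<close>
  define \<kappa> where "\<kappa> = 1 / (2 * C)"
  have \<kappa>: "\<kappa> > 0" "C * \<kappa> = 1/2" using C by (simp_all add: \<kappa>_def)
  show thesis
  proof (rule that[OF \<kappa>(1)])
    fix G :: "nat \<Rightarrow> 'a \<Rightarrow> 'a" assume G0: "\<And>n. norm (G n 0) \<le> \<kappa>"
      and GL: "\<And>n v w. norm v \<le> 1 \<Longrightarrow> norm w \<le> 1 \<Longrightarrow> norm (G n v - G n w) \<le> \<kappa> * norm (v - w)"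
    define sol where "sol g u \<longleftrightarrow> (\<forall>n. u (Suc n) = A n (u n) + g n) \<and> bounded (range u) \<and> u 0 \<in> U" for g u
    \<comment> \<open>The choice is harmless: \<open>est\<close> applied to differences shows that
      the solution is unique for bounded forcing.\<close>
    define K where "K g = (SOME u. sol g u)" for g
    have K: "sol g (K g)" if "\<And>n. norm (g n) \<le> \<gamma>" for g \<gamma>
    proof -
      have "\<exists>u. sol g u" using ex[of g \<gamma>] that by (simp add: sol_def)
      then show ?thesis unfolding K_def by (rule someI_ex)
    qed
    have Kn: "norm (K g n) \<le> C * \<gamma>" if "\<And>n. norm (g n) \<le> \<gamma>" for g \<gamma> n
      using K[OF that] est[of "K g" g \<gamma> n] that by (auto simp: sol_def)
    have Kd: "norm (K g n - K g' n) \<le> C * \<gamma>"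
      if b: "\<And>n. norm (g n) \<le> B" "\<And>n. norm (g' n) \<le> B" and d: "\<And>n. norm (g n - g' n) \<le> \<gamma>" for g g' B \<gamma> n
    proof (rule est[where u = "\<lambda>n. K g n - K g' n" and g = "\<lambda>n. g n - g' n"])
      have s: "sol g (K g)" "sol g' (K g')" using K b by blast+
      then show "K g (Suc n) - K g' (Suc n) = A n (K g n - K g' n) + (g n - g' n)" for n
        by (simp add: sol_def linear_diff[OF linear_A])
      show "K g 0 - K g' 0 \<in> U" using s UD by (simp add: sol_def)
      show "bounded (range (\<lambda>n. K g n - K g' n))" using s by (auto simp: sol_def intro!: bounded_minus_comp)
    qed (rule d)
    define N where "N u = K (\<lambda>n. G n (u n))" for u
    define x where "x = rec_nat (\<lambda>n. 0) (\<lambda>i u. N u)"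
    have x: "x 0 = (\<lambda>n. 0)" "x (Suc i) = N (x i)" for i by (simp_all add: x_def)
    have Gb: "norm (G n v) \<le> 2 * \<kappa>" if "norm v \<le> 1" for n v
    proof -
      have "norm (G n v - G n 0) \<le> \<kappa> * norm v" using GL[of v 0 n] that by simp
      also have "\<dots> \<le> \<kappa>" using that \<kappa> by simp
      finally show ?thesis using norm_triangle_sub[of "G n v" "G n 0"] G0[of n] by simp
    qed
    have x1: "norm (x i n) \<le> 1" for i n
    proof (induction i arbitrary: n)
      case (Suc i)
      then have "norm (x (Suc i) n) \<le> C * (2 * \<kappa>)" unfolding x N_def by (intro Kn Gb)
      then show ?case using \<kappa> by simp
    qed (simp add: x)
    have diff: "norm (x (Suc i) n - x i n) \<le> (1/2) ^ i" for i n
    proof (induction i arbitrary: n)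
      case 0
      then show ?case using x1[of 1 n] by (simp add: x)
    next
      case (Suc i)
      have "norm (N (x (Suc i)) n - N (x i) n) \<le> C * (\<kappa> * (1/2) ^ i)"
        unfolding N_def
      proof (rule Kd)
        show "norm (G n (x (Suc i) n)) \<le> 2 * \<kappa>" "norm (G n (x i n)) \<le> 2 * \<kappa>" for n using Gb x1 by blast+
        show "norm (G n (x (Suc i) n) - G n (x i n)) \<le> \<kappa> * (1/2) ^ i" for n
          using GL[OF x1 x1] Suc \<kappa> by (meson less_imp_le mult_left_mono order_trans)
      qed
      then show ?case using \<kappa> by (simp add: x(2) flip: mult.assoc)
    qed
    have "convergent (\<lambda>i. x i n)" for n
    proof -
      have "summable (\<lambda>i. x (Suc i) n - x i n)"
        by (rule summable_comparison_test'[where g = "\<lambda>i. (1/2::real) ^ i" and N = 0]) (auto intro: diff simp: summable_geometric)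
      then show ?thesis
        by (simp add: summable_iff_convergent sum_lessThan_telescope[of "\<lambda>i. x i n"] x(1))
    qed
    then obtain u where lim: "\<And>n. (\<lambda>i. x i n) \<longlonglongrightarrow> u n" unfolding convergent_def by metis
    have u1: "norm (u n) \<le> 1" for n
      by (rule LIMSEQ_le_const2[OF tendsto_norm[OF lim[of n]]]) (use x1 in blast)
    have "u (Suc n) = A n (u n) + G n (u n)" for n
    proof -
      have "(\<lambda>i. x (Suc i) (Suc n)) \<longlonglongrightarrow> u (Suc n)" by (rule LIMSEQ_Suc[OF lim])
      moreover have "x (Suc i) (Suc n) = A n (x (Suc i) n) + G n (x i n)" for i
      proof -
        have "sol (\<lambda>n. G n (x i n)) (x (Suc i))" unfolding x N_def by (rule K, rule Gb, rule x1)
        then show ?thesis by (simp add: sol_def)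
      qed
      ultimately have 1: "(\<lambda>i. A n (x (Suc i) n) + G n (x i n)) \<longlonglongrightarrow> u (Suc n)" by simp
      have "(\<lambda>i. A n (x (Suc i) n)) \<longlonglongrightarrow> A n (u n)"
        by (intro isCont_tendsto_compose[OF _ LIMSEQ_Suc[OF lim]] linear_continuous_at)
           (use linear_A linear_conv_bounded_linear in blast)
      moreover have "(\<lambda>i. G n (x i n)) \<longlonglongrightarrow> G n (u n)"
      proof (rule LIM_zero_cancel, rule Lim_null_comparison)
        show "\<forall>\<^sub>F i in sequentially. norm (G n (x i n) - G n (u n)) \<le> \<kappa> * norm (x i n - u n)"
          using GL[OF x1 u1] by simp
        have "(\<lambda>i. \<kappa> * norm (x i n - u n)) \<longlonglongrightarrow> \<kappa> * norm (u n - u n)"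
          by (intro tendsto_mult tendsto_norm tendsto_diff tendsto_const lim)
        then show "(\<lambda>i. \<kappa> * norm (x i n - u n)) \<longlonglongrightarrow> 0" by simp
      qed
      ultimately have 2: "(\<lambda>i. A n (x (Suc i) n) + G n (x i n)) \<longlonglongrightarrow> A n (u n) + G n (u n)"
        by (rule tendsto_add)
      show ?thesis by (rule LIMSEQ_unique[OF 1 2])
    qed
    then show "\<exists>u. (\<forall>n. u (Suc n) = A n (u n) + G n (u n)) \<and> (\<forall>n. norm (u n) \<le> 1)" using u1 by blast
  qed
qed

end

section \<open>Shadowing\<close>

lemma limit_setI:
  fixes X :: "real \<Rightarrow> 'a::metric_space"
  assumes s: "filterlim s at_top sequentially" and lim: "(\<lambda>j. X (s j)) \<longlonglongrightarrow> z"
  shows "z \<in> limit_set X"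
  unfolding limit_set_def
proof
  fix t :: real
  show "z \<in> closure {X (t + s) | s. s \<ge> 0}"
  proof (rule Lim_in_closed_set[OF closed_closure _ _ lim])
    have "\<forall>\<^sub>F j in sequentially. t \<le> s j" using s by (simp add: filterlim_at_top)
    then show "\<forall>\<^sub>F j in sequentially. X (s j) \<in> closure {X (t + s) | s. s \<ge> 0}"
    proof eventually_elim
      case (elim j)
      then have "s j = t + (s j - t) \<and> 0 \<le> s j - t" by simp
      then have "X (s j) \<in> {X (t + s) | s. s \<ge> 0}" by (metis (mono_tags, lifting) mem_Collect_eq)
      then show ?case using closure_subset[of "{X (t + s) | s. s \<ge> 0}"] by auto
    qed
  qed simp
qed

text \<open>\<open>\<nu>\<close> is meant to lie strictly between the error rate and
  \<open>\<mu>\<close>; the gap to \<open>\<mu>\<close> makes the errors vanish after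
  rescaling.\<close>

locale pseudotrajectory = C1_flow +
  fixes X :: "real \<Rightarrow> 'a" and T \<mu> \<nu> t0 r :: real
  assumes T: "T > 0" and \<nu>: "\<nu> < \<mu>" and \<mu>: "\<mu> < 0"
    and X_bounded: "\<And>t. 0 \<le> t \<Longrightarrow> X t \<in> cball 0 r"
    and error: "\<And>t h. \<lbrakk>0 \<le> t; t0 \<le> t; 0 \<le> h; h \<le> T\<rbrakk> \<Longrightarrow> norm (X (t + h) - \<Phi> h (X t)) \<le> exp (\<nu> * t)"
    and resolvent: "\<mu> \<in> Sacker_Sell_resolvent \<Phi> (limit_set X)"
begin

section \<open>The sampled pseudotrajectory and limits of its shifts\<close>

definition x :: "nat \<Rightarrow> 'a" where "x n = X (n * T)"
definition \<rho> :: real where "\<rho> = exp (\<mu> * T)"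

lemma \<rho>: "0 < \<rho>" "\<rho> < 1"
  using T \<mu> by (simp_all add: \<rho>_def mult_neg_pos)

lemma \<rho>_powi: "exp (\<mu> * (real_of_int i * T)) = \<rho> powi i"
  by (simp add: \<rho>_def exp_power_int mult_ac)

lemma \<rho>_power: "exp (\<mu> * (real n * T)) = \<rho> ^ n"
  using \<rho>_powi[of "int n"] by simp

lemma x_in_cball: "x n \<in> cball 0 r"
  unfolding x_def using X_bounded T by simp

lemma x_error:
  assumes "t0 \<le> n * T"
  shows "norm (x (Suc n) - \<Phi> T (x n)) \<le> exp (\<nu> * (n * T))"
  using error[of "n * T" T] assms T unfolding x_def by (simp add: algebra_simps)

lemma eventually_large: "\<forall>\<^sub>F n in sequentially. t0 \<le> real n * T"
proof -
  have "filterlim (\<lambda>n. real n * T) at_top sequentially"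
    using T by (simp add: filterlim_at_top_mult_tendsto_pos[OF tendsto_const] filterlim_real_sequentially)
  then show ?thesis by (simp add: filterlim_at_top)
qed

lemma x_error_tendsto: "(\<lambda>n. x (Suc n) - \<Phi> T (x n)) \<longlonglongrightarrow> 0"
proof (rule Lim_null_comparison)
  show "\<forall>\<^sub>F n in sequentially. norm (x (Suc n) - \<Phi> T (x n)) \<le> exp (\<nu> * T) ^ n"
    using eventually_large
  proof eventually_elim
    case (elim n)
    have "exp (\<nu> * T) ^ n = exp (\<nu> * (n * T))" by (simp add: exp_of_nat_mult[symmetric] mult_ac)
    then show ?case using x_error[OF elim] by simp
  qed
  have "\<nu> * T < 0" using \<nu> \<mu> T by (simp add: mult_neg_pos)
  then show "(\<lambda>n. exp (\<nu> * T) ^ n) \<longlonglongrightarrow> 0" by (intro LIMSEQ_power_zero) simp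
qed

text \<open>The one-step errors vanish, so continuity of the flow makes limits of shifted samples
  follow the orbit of \<open>z\<close>.\<close>

lemma x_subseq_forward:
  assumes s: "filterlim s at_top sequentially" and lim: "(\<lambda>j. x (s j)) \<longlonglongrightarrow> z"
  shows "(\<lambda>j. x (s j + k)) \<longlonglongrightarrow> \<Phi> (k * T) z"
proof (induction k)
  case (Suc k)
  have "filterlim (\<lambda>j. s j + k) at_top sequentially"
    unfolding filterlim_at_top
  proof
    fix N
    have "\<forall>\<^sub>F j in sequentially. N \<le> s j" using s by (simp add: filterlim_at_top)
    then show "\<forall>\<^sub>F j in sequentially. N \<le> s j + k" by eventually_elim simp
  qed
  from filterlim_compose[OF x_error_tendsto this]
  have "(\<lambda>j. x (s j + Suc k) - \<Phi> T (x (s j + k))) \<longlonglongrightarrow> 0" by simp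
  moreover have "(\<lambda>j. \<Phi> T (x (s j + k))) \<longlonglongrightarrow> \<Phi> T (\<Phi> (k * T) z)"
    by (rule isCont_tendsto_compose[OF continuous_flow Suc])
  ultimately have "(\<lambda>j. x (s j + Suc k) - \<Phi> T (x (s j + k)) + \<Phi> T (x (s j + k))) \<longlonglongrightarrow> 0 + \<Phi> T (\<Phi> (k * T) z)"
    by (rule tendsto_add)
  then show ?case by (simp add: algebra_simps flip: flow_add)
qed (use lim in simp)

text \<open>Truncated subtraction is harmless because \<open>s\<close> tends to infinity. The second
  limit is there because the inverse of \<open>DP T (x n)\<close> is based at
  \<open>\<Phi> T (x n)\<close>, not at the next sample.\<close>

lemma x_subseq_backward:
  assumes s: "filterlim s at_top sequentially" and lim: "(\<lambda>j. x (s j)) \<longlonglongrightarrow> z"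
  shows "(\<lambda>j. x (s j - k)) \<longlonglongrightarrow> \<Phi> (- (k * T)) z"
    and "(\<lambda>j. \<Phi> T (x (s j - Suc k))) \<longlonglongrightarrow> \<Phi> (- (k * T)) z"
proof -
  have step: "(\<lambda>j. \<Phi> T (x (s j - Suc k))) \<longlonglongrightarrow> \<Phi> (- (k * T)) z"
    if "(\<lambda>j. x (s j - k)) \<longlonglongrightarrow> \<Phi> (- (k * T)) z" for k
  proof -
    have "filterlim (\<lambda>j. s j - Suc k) at_top sequentially"
      unfolding filterlim_at_top
    proof
      fix N
      have "\<forall>\<^sub>F j in sequentially. N + Suc k \<le> s j" using s by (simp add: filterlim_at_top)
      then show "\<forall>\<^sub>F j in sequentially. N \<le> s j - Suc k" by eventually_elim simp
    qed
    from filterlim_compose[OF x_error_tendsto this]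
    have "(\<lambda>j. x (Suc (s j - Suc k)) - \<Phi> T (x (s j - Suc k))) \<longlonglongrightarrow> 0" .
    from tendsto_diff[OF that this]
    have *: "(\<lambda>j. x (s j - k) - (x (Suc (s j - Suc k)) - \<Phi> T (x (s j - Suc k)))) \<longlonglongrightarrow> \<Phi> (- (k * T)) z" by simp
    have "\<forall>\<^sub>F j in sequentially. Suc k \<le> s j" using s by (simp add: filterlim_at_top)
    then have "\<forall>\<^sub>F j in sequentially. x (s j - k) - (x (Suc (s j - Suc k)) - \<Phi> T (x (s j - Suc k))) = \<Phi> T (x (s j - Suc k))"
    proof eventually_elim
      case (elim j)
      then have "Suc (s j - Suc k) = s j - k" by simp
      then show ?case by simp
    qed
    then show ?thesis by (rule Lim_transform_eventually[OF *])
  qed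
  have main: "(\<lambda>j. x (s j - k)) \<longlonglongrightarrow> \<Phi> (- (k * T)) z" for k
  proof (induction k)
    case (Suc k)
    have "(\<lambda>j. \<Phi> (- T) (\<Phi> T (x (s j - Suc k)))) \<longlonglongrightarrow> \<Phi> (- T) (\<Phi> (- (k * T)) z)"
      by (rule isCont_tendsto_compose[OF continuous_flow step[OF Suc]])
    then show ?case by (simp add: algebra_simps flip: flow_add)
  qed (use lim in simp)
  show "(\<lambda>j. x (s j - k)) \<longlonglongrightarrow> \<Phi> (- (k * T)) z" by (rule main)
  show "(\<lambda>j. \<Phi> T (x (s j - Suc k))) \<longlonglongrightarrow> \<Phi> (- (k * T)) z" by (rule step[OF main])
qed

definition A :: "nat \<Rightarrow> 'a \<Rightarrow> 'a" where
  "A n v = inverse \<rho> *\<^sub>R DP T (x n) v"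

lemma linear_A: "linear (A n)"
  unfolding A_def by (intro linear_compose_scale_right linear_DP)

text \<open>The resolvent speaks of all real times, the recursion of multiples of \<open>T\<close>.
  Writing a time as \<open>h + i * T\<close> with \<open>h\<close> between 0 and \<open>T\<close>,
  the piece of length \<open>h\<close> costs only a bounded factor.\<close>

lemma no_bounded_orbit:
  assumes z: "z \<in> limit_set X" and orbit: "\<And>i. \<Phi> (of_int i * T) z \<in> cball 0 r"
    and bound: "\<And>i. norm (\<rho> powi (- i) *\<^sub>R DP (of_int i * T) z w) \<le> B"
  shows "w = 0"
proof (rule ccontr)
  assume "w \<noteq> 0"
  then have inf: "(SUP t. ereal (norm (exp (- \<mu> * t) *\<^sub>R DP t z w))) = \<infinity>"
    using resolvent z by (simp add: Sacker_Sell_resolvent_def DP_def)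
  obtain C where C: "C > 0" "\<And>y h v. y \<in> cball 0 r \<Longrightarrow> 0 \<le> h \<Longrightarrow> h \<le> T \<Longrightarrow> norm (DP h y v) \<le> C * norm v"
    using DP_bounded[of T r] T by auto
  have "norm (exp (- \<mu> * t) *\<^sub>R DP t z w) \<le> inverse \<rho> * C * B" for t
  proof -
    define i where "i = \<lfloor>t / T\<rfloor>"
    define h where "h = t - of_int i * T"
    have "of_int i \<le> t / T" "t / T < of_int i + 1" unfolding i_def by linarith+
    then have h: "0 \<le> h" "h \<le> T" using T by (simp_all add: h_def field_simps)
    have t: "t = h + of_int i * T" by (simp add: h_def)
    have "exp (- \<mu> * t) = exp (- \<mu> * h) * \<rho> powi (- i)"
      unfolding t \<rho>_powi[symmetric] exp_add[symmetric] by (simp add: algebra_simps)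
    then have "norm (exp (- \<mu> * t) *\<^sub>R DP t z w)
        = exp (- \<mu> * h) * norm (DP h (\<Phi> (of_int i * T) z) (\<rho> powi (- i) *\<^sub>R DP (of_int i * T) z w))"
      unfolding t DP_add by (simp add: linear_scale[OF linear_DP] abs_mult)
    also have "\<dots> \<le> inverse \<rho> * (C * B)"
    proof (intro mult_mono)
      have "- \<mu> * h \<le> - \<mu> * T" using h \<mu> by (intro mult_left_mono) auto
      then show "exp (- \<mu> * h) \<le> inverse \<rho>" by (simp add: \<rho>_def exp_minus[symmetric])
      show "norm (DP h (\<Phi> (of_int i * T) z) (\<rho> powi (- i) *\<^sub>R DP (of_int i * T) z w)) \<le> C * B"
        using C(2)[OF orbit h] bound C(1) by (meson less_imp_le mult_left_mono order_trans)
    qed (use \<rho> in auto)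
    finally show ?thesis by (simp add: mult.assoc)
  qed
  then have "(SUP t. ereal (norm (exp (- \<mu> * t) *\<^sub>R DP t z w))) \<le> ereal (inverse \<rho> * C * B)"
    by (intro SUP_least) simp
  then show False using inf by simp
qed

text \<open>Otherwise solutions on ever longer windows, normalised at the midpoint and bounded by \<open>2\<close>,
  converge along a subsequence to a bounded orbit over a point of the limit set.\<close>

lemma uniform_contraction:
  "\<exists>W. \<forall>n u B. 2 * W \<le> n \<longrightarrow> (\<forall>k\<ge>n - W. u (Suc k) = A k (u k)) \<longrightarrow> (\<forall>k. n - W \<le> k \<longrightarrow> k \<le> n + W \<longrightarrow> norm (u k) \<le> B)
      \<longrightarrow> norm (u n) \<le> B / 2"
proof (rule ccontr)
  assume neg: "\<not> ?thesis"
  \<comment> \<open>Failure at every \<open>W\<close>, normalised at the midpoint. As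
    \<open>2 * W \<le> n\<close>, the midpoint times tend to infinity, which puts a limit of the
    samples there into the limit set.\<close>
  have "\<exists>n v. 2 * W \<le> n \<and> (\<forall>k\<ge>n - W. v (Suc k) = A k (v k)) \<and> (\<forall>k. n - W \<le> k \<longrightarrow> k \<le> n + W \<longrightarrow> norm (v k) \<le> 2)
      \<and> norm (v n) = 1" for W
  proof -
    obtain n u B where n: "2 * W \<le> n" and u: "\<And>k. k \<ge> n - W \<Longrightarrow> u (Suc k) = A k (u k)"
      and B: "\<And>k. n - W \<le> k \<Longrightarrow> k \<le> n + W \<Longrightarrow> norm (u k) \<le> B" and big: "norm (u n) > B / 2"
      using neg unfolding not_ex not_all not_imp not_le by blast
    have "norm (u n) \<le> B" by (rule B) auto
    then have pos: "norm (u n) > 0" using big by linarith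
    show ?thesis
    proof (rule exI[of _ n], rule exI[of _ "\<lambda>k. inverse (norm (u n)) *\<^sub>R u k"], intro conjI allI impI n)
      fix k assume k: "n - W \<le> k"
      then show "inverse (norm (u n)) *\<^sub>R u (Suc k) = A k (inverse (norm (u n)) *\<^sub>R u k)"
        by (simp add: u linear_scale[OF linear_A])
      assume "k \<le> n + W"
      from B[OF k this] have "norm (u k) \<le> 2 * norm (u n)" using big by simp
      then show "norm (inverse (norm (u n)) *\<^sub>R u k) \<le> 2" using pos by (simp add: field_simps)
    next
      show "norm (inverse (norm (u n)) *\<^sub>R u n) = 1" using pos by simp
    qed
  qed
  then obtain n v where n: "\<And>W. 2 * W \<le> n W" and v: "\<And>W k. k \<ge> n W - W \<Longrightarrow> v W (Suc k) = A k (v W k)"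
    and v2: "\<And>W k. n W - W \<le> k \<Longrightarrow> k \<le> n W + W \<Longrightarrow> norm (v W k) \<le> 2" and v1: "\<And>W. norm (v W (n W)) = 1"
    by metis
  have "compact (cball (0::'a) r \<times> sphere (0::'a) 1)" by (intro compact_Times) auto
  moreover have "\<forall>W. (x (n W), v W (n W)) \<in> cball 0 r \<times> sphere 0 1" using x_in_cball v1 by simp
  ultimately obtain zw q where q: "strict_mono q"
    and lim: "((\<lambda>W. (x (n W), v W (n W))) \<circ> q) \<longlonglongrightarrow> zw" and zw: "zw \<in> cball 0 r \<times> sphere 0 1"
    unfolding compact_def by meson
  define z w where "z = fst zw" and "w = snd zw"
  have w: "norm w = 1" using zw by (auto simp: w_def)
  have limx: "(\<lambda>j. x (n (q j))) \<longlonglongrightarrow> z" using tendsto_fst[OF lim] by (simp add: o_def z_def)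
  have limv: "(\<lambda>j. v (q j) (n (q j))) \<longlonglongrightarrow> w" using tendsto_snd[OF lim] by (simp add: o_def w_def)
  have q_ge: "j \<le> q j" for j using seq_suble[OF q] .
  have nq_ge: "2 * j \<le> n (q j)" for j using n[of "q j"] q_ge[of j] by simp
  have nq: "filterlim (\<lambda>j. n (q j)) at_top sequentially"
    unfolding filterlim_at_top
  proof
    fix N show "\<forall>\<^sub>F j in sequentially. N \<le> n (q j)"
      using eventually_ge_at_top[of N] by eventually_elim (use nq_ge in \<open>metis mult_2 trans_le_add2 order_trans\<close>)
  qed
  have forward: "(\<lambda>j. v (q j) (n (q j) + k)) \<longlonglongrightarrow> inverse \<rho> ^ k *\<^sub>R DP (k * T) z w" for k
  proof (induction k)
    case 0
    then show ?case using limv by (simp add: DP_0)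
  next
    case (Suc k)
    have "(\<lambda>j. inverse \<rho> *\<^sub>R DP T (x (n (q j) + k)) (v (q j) (n (q j) + k))) \<longlonglongrightarrow>
        inverse \<rho> *\<^sub>R DP T (\<Phi> (k * T) z) (inverse \<rho> ^ k *\<^sub>R DP (k * T) z w)"
      by (intro tendsto_scaleR tendsto_const DP_tendsto x_subseq_forward[OF nq limx] Suc)
    moreover have "v (q j) (n (q j) + Suc k) = inverse \<rho> *\<^sub>R DP T (x (n (q j) + k)) (v (q j) (n (q j) + k))" for j
      using v[of "q j" "n (q j) + k"] by (simp add: A_def)
    moreover have "real (Suc k) * T = T + real k * T" by (simp add: algebra_simps)
    ultimately show ?case by (simp add: DP_add linear_scale[OF linear_DP])
  qed
  \<comment> \<open>Going back one step inverts \<open>A\<close>, with the derivative of the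
    reversed flow evaluated at the image under \<open>\<Phi> T\<close> of the earlier
    sample.\<close>
  have backward: "(\<lambda>j. v (q j) (n (q j) - k)) \<longlonglongrightarrow> \<rho> ^ k *\<^sub>R DP (- (k * T)) z w" for k
  proof (induction k)
    case 0
    then show ?case using limv by (simp add: DP_0)
  next
    case (Suc k)
    have "(\<lambda>j. \<rho> *\<^sub>R DP (- T) (\<Phi> T (x (n (q j) - Suc k))) (v (q j) (n (q j) - k))) \<longlonglongrightarrow>
        \<rho> *\<^sub>R DP (- T) (\<Phi> (- (k * T)) z) (\<rho> ^ k *\<^sub>R DP (- (k * T)) z w)"
      by (intro tendsto_scaleR tendsto_const DP_tendsto x_subseq_backward(2)[OF nq limx] Suc)
    moreover have "\<forall>\<^sub>F j in sequentially. \<rho> *\<^sub>R DP (- T) (\<Phi> T (x (n (q j) - Suc k))) (v (q j) (n (q j) - k)) = v (q j) (n (q j) - Suc k)"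
      using eventually_ge_at_top[of "Suc k"]
    proof eventually_elim
      case (elim j)
      then have "Suc k \<le> n (q j)" "Suc k \<le> q j" using nq_ge[of j] q_ge[of j] by simp_all
      then have "v (q j) (n (q j) - k) = A (n (q j) - Suc k) (v (q j) (n (q j) - Suc k))"
        using v[of "q j" "n (q j) - Suc k"] by (simp add: Suc_diff_Suc)
      then show ?case using \<rho> by (simp add: A_def linear_scale[OF linear_DP])
    qed
    ultimately have "(\<lambda>j. v (q j) (n (q j) - Suc k)) \<longlonglongrightarrow> \<rho> *\<^sub>R DP (- T) (\<Phi> (- (k * T)) z) (\<rho> ^ k *\<^sub>R DP (- (k * T)) z w)"
      by (rule Lim_transform_eventually)
    moreover have "- (real (Suc k) * T) = - T + - (real k * T)" by (simp add: algebra_simps)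
    ultimately show ?case by (simp only: DP_add) (simp add: linear_scale[OF linear_DP])
  qed
  have "w = 0"
  proof (rule no_bounded_orbit)
    have "filterlim (\<lambda>n. T * real n) at_top sequentially"
      using T filterlim_tendsto_pos_mult_at_top[OF tendsto_const T filterlim_real_sequentially] by simp
    from filterlim_compose[OF this nq] have "filterlim (\<lambda>j. T * real (n (q j))) at_top sequentially" .
    moreover have "(\<lambda>j. X (T * real (n (q j)))) \<longlonglongrightarrow> z" using limx by (simp add: x_def mult.commute)
    ultimately show "z \<in> limit_set X" by (rule limit_setI)
    fix i :: int
    have closed: "y \<in> cball 0 b" if "(\<lambda>j. f j) \<longlonglongrightarrow> y" "\<forall>\<^sub>F j in sequentially. norm (f j) \<le> b" for f and y :: 'a and b
      by (rule Lim_in_closed_set[OF closed_cball _ _ that(1)]) (use that(2) in simp_all)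
    obtain k where i: "i = int k \<or> i = - int k" by (metis int_cases2)
    then show "\<Phi> (of_int i * T) z \<in> cball 0 r"
      using closed[OF x_subseq_forward[OF nq limx, of k], of r] closed[OF x_subseq_backward(1)[OF nq limx, of k], of r] x_in_cball
      by auto
    have ev: "\<forall>\<^sub>F j in sequentially. k \<le> q j"
      using eventually_ge_at_top[of k] by eventually_elim (use q_ge order_trans in blast)
    have "\<forall>\<^sub>F j in sequentially. norm (v (q j) (n (q j) + k)) \<le> 2"
      using ev by eventually_elim (intro v2, auto)
    from closed[OF forward this] have 1: "norm (inverse \<rho> ^ k *\<^sub>R DP (k * T) z w) \<le> 2" by simp
    have "\<forall>\<^sub>F j in sequentially. norm (v (q j) (n (q j) - k)) \<le> 2"
      using ev by eventually_elim (intro v2, auto)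
    from closed[OF backward this] have 2: "norm (\<rho> ^ k *\<^sub>R DP (- (k * T)) z w) \<le> 2" by simp
    show "norm (\<rho> powi (- i) *\<^sub>R DP (of_int i * T) z w) \<le> 2"
      using i
    proof
      assume "i = int k"
      then show ?thesis using 1 by (simp add: power_int_minus power_inverse)
    next
      assume "i = - int k"
      then show ?thesis using 2 by simp
    qed
  qed
  then show False using w by simp
qed

end

section \<open>Construction of the shadowing orbit\<close>

context pseudotrajectory
begin

lemma surj_A: "surj (A n)"
proof (rule surjI)
  fix v
  show "A n (\<rho> *\<^sub>R DP (- T) (\<Phi> T (x n)) v) = v"
    using DP_inverse(2)[of T "\<Phi> T (x n)" v] \<rho> by (simp add: A_def linear_scale[OF linear_DP])
qed

text \<open>Starting the sequence at time \<open>W\<close> turns the requirement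
  \<open>2 * W \<le> n\<close> into the \<open>W \<le> n\<close> of the locale.\<close>

lemma hyperbolic: "\<exists>W \<Lambda>. hyperbolic_sequence (\<lambda>i. A (W + i)) \<Lambda> W"
proof -
  obtain W where W: "\<And>n u B. \<lbrakk>2 * W \<le> n; \<forall>k\<ge>n - W. u (Suc k) = A k (u k);
      \<forall>k. n - W \<le> k \<longrightarrow> k \<le> n + W \<longrightarrow> norm (u k) \<le> B\<rbrakk> \<Longrightarrow> norm (u n) \<le> B / 2"
    using uniform_contraction by blast
  obtain C where C: "C > 0" "\<And>y h v. y \<in> cball 0 r \<Longrightarrow> 0 \<le> h \<Longrightarrow> h \<le> T \<Longrightarrow> norm (DP h y v) \<le> C * norm v"
    using DP_bounded[of T r] T by auto
  have "hyperbolic_sequence (\<lambda>i. A (W + i)) (max 1 (inverse \<rho> * C)) W"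
  proof (rule hyperbolic_sequence.intro)
    show "linear (A (W + n))" for n by (rule linear_A)
    show "surj (A (W + n))" for n by (rule surj_A)
    show "norm (A (W + n) v) \<le> max 1 (inverse \<rho> * C) * norm v" for n v
    proof -
      have "norm (A (W + n) v) = inverse \<rho> * norm (DP T (x (W + n)) v)" using \<rho> by (simp add: A_def)
      also have "\<dots> \<le> inverse \<rho> * (C * norm v)" using \<rho> T C(2)[OF x_in_cball] by (intro mult_left_mono) auto
      also have "\<dots> \<le> max 1 (inverse \<rho> * C) * norm v" unfolding mult.assoc[symmetric] by (intro mult_right_mono) auto
      finally show ?thesis .
    qed
    show "1 \<le> max 1 (inverse \<rho> * C)" by simp
    fix n u B
    assume n: "W \<le> n" and u: "\<And>k. n - W \<le> k \<Longrightarrow> u (Suc k) = A (W + k) (u k)"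
      and B: "\<And>k. n - W \<le> k \<Longrightarrow> k \<le> n + W \<Longrightarrow> norm (u k) \<le> B"
    have "norm (u (W + n - W)) \<le> B / 2"
    proof (rule W[of "W + n" "\<lambda>k. u (k - W)" B])
      show "2 * W \<le> W + n" using n by simp
      show "\<forall>k\<ge>W + n - W. u (Suc k - W) = A k (u (k - W))"
      proof (intro allI impI)
        fix k assume "W + n - W \<le> k"
        then have k: "W \<le> k" "n - W \<le> k - W" using n by auto
        then show "u (Suc k - W) = A k (u (k - W))" using u[of "k - W"] by (simp add: Suc_diff_le)
      qed
      show "\<forall>k. W + n - W \<le> k \<longrightarrow> k \<le> W + n + W \<longrightarrow> norm (u (k - W)) \<le> B"
      proof (intro allI impI)
        fix k assume k: "W + n - W \<le> k" "k \<le> W + n + W"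
        show "norm (u (k - W)) \<le> B" by (rule B) (use k n in auto)
      qed
    qed
    then show "norm (u n) \<le> B / 2" by simp
  qed
  then show ?thesis by blast
qed

text \<open>Ansatz: \<open>x n\<close> plus \<open>\<rho> ^ n\<close> times a bounded sequence is an
  exact orbit of \<open>\<Phi> T\<close> from some index on. Separating the linear part at
  \<open>x n\<close> yields the nonlinear recursion.\<close>

theorem shadowing: "\<exists>y C. \<forall>\<^sub>F t in at_top. norm (X t - \<Phi> t y) \<le> C * exp (\<mu> * t)"
proof -
  obtain W \<Lambda> where hyp: "hyperbolic_sequence (\<lambda>i. A (W + i)) \<Lambda> W" using hyperbolic by blast
  obtain \<kappa> where \<kappa>: "\<kappa> > 0" and
    solve: "\<And>G. \<lbrakk>\<And>n. norm (G n 0) \<le> \<kappa>;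
           \<And>n v w. norm v \<le> 1 \<Longrightarrow> norm w \<le> 1 \<Longrightarrow> norm (G n v - G n w) \<le> \<kappa> * norm (v - w)\<rbrakk>
      \<Longrightarrow> \<exists>u. (\<forall>n. u (Suc n) = A (W + n) (u n) + G n (u n)) \<and> (\<forall>n. norm (u n) \<le> 1)"
    using hyperbolic_sequence.nonlinear_bounded_solution[OF hyp] by blast
  \<comment> \<open>The factor \<open>\<rho>\<close> offsets the division by
    \<open>\<rho> ^ Suc n\<close>, one power more than the size \<open>\<rho> ^ n\<close> of the
    correction.\<close>
  define \<epsilon> where "\<epsilon> = \<kappa> * \<rho>"
  have \<epsilon>: "\<epsilon> > 0" using \<kappa> \<rho> by (simp add: \<epsilon>_def)
  obtain \<delta> where \<delta>: "\<delta> > 0" and strict: "\<And>y a b. y\<in>cball 0 r \<Longrightarrow> a\<in>ball y \<delta> \<Longrightarrow> b\<in>ball y \<delta> \<Longrightarrow>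
           norm (\<Phi> T a - \<Phi> T b - DP T y (a - b)) \<le> \<epsilon> * norm (a - b)"
    using flow_strictly_differentiable[OF \<epsilon>, of r T] by auto
  have "(\<lambda>n. \<rho> ^ n) \<longlonglongrightarrow> 0" using \<rho> by (intro LIMSEQ_power_zero) simp
  from order_tendstoD(2)[OF this \<delta>] have ev1: "\<forall>\<^sub>F n in sequentially. \<rho> ^ n < \<delta>" .
  define \<sigma> where "\<sigma> = exp (\<nu> * T)"
  have \<sigma>: "0 < \<sigma>" "\<sigma> < \<rho>" using \<nu> T by (simp_all add: \<sigma>_def \<rho>_def)
  have \<sigma>_power: "exp (\<nu> * (real n * T)) = \<sigma> ^ n" for n by (simp add: \<sigma>_def exp_of_nat_mult[symmetric] mult_ac)
  have "(\<lambda>n. (\<sigma> / \<rho>) ^ n) \<longlonglongrightarrow> 0" using \<sigma> \<rho> by (intro LIMSEQ_power_zero) simp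
  from order_tendstoD(2)[OF this \<epsilon>] have ev2: "\<forall>\<^sub>F n in sequentially. (\<sigma> / \<rho>) ^ n < \<epsilon>" .
  have "\<forall>\<^sub>F n in sequentially. \<rho> ^ n < \<delta> \<and> (\<sigma> / \<rho>) ^ n < \<epsilon> \<and> t0 \<le> real n * T \<and> W \<le> n"
    using ev1 ev2 eventually_large eventually_ge_at_top[of W] by eventually_elim simp
  then obtain N where N: "\<And>n. N \<le> n \<Longrightarrow> \<rho> ^ n < \<delta> \<and> (\<sigma> / \<rho>) ^ n < \<epsilon> \<and> t0 \<le> real n * T \<and> W \<le> n"
    unfolding eventually_sequentially by blast
  \<comment> \<open>Rescaled remainder of the ansatz: the nonlinear part of the flow increment, then
    the one-step error of the samples.\<close>
  define H where "H n v = inverse (\<rho> ^ Suc n) *\<^sub>R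
      (\<Phi> T (x n + \<rho> ^ n *\<^sub>R v) - \<Phi> T (x n) - DP T (x n) (\<rho> ^ n *\<^sub>R v) + (\<Phi> T (x n) - x (Suc n)))" for n v
  \<comment> \<open>\<^term>\<open>\<kappa>\<close> belongs to the recursion started at \<^term>\<open>W\<close>, so \<^term>\<open>N\<close> cannot serve as its
    starting point; the nonlinearity is switched on at \<^term>\<open>N\<close> instead.\<close>
  define G where "G i v = (if W + i < N then 0 else H (W + i) v)" for i v
  have H0: "norm (H n 0) \<le> \<kappa>" if "N \<le> n" for n
  proof -
    have "norm (H n 0) = inverse (\<rho> ^ Suc n) * norm (x (Suc n) - \<Phi> T (x n))"
      using \<rho> by (simp add: H_def linear_0[OF linear_DP] norm_minus_commute)
    also have "\<dots> \<le> inverse (\<rho> ^ Suc n) * \<sigma> ^ n"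
      using x_error[of n] N[OF that] \<rho> unfolding \<sigma>_power by (intro mult_left_mono) auto
    also have "\<dots> = (\<sigma> / \<rho>) ^ n / \<rho>" using \<rho> by (simp add: field_simps)
    also have "\<dots> \<le> \<epsilon> / \<rho>" using N[OF that] \<rho> by (intro divide_right_mono) auto
    finally show ?thesis using \<rho> by (simp add: \<epsilon>_def)
  qed
  have HL: "norm (H n v - H n w) \<le> \<kappa> * norm (v - w)" if n: "N \<le> n" and vw: "norm v \<le> 1" "norm w \<le> 1" for n v w
  proof -
    have small: "x n + \<rho> ^ n *\<^sub>R y \<in> ball (x n) \<delta>" if "norm y \<le> 1" for y :: 'a
    proof -
      have "\<rho> ^ n * norm y \<le> \<rho> ^ n * 1" using that \<rho> by (intro mult_left_mono) auto
      then have "\<rho> ^ n * norm y < \<delta>" using N[OF n] by linarith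
      then show ?thesis using \<rho> by (simp add: dist_norm)
    qed
    have d: "DP T (x n) ((x n + \<rho> ^ n *\<^sub>R v) - (x n + \<rho> ^ n *\<^sub>R w)) = DP T (x n) (\<rho> ^ n *\<^sub>R v) - DP T (x n) (\<rho> ^ n *\<^sub>R w)"
      unfolding add_diff_cancel_left by (rule linear_diff[OF linear_DP])
    have "H n v - H n w = inverse (\<rho> ^ Suc n) *\<^sub>R
      (\<Phi> T (x n + \<rho> ^ n *\<^sub>R v) - \<Phi> T (x n + \<rho> ^ n *\<^sub>R w) - DP T (x n) ((x n + \<rho> ^ n *\<^sub>R v) - (x n + \<rho> ^ n *\<^sub>R w)))"
      unfolding H_def d by (simp add: algebra_simps)
    then have "norm (H n v - H n w) = inverse (\<rho> ^ Suc n) *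
      norm (\<Phi> T (x n + \<rho> ^ n *\<^sub>R v) - \<Phi> T (x n + \<rho> ^ n *\<^sub>R w) - DP T (x n) ((x n + \<rho> ^ n *\<^sub>R v) - (x n + \<rho> ^ n *\<^sub>R w)))"
      using \<rho> by simp
    also have "\<dots> \<le> inverse (\<rho> ^ Suc n) * (\<epsilon> * norm ((x n + \<rho> ^ n *\<^sub>R v) - (x n + \<rho> ^ n *\<^sub>R w)))"
      using \<rho> by (intro mult_left_mono strict x_in_cball small vw) auto
    also have "(x n + \<rho> ^ n *\<^sub>R v) - (x n + \<rho> ^ n *\<^sub>R w) = \<rho> ^ n *\<^sub>R (v - w)" by (simp add: scaleR_diff_right)
    also have "norm (\<rho> ^ n *\<^sub>R (v - w)) = \<rho> ^ n * norm (v - w)" using \<rho> by simp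
    also have "inverse (\<rho> ^ Suc n) * (\<epsilon> * (\<rho> ^ n * norm (v - w))) = \<kappa> * norm (v - w)"
      using \<rho> by (simp add: \<epsilon>_def field_simps)
    finally show ?thesis .
  qed
  have "\<exists>u. (\<forall>n. u (Suc n) = A (W + n) (u n) + G n (u n)) \<and> (\<forall>n. norm (u n) \<le> 1)"
  proof (rule solve)
    show "norm (G n 0) \<le> \<kappa>" for n using H0 \<kappa> by (simp add: G_def)
    show "norm (G n v - G n w) \<le> \<kappa> * norm (v - w)" if "norm v \<le> 1" "norm w \<le> 1" for n v w
      using HL[OF _ that] \<kappa> by (simp add: G_def)
  qed
  then obtain u where u: "\<And>n. u (Suc n) = A (W + n) (u n) + G n (u n)" and u1: "\<And>n. norm (u n) \<le> 1" by blast
  define w where "w n = \<rho> ^ n *\<^sub>R u (n - W)" for n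
  have w_le: "norm (w n) \<le> \<rho> ^ n" for n
    using u1[of "n - W"] \<rho> by (simp add: w_def mult_left_le)
  have w_step: "x (Suc n) + w (Suc n) = \<Phi> T (x n + w n)" if n: "N \<le> n" for n
  proof -
    have W: "W + (n - W) = n" "Suc n - W = Suc (n - W)" using N[OF n] by auto
    have "w (Suc n) = \<rho> ^ Suc n *\<^sub>R (A n (u (n - W)) + H n (u (n - W)))"
      using u[of "n - W"] n by (simp add: w_def W G_def)
    also have "\<dots> = DP T (x n) (w n) + (\<Phi> T (x n + w n) - \<Phi> T (x n) - DP T (x n) (w n) + (\<Phi> T (x n) - x (Suc n)))"
      using \<rho> by (simp add: A_def H_def w_def scaleR_add_right linear_scale[OF linear_DP] del: power_Suc) (simp add: power_Suc)
    finally show ?thesis by simp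
  qed
  \<comment> \<open>Only indices from \<open>N\<close> on form an exact orbit, so its point at time
    \<open>N * T\<close> is flowed back to time 0.\<close>
  define y where "y = \<Phi> (- (N * T)) (x N + w N)"
  have shadow: "x (N + k) + w (N + k) = \<Phi> (real (N + k) * T) y" for k
  proof (induction k)
    case 0
    then show ?case by (simp add: y_def)
  next
    case (Suc k)
    have "x (N + Suc k) + w (N + Suc k) = \<Phi> T (\<Phi> (real (N + k) * T) y)" using w_step[of "N + k"] Suc by simp
    also have "\<dots> = \<Phi> (real (N + Suc k) * T) y" by (simp add: algebra_simps flip: flow_add)
    finally show ?case .
  qed
  obtain C where C: "C > 0"
    "\<And>a b t. a \<in> cball 0 (r+1) \<Longrightarrow> b \<in> cball 0 (r+1) \<Longrightarrow> 0 \<le> t \<Longrightarrow> t \<le> T \<Longrightarrow> norm (\<Phi> t a - \<Phi> t b) \<le> C * norm (a - b)"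
    using flow_lipschitz[of T "r+1"] T by auto
  have "norm (X t - \<Phi> t y) \<le> (1 + C) * inverse \<rho> * exp (\<mu> * t)" if t: "real (Suc N) * T \<le> t" for t
  proof -
    define n where "n = nat \<lfloor>t / T\<rfloor>"
    define h where "h = t - n * T"
    have tT: "real (Suc N) \<le> t / T" using t T by (simp add: pos_le_divide_eq)
    then have "0 \<le> \<lfloor>t / T\<rfloor>" by simp
    then have rn: "real n = of_int \<lfloor>t / T\<rfloor>" by (simp add: n_def)
    have "real n \<le> t / T" "t / T < real n + 1" unfolding rn by linarith+
    then have h: "0 \<le> h" "h \<le> T" using T by (simp_all add: h_def field_simps)
    have nN: "N \<le> n" using tT \<open>t / T < real n + 1\<close> by simp
    have t_eq: "t = h + n * T" by (simp add: h_def)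
    \<comment> \<open>Between sampling times: one pseudotrajectory error over time \<open>h\<close>,
      plus the Lipschitz spread of two nearby start points.\<close>
    have "X t - \<Phi> t y = (X (n * T + h) - \<Phi> h (X (n * T))) + (\<Phi> h (x n) - \<Phi> h (x n + w n))"
      using shadow[of "n - N"] nN by (simp add: t_eq flow_add x_def add.commute)
    also have "norm \<dots> \<le> \<sigma> ^ n + C * norm (x n - (x n + w n))"
    proof (rule norm_triangle_mono)
      show "norm (X (n * T + h) - \<Phi> h (X (n * T))) \<le> \<sigma> ^ n"
        using error[of "n * T" h] N[OF nN] h T by (simp add: \<sigma>_power)
      have "norm (x n + w n) \<le> norm (x n) + norm (w n)" by (rule norm_triangle_ineq)
      also have "\<dots> \<le> r + 1"
        using x_in_cball[of n] w_le[of n] power_le_one[of \<rho> n] \<rho> by simp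
      finally show "norm (\<Phi> h (x n) - \<Phi> h (x n + w n)) \<le> C * norm (x n - (x n + w n))"
        using h x_in_cball[of n] by (intro C(2)) auto
    qed
    also have "\<dots> \<le> \<rho> ^ n + C * \<rho> ^ n"
      using \<sigma> w_le[of n] C(1) by (intro add_mono power_mono mult_left_mono) auto
    also have "\<dots> = (1 + C) * exp (\<mu> * (n * T))" unfolding \<rho>_power by (simp add: algebra_simps)
    \<comment> \<open>\<open>t\<close> exceeds \<open>n * T\<close> by at most \<open>T\<close>,
      which costs the factor \<open>inverse \<rho>\<close>.\<close>
    also have "\<dots> \<le> (1 + C) * (inverse \<rho> * exp (\<mu> * t))"
    proof (intro mult_left_mono)
      have "\<mu> * T \<le> \<mu> * h" using h \<mu> by (intro mult_left_mono_neg) auto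
      then show "exp (\<mu> * (n * T)) \<le> inverse \<rho> * exp (\<mu> * t)"
        by (simp add: \<rho>_def t_eq algebra_simps flip: exp_minus exp_add)
    qed (use C in simp)
    finally show ?thesis by (simp add: mult.assoc)
  qed
  then show ?thesis
    by (intro exI[of _ y] exI[of _ "(1 + C) * inverse \<rho>"] eventually_mono[OF eventually_ge_at_top[of "real (Suc N) * T"]])
qed

end

section \<open>Orbits accumulating at a point with a Lojasiewicz inequality\<close>

text \<open>\<open>grad\<close> is a definite description, so both existence and uniqueness are
  owed; the representing vector is read off in the standard basis.\<close>

lemma gderiv_grad:
  fixes V :: "'a::euclidean_space \<Rightarrow> real"
  assumes "C1_map V"
  shows "GDERIV V x :> grad V x"
proof -
  obtain D where D: "(V has_derivative blinfun_apply D) (at x)"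
    using assms by (auto simp: C1_map_def)
  define g where "g = (\<Sum>b\<in>Basis. D b *\<^sub>R b)"
  have "blinfun_apply D = (\<lambda>h. h \<bullet> g)"
  proof
    fix h
    have "D h = D (\<Sum>b\<in>Basis. (h \<bullet> b) *\<^sub>R b)" by (simp add: euclidean_representation)
    also have "\<dots> = (\<Sum>b\<in>Basis. (h \<bullet> b) * D b)" by (simp add: blinfun.sum_right blinfun.scaleR_right)
    also have "\<dots> = h \<bullet> g" by (simp add: g_def inner_sum_right mult.commute)
    finally show "D h = h \<bullet> g" .
  qed
  then have g: "GDERIV V x :> g" using D by (simp add: gderiv_def)
  have "g' = g" if "GDERIV V x :> g'" for g'
  proof -
    have "(\<lambda>h. h \<bullet> g') = (\<lambda>h. h \<bullet> g)"
      using that g unfolding gderiv_def by (rule has_derivative_unique)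
    then have "h \<bullet> (g' - g) = 0" for h by (simp add: inner_diff_right fun_eq_iff)
    from this[of "g' - g"] show ?thesis by simp
  qed
  with g show ?thesis unfolding grad_def by (rule theI)
qed

text \<open>For \<open>\<theta> = 1/2\<close> the inequality is linear and an integrating factor
  suffices. Otherwise, with \<open>q = 1 - 2 * \<theta>\<close>, \<open>v powr (- q)\<close> grows
  at rate at least \<open>q * b\<close> while \<open>v\<close> is positive; dropping its initial
  value gives a bound free of \<open>v s\<close>.\<close>

lemma power_decay:
  fixes v v' :: "real \<Rightarrow> real"
  assumes der: "\<And>t. s \<le> t \<Longrightarrow> (v has_real_derivative v' t) (at t)"
    and nonneg: "\<And>t. s \<le> t \<Longrightarrow> 0 \<le> v t" and b: "0 \<le> b"
    and le: "\<And>t. s \<le> t \<Longrightarrow> v' t \<le> - b * v t powr (2 * (1 - \<theta>))"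
  shows exp_decay: "\<theta> = 1/2 \<Longrightarrow> s \<le> t \<Longrightarrow> v t \<le> v s * exp (- b * (t - s))"
    and powr_decay: "0 < \<theta> \<Longrightarrow> \<theta> < 1/2 \<Longrightarrow> 0 < b \<Longrightarrow> s < t \<Longrightarrow> v t \<le> ((1 - 2 * \<theta>) * b * (t - s)) powr (- (1 / (1 - 2 * \<theta>)))"
proof -
  assume \<theta>: "\<theta> = 1/2" and t: "s \<le> t"
  have "v t * exp (b * (t - s)) \<le> v s * exp (b * (s - s))"
  proof (rule DERIV_nonpos_imp_nonincreasing[OF t])
    fix y assume y: "s \<le> y" "y \<le> t"
    have "((\<lambda>y. v y * exp (b * (y - s))) has_real_derivative (v' y + b * v y) * exp (b * (y - s))) (at y)"
      using der[OF y(1)] by (auto intro!: derivative_eq_intros simp: algebra_simps)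
    moreover have "v' y + b * v y \<le> 0" using le[OF y(1)] nonneg[OF y(1)] \<theta> by (cases "v y = 0") auto
    ultimately show "\<exists>d. ((\<lambda>y. v y * exp (b * (y - s))) has_real_derivative d) (at y) \<and> d \<le> 0"
      by (intro exI[of _ "(v' y + b * v y) * exp (b * (y - s))"] conjI) (auto intro: mult_nonpos_nonneg)
  qed
  then have "v t \<le> v s / exp (b * (t - s))" by (simp add: pos_le_divide_eq)
  then show "v t \<le> v s * exp (- b * (t - s))" unfolding mult_minus_left exp_minus divide_inverse .
next
  assume \<theta>: "0 < \<theta>" "\<theta> < 1/2" and b: "0 < b" and t: "s < t"
  define q where "q = 1 - 2 * \<theta>"
  have q: "0 < q" using \<theta> by (simp add: q_def)
  show "v t \<le> ((1 - 2 * \<theta>) * b * (t - s)) powr (- (1 / (1 - 2 * \<theta>)))"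
    unfolding q_def[symmetric]
  \<comment> \<open>If \<open>v t\<close> is positive, monotonicity keeps \<open>v\<close> positive
    on the whole interval, where its negative power is differentiable.\<close>
  proof (cases "v t = 0")
    case False
    have mono: "v t \<le> v y" if y: "s \<le> y" "y \<le> t" for y
    proof (rule DERIV_nonpos_imp_nonincreasing[OF y(2)])
      fix x assume x: "y \<le> x" "x \<le> t"
      then have "s \<le> x" using y by simp
      from le[OF this] have "v' x \<le> 0" using b by (smt (verit) mult_minus_left mult_nonneg_nonneg powr_ge_zero)
      then show "\<exists>d. (v has_real_derivative d) (at x) \<and> d \<le> 0" using der[OF \<open>s \<le> x\<close>] by blast
    qed
    have vt: "0 < v t" using False nonneg[of t] t by simp
    have "v s powr (- q) - q * b * (s - s) \<le> v t powr (- q) - q * b * (t - s)"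
    proof (rule DERIV_nonneg_imp_nondecreasing[of s t])
      fix y assume y: "s \<le> y" "y \<le> t"
      have vy: "0 < v y" using mono[OF y] vt by simp
      have "((\<lambda>y. v y powr (- q)) has_real_derivative (- q) * v y powr (- q - 1) * v' y) (at y)"
        using has_real_derivative_powr[OF vy, of "- q"] der[OF y(1)] by (rule DERIV_chain2)
      moreover have "((\<lambda>y. q * b * (y - s)) has_real_derivative q * b) (at y)" by (auto intro!: derivative_eq_intros)
      ultimately have "((\<lambda>y. v y powr (- q) - q * b * (y - s)) has_real_derivative (- q) * v y powr (- q - 1) * v' y - q * b) (at y)"
        by (rule DERIV_diff)
      moreover have "q * b \<le> (- q) * v y powr (- q - 1) * v' y"
      proof -
        have "v y powr (- q - 1) * v' y \<le> v y powr (- q - 1) * (- b * v y powr (2 * (1 - \<theta>)))"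
          using le[OF y(1)] by (intro mult_left_mono) auto
        also have "\<dots> = - b * v y powr ((- q - 1) + (2 * (1 - \<theta>)))" unfolding powr_add by (simp only: mult_ac)
        also have "(- q - 1) + (2 * (1 - \<theta>)) = 0" by (simp add: q_def)
        finally have "v y powr (- q - 1) * v' y \<le> - b" using vy by simp
        then have "q * (v y powr (- q - 1) * v' y) \<le> q * - b" using q by (intro mult_left_mono) auto
        then show ?thesis by simp
      qed
      ultimately show "\<exists>d. ((\<lambda>y. v y powr (- q) - q * b * (y - s)) has_real_derivative d) (at y) \<and> 0 \<le> d" by force
    qed (use t in simp)
    then have "v s powr (- q) \<le> v t powr (- q) - q * b * (t - s)" by simp
    then have "q * b * (t - s) \<le> v t powr (- q)" using powr_ge_zero[of "v s" "- q"] by linarith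
    moreover have "0 < q * b * (t - s)" using q b t by simp
    ultimately have "(v t powr (- q)) powr (- (1 / q)) \<le> (q * b * (t - s)) powr (- (1 / q))"
      using q by (intro powr_mono2') auto
    moreover have "(v t powr (- q)) powr (- (1 / q)) = v t" using vt q by (simp add: powr_powr)
    ultimately show "v t \<le> (q * b * (t - s)) powr (- (1 / q))" by simp
  qed simp
qed

locale Lojasiewicz_flow = C1_flow +
  fixes V :: "'a \<Rightarrow> real"
  assumes C1_V: "C1_map V" and strict: "strict_Lyapounov F \<Phi> V"
begin

lemma V_derivative: "((\<lambda>t. V (\<Phi> t y)) has_real_derivative grad V (\<Phi> t y) \<bullet> F (\<Phi> t y)) (at t)"
proof -
  have "(V has_derivative (\<lambda>h. h \<bullet> grad V (\<Phi> t y))) (at (\<Phi> t y))"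
    using gderiv_grad[OF C1_V] by (simp add: gderiv_def)
  from diff_chain_at[OF flow_has_vector_derivative[unfolded has_vector_derivative_def] this]
  show ?thesis unfolding has_field_derivative_def
    by (simp add: o_def inner_commute mult_commute_abs)
qed

lemma V_antimono:
  assumes "s \<le> t"
  shows "V (\<Phi> t y) \<le> V (\<Phi> s y)"
proof -
  have t: "\<Phi> t y = \<Phi> (t - s) (\<Phi> s y)" by (simp flip: flow_add)
  show ?thesis
  proof (cases "\<Phi> s y \<in> Eq F \<or> t = s")
    case True
    then show ?thesis using flow_fixed unfolding t by auto
  next
    case False
    then show ?thesis using strict assms unfolding t strict_Lyapounov_def
      by (intro less_imp_le) simp
  qed
qed

text \<open>A positive derivative would let \<open>V\<close> increase for a short time. The sign
  turns the absolute values in the angle and gradient conditions into decay of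
  \<open>V\<close>.\<close>

lemma grad_inner_F_le: "grad V x \<bullet> F x \<le> 0"
proof (rule ccontr)
  assume "\<not> ?thesis"
  then have "0 < grad V (\<Phi> 0 x) \<bullet> F (\<Phi> 0 x)" by simp
  from DERIV_pos_inc_right[OF V_derivative this] obtain d where
    d: "0 < d" "\<And>h. 0 < h \<Longrightarrow> h < d \<Longrightarrow> V (\<Phi> 0 x) < V (\<Phi> (0 + h) x)" by blast
  have "0 < d / 2" "d / 2 < d" using d(1) by simp_all
  from d(2)[OF this] V_antimono[of 0 "d / 2" x] show False using d(1) by simp
qed

end

text \<open>\<open>Lojasiewicz_at\<close> permits the constant 0, whereas divisions by
  \<open>c\<close> occur below; a zero constant can be enlarged first. The orbit is only assumed to
  accumulate at \<open>p\<close>; convergence is a result.\<close>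

locale Lojasiewicz_trajectory = Lojasiewicz_flow +
  fixes p y :: 'a and \<theta> c :: real
  assumes Loj: "Lojasiewicz_at V p \<theta> c" and angle: "angle_condition_at F V p"
    and c: "c > 0"
    and limit_point: "\<And>\<epsilon> s. 0 < \<epsilon> \<Longrightarrow> \<exists>t\<ge>s. dist (\<Phi> t y) p < \<epsilon>"
begin

definition v :: "real \<Rightarrow> real" where "v t = V (\<Phi> t y) - V p"

lemma \<theta>: "0 < \<theta>" "\<theta> \<le> 1/2"
  using Loj by (simp_all add: Lojasiewicz_at_def)

lemma v_derivative: "(v has_real_derivative grad V (\<Phi> t y) \<bullet> F (\<Phi> t y)) (at t)"
  unfolding v_def[abs_def] using V_derivative by (auto intro!: derivative_eq_intros)

lemma v_antimono: "s \<le> t \<Longrightarrow> v t \<le> v s"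
  using V_antimono by (simp add: v_def)

lemma v_near_0:
  assumes "\<epsilon> > 0"
  shows "\<exists>t\<ge>s. \<bar>v t\<bar> < \<epsilon>"
proof -
  have "continuous (at p) V" using strict by (simp add: strict_Lyapounov_def continuous_on_eq_continuous_at)
  then obtain d where d: "d > 0" "\<And>x. dist x p < d \<Longrightarrow> dist (V x) (V p) < \<epsilon>"
    using assms unfolding continuous_at_eps_delta by blast
  obtain t where "t \<ge> s" "dist (\<Phi> t y) p < d" using limit_point[OF d(1)] by blast
  then show ?thesis using d(2) by (auto simp: v_def dist_real_def)
qed

lemma v_nonneg: "0 \<le> v t"
proof (rule ccontr)
  assume "\<not> ?thesis"
  then obtain s where "s \<ge> t" "\<bar>v s\<bar> < - v t" using v_near_0[of "- v t" t] by auto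
  then show False using v_antimono[of t s] by simp
qed

lemma v_tendsto: "(v \<longlongrightarrow> 0) at_top"
  unfolding tendsto_iff eventually_at_top_linorder
proof (intro allI impI)
  fix \<epsilon> :: real assume "\<epsilon> > 0"
  then obtain s where "\<bar>v s\<bar> < \<epsilon>" using v_near_0[of \<epsilon> 0] by blast
  then show "\<exists>N. \<forall>n\<ge>N. dist (v n) 0 < \<epsilon>"
    using v_antimono v_nonneg by (intro exI[of _ s] allI impI) (force simp: dist_real_def abs_of_nonneg)
qed

lemma v_powr_tendsto: "((\<lambda>t. v t powr \<theta>) \<longlongrightarrow> 0) at_top"
  by (rule tendsto_zero_powrI[OF v_tendsto tendsto_const]) (use \<theta> v_nonneg in auto)

text \<open>\<open>v powr \<theta>\<close> acts as a potential for arc length: by the angle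
  condition and the Lojasiewicz inequality it decreases at least as fast as a fixed multiple of the
  speed. So the length still to come is at most a multiple of \<open>v powr \<theta>\<close>, as
  long as the orbit stays where both conditions hold.\<close>

lemma distance_bound: "\<exists>\<kappa>\<ge>0. \<exists>s. \<forall>t\<ge>s. norm (\<Phi> t y - p) \<le> \<kappa> * v t powr \<theta>"
\<comment> \<open>The power is not differentiable where \<open>v\<close> vanishes; there strictness
  of \<open>V\<close> forces the orbit to rest, and accumulation puts it at
  \<open>p\<close>.\<close>
proof (cases "\<exists>t1. v t1 = 0")
  case True
  then obtain t1 where t1: "v t1 = 0" by blast
  have "\<Phi> t1 y \<in> Eq F"
  proof (rule ccontr)
    assume "\<Phi> t1 y \<notin> Eq F"
    then have "V (\<Phi> 1 (\<Phi> t1 y)) < V (\<Phi> t1 y)" using strict by (simp add: strict_Lyapounov_def)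
    then have "v (1 + t1) < v t1" by (simp add: v_def flow_add)
    then show False using t1 v_nonneg[of "1 + t1"] by simp
  qed
  then have const: "\<Phi> t y = \<Phi> t1 y" for t using flow_fixed[of "\<Phi> t1 y" "t - t1"] by (simp flip: flow_add)
  have "\<Phi> t1 y = p"
  proof (rule ccontr)
    assume "\<Phi> t1 y \<noteq> p"
    then obtain t where "dist (\<Phi> t y) p < dist (\<Phi> t1 y) p" using limit_point[of "dist (\<Phi> t1 y) p" 0] by auto
    then show False using const[of t] by simp
  qed
  then show ?thesis using const by (intro exI[of _ 0]) auto
next
  case False
  then have v_pos: "0 < v t" for t using v_nonneg[of t] by (metis less_eq_real_def)
  obtain c1 where c1: "c1 > 0" and angle1: "\<forall>\<^sub>F x in nhds p. \<bar>grad V x \<bullet> F x\<bar> \<ge> c1 * norm (grad V x) * norm (F x)"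
    using angle by (auto simp: angle_condition_at_def)
  have "\<forall>\<^sub>F x in nhds p. \<bar>V x - V p\<bar> powr (1 - \<theta>) \<le> c * norm (grad V x)"
    using Loj by (simp add: Lojasiewicz_at_def)
  with angle1 have "\<forall>\<^sub>F x in nhds p. \<bar>grad V x \<bullet> F x\<bar> \<ge> c1 * norm (grad V x) * norm (F x)
      \<and> \<bar>V x - V p\<bar> powr (1 - \<theta>) \<le> c * norm (grad V x)" by eventually_elim simp
  then obtain r where r: "r > 0" and near: "\<And>x. dist x p < r \<Longrightarrow> \<bar>grad V x \<bullet> F x\<bar> \<ge> c1 * norm (grad V x) * norm (F x)
      \<and> \<bar>V x - V p\<bar> powr (1 - \<theta>) \<le> c * norm (grad V x)"
    unfolding eventually_nhds_metric by blast
  \<comment> \<open>\<open>c\<close> stems from the Lojasiewicz inequality, \<open>c1\<close> from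
    the angle condition, \<open>\<theta>\<close> from differentiating the power.\<close>
  define \<kappa> where "\<kappa> = c / (\<theta> * c1)"
  have \<kappa>: "\<kappa> > 0" using c c1 \<theta> by (simp add: \<kappa>_def)
  define w where "w t = \<kappa> * v t powr \<theta>" for t
  define w' where "w' t = \<kappa> * (\<theta> * v t powr (\<theta> - 1) * (grad V (\<Phi> t y) \<bullet> F (\<Phi> t y)))" for t
  have w_der: "(w has_real_derivative w' t) (at t)" for t
    unfolding w_def[abs_def] w'_def
    by (intro DERIV_cmult DERIV_chain2[OF has_real_derivative_powr v_derivative] v_pos)
  have speed: "norm (F (\<Phi> t y)) \<le> - w' t" if "dist (\<Phi> t y) p < r" for t
  proof -
    let ?g = "norm (grad V (\<Phi> t y))" and ?f = "norm (F (\<Phi> t y))"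
    have n1: "c1 * ?g * ?f \<le> - (grad V (\<Phi> t y) \<bullet> F (\<Phi> t y))"
      using near[OF that] grad_inner_F_le[of "\<Phi> t y"] by simp
    have n2: "v t powr (1 - \<theta>) \<le> c * ?g" using near[OF that] v_pos[of t] by (simp add: v_def)
    have "?f = v t powr (\<theta> - 1) * v t powr (1 - \<theta>) * ?f" using v_pos[of t] by (simp flip: powr_add)
    also have "\<dots> \<le> v t powr (\<theta> - 1) * (c * ?g) * ?f" using n2 by (intro mult_right_mono mult_left_mono) auto
    also have "\<dots> = \<kappa> * (\<theta> * v t powr (\<theta> - 1) * (c1 * ?g * ?f))" using c1 \<theta> by (simp add: \<kappa>_def)
    also have "\<dots> \<le> \<kappa> * (\<theta> * v t powr (\<theta> - 1) * (- (grad V (\<Phi> t y) \<bullet> F (\<Phi> t y))))"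
      using n1 \<kappa> \<theta> by (intro mult_left_mono) auto
    also have "\<dots> = - w' t" by (simp add: w'_def)
    finally show ?thesis .
  qed
  have length: "norm (\<Phi> t y - \<Phi> s y) \<le> w s - w t"
    if st: "s \<le> t" and inside: "\<And>u. s \<le> u \<Longrightarrow> u < t \<Longrightarrow> dist (\<Phi> u y) p < r" for s t
  proof (cases "s = t")
    case False
    have "norm (\<Phi> t y - \<Phi> s y) \<le> - w t - - w s"
    proof (rule differentiable_bound_general[of s t "\<lambda>u. \<Phi> u y" "\<lambda>u. - w u" "\<lambda>u. F (\<Phi> u y)" "\<lambda>u. - w' u"])
      show "s < t" using st False by simp
      show "continuous_on {s..t} (\<lambda>u. \<Phi> u y)" by (rule continuous_on_flow_time)
      show "continuous_on {s..t} (\<lambda>u. - w u)"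
        by (intro continuous_on_minus continuous_at_imp_continuous_on ballI DERIV_isCont[OF w_der])
      show "((\<lambda>u. \<Phi> u y) has_vector_derivative F (\<Phi> u y)) (at u)" for u by (rule flow_has_vector_derivative)
      show "((\<lambda>u. - w u) has_vector_derivative - w' u) (at u)" for u
        using DERIV_minus[OF w_der] by (simp add: has_real_derivative_iff_has_vector_derivative)
      show "norm (F (\<Phi> u y)) \<le> - w' u" if "s < u" "u < t" for u using speed inside that by simp
    qed
    then show ?thesis by simp
  qed simp
  have w_nonneg: "0 \<le> w t" for t using \<kappa> by (simp add: w_def)
  have "(w \<longlongrightarrow> \<kappa> * 0) at_top" unfolding w_def[abs_def] by (intro tendsto_mult tendsto_const v_powr_tendsto)
  then have "(w \<longlongrightarrow> 0) at_top" by simp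
  from order_tendstoD(2)[OF this half_gt_zero[OF r]]
  obtain t0 where t0: "\<And>t. t0 \<le> t \<Longrightarrow> w t < r / 2" unfolding eventually_at_top_linorder by blast
  \<comment> \<open>Distance below \<open>r / 2\<close> and remaining length below
    \<open>r / 2\<close>: from this time on the orbit cannot leave the ball of radius
    \<open>r\<close>.\<close>
  obtain s where s: "t0 \<le> s" "dist (\<Phi> s y) p < r / 2" using limit_point[OF half_gt_zero[OF r]] by blast
  have inside: "dist (\<Phi> t y) p < r" if "s \<le> t" for t
  proof (rule first_exit[of s t "\<lambda>t. dist (\<Phi> t y) p" r t])
    show "continuous_on {s..t} (\<lambda>t. dist (\<Phi> t y) p)" by (intro continuous_intros continuous_on_flow_time)
    fix u assume u: "s \<le> u" "u \<le> t" and less: "\<And>q. s \<le> q \<Longrightarrow> q < u \<Longrightarrow> dist (\<Phi> q y) p < r"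
    have "dist (\<Phi> u y) p \<le> norm (\<Phi> u y - \<Phi> s y) + dist (\<Phi> s y) p" unfolding dist_norm by norm
    also have "norm (\<Phi> u y - \<Phi> s y) \<le> w s - w u" by (rule length[OF u(1) less])
    finally show "dist (\<Phi> u y) p < r" using t0[OF s(1)] w_nonneg[of u] s(2) by simp
  qed (use that in auto)
  have "norm (\<Phi> t y - p) \<le> w t" if t: "s \<le> t" for t
  proof (rule field_le_epsilon)
    fix \<epsilon> :: real assume "\<epsilon> > 0"
    \<comment> \<open>Comparison with a later time close to \<open>p\<close> turns the length
      estimate into a bound on the distance to \<open>p\<close>.\<close>
    then obtain u where u: "u \<ge> t" "dist (\<Phi> u y) p < \<epsilon>" using limit_point by blast
    have "norm (\<Phi> t y - p) \<le> norm (\<Phi> u y - \<Phi> t y) + dist (\<Phi> u y) p" unfolding dist_norm by norm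
    also have "norm (\<Phi> u y - \<Phi> t y) \<le> w t - w u" by (rule length[OF u(1) inside]) (use t in simp)
    finally show "norm (\<Phi> t y - p) \<le> w t + \<epsilon>" using w_nonneg[of u] u by simp
  qed
  then show ?thesis unfolding w_def using \<kappa> by (intro exI[of _ \<kappa>] conjI exI[of _ s]) auto
qed

lemma flow_tendsto: "((\<lambda>t. \<Phi> t y) \<longlongrightarrow> p) at_top"
proof -
  obtain \<kappa> s where "\<And>t. t \<ge> s \<Longrightarrow> norm (\<Phi> t y - p) \<le> \<kappa> * v t powr \<theta>" using distance_bound by blast
  then have "\<forall>\<^sub>F t in at_top. norm (\<Phi> t y - p) \<le> \<kappa> * v t powr \<theta>" unfolding eventually_at_top_linorder by blast
  moreover have "((\<lambda>t. \<kappa> * v t powr \<theta>) \<longlongrightarrow> 0) at_top" using tendsto_mult[OF tendsto_const v_powr_tendsto] by simp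
  ultimately have "((\<lambda>t. \<Phi> t y - p) \<longlongrightarrow> 0) at_top" by (rule Lim_null_comparison)
  then show ?thesis by (rule LIM_zero_cancel)
qed

section \<open>Decay rates under the lower bound by the squared gradient\<close>

context
  fixes \<beta> :: real
  assumes \<beta>: "\<beta> > 0" and \<beta>_bound: "\<forall>\<^sub>F x in nhds p. \<bar>grad V x \<bullet> F x\<bar> \<ge> \<beta> * (norm (grad V x))\<^sup>2"
begin

text \<open>Squaring the Lojasiewicz inequality replaces the gradient by a power of
  \<open>v\<close>, at the price of \<open>c\<^sup>2\<close>. The local conditions apply at late
  times because the orbit converges to \<open>p\<close>.\<close>

lemma v_decay: "\<exists>s. \<forall>t\<ge>s. grad V (\<Phi> t y) \<bullet> F (\<Phi> t y) \<le> - (\<beta> / c\<^sup>2) * v t powr (2 * (1 - \<theta>))"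
proof -
  have "\<forall>\<^sub>F x in nhds p. \<bar>V x - V p\<bar> powr (1 - \<theta>) \<le> c * norm (grad V x)"
    using Loj by (simp add: Lojasiewicz_at_def)
  with \<beta>_bound have "\<forall>\<^sub>F x in nhds p. \<bar>grad V x \<bullet> F x\<bar> \<ge> \<beta> * (norm (grad V x))\<^sup>2
      \<and> \<bar>V x - V p\<bar> powr (1 - \<theta>) \<le> c * norm (grad V x)" by eventually_elim simp
  then have "\<forall>\<^sub>F t in at_top. \<bar>grad V (\<Phi> t y) \<bullet> F (\<Phi> t y)\<bar> \<ge> \<beta> * (norm (grad V (\<Phi> t y)))\<^sup>2
      \<and> \<bar>V (\<Phi> t y) - V p\<bar> powr (1 - \<theta>) \<le> c * norm (grad V (\<Phi> t y))"
    using flow_tendsto by (rule eventually_compose_filterlim)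
  then have "\<forall>\<^sub>F t in at_top. grad V (\<Phi> t y) \<bullet> F (\<Phi> t y) \<le> - (\<beta> / c\<^sup>2) * v t powr (2 * (1 - \<theta>))"
  proof eventually_elim
    case (elim t)
    let ?g = "norm (grad V (\<Phi> t y))"
    have "(v t powr (1 - \<theta>))\<^sup>2 \<le> (c * ?g)\<^sup>2"
      using elim v_nonneg[of t] by (intro power_mono) (auto simp: v_def)
    moreover have "(v t powr (1 - \<theta>))\<^sup>2 = v t powr (2 * (1 - \<theta>))"
      using v_nonneg[of t] by (simp add: power2_eq_square flip: powr_add)
    ultimately have "v t powr (2 * (1 - \<theta>)) \<le> c\<^sup>2 * ?g\<^sup>2" by (simp add: power_mult_distrib)
    then have "(\<beta> / c\<^sup>2) * v t powr (2 * (1 - \<theta>)) \<le> (\<beta> / c\<^sup>2) * (c\<^sup>2 * ?g\<^sup>2)"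
      using \<beta> by (intro mult_left_mono) auto
    also have "\<dots> = \<beta> * ?g\<^sup>2" using c by simp
    finally show ?case using elim grad_inner_F_le[of "\<Phi> t y"] by simp
  qed
  then show ?thesis by (simp add: eventually_at_top_linorder)
qed

text \<open>The 2 in the exponent arises because \<open>v\<close> decays at rate
  \<open>\<beta> / c\<^sup>2\<close> while the distance is bounded by a multiple of its square
  root.\<close>

lemma flow_exp_rate:
  assumes "\<theta> = 1/2"
  shows "(\<lambda>t. norm (\<Phi> t y - p)) \<in> O[at_top](\<lambda>t. exp (- \<beta> / (2 * c\<^sup>2) * t))"
proof -
  obtain \<kappa> s where \<kappa>: "\<kappa> \<ge> 0" "\<And>t. t \<ge> s \<Longrightarrow> norm (\<Phi> t y - p) \<le> \<kappa> * v t powr \<theta>" using distance_bound by blast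
  obtain s1 where s1: "\<And>t. s1 \<le> t \<Longrightarrow> grad V (\<Phi> t y) \<bullet> F (\<Phi> t y) \<le> - (\<beta> / c\<^sup>2) * v t powr (2 * (1 - \<theta>))"
    using v_decay by blast
  define b where "b = \<beta> / c\<^sup>2"
  define M where "M = v s1 * exp (b * s1)"
  have b: "b \<ge> 0" using \<beta> by (simp add: b_def)
  have "norm (\<Phi> t y - p) \<le> \<kappa> * sqrt M * exp (- \<beta> / (2 * c\<^sup>2) * t)" if t: "max s s1 \<le> t" for t
  proof -
    have "v t \<le> v s1 * exp (- b * (t - s1))"
      using exp_decay[of s1 v _ b \<theta> t, OF v_derivative v_nonneg b s1[folded b_def] assms] t by simp
    also have "\<dots> = M * exp (- b * t)" by (simp add: M_def algebra_simps flip: exp_add)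
    finally have "v t \<le> M * exp (- b * t)" .
    then have "sqrt (v t) \<le> sqrt (M * exp (- b * t))" by (rule real_sqrt_le_mono)
    also have "\<dots> = sqrt M * sqrt ((exp (- \<beta> / (2 * c\<^sup>2) * t))\<^sup>2)"
      unfolding real_sqrt_mult by (simp add: b_def power2_eq_square field_simps flip: exp_add)
    also have "\<dots> = sqrt M * exp (- \<beta> / (2 * c\<^sup>2) * t)" by simp
    finally have "v t powr \<theta> \<le> sqrt M * exp (- \<beta> / (2 * c\<^sup>2) * t)"
      using v_nonneg[of t] by (simp add: assms powr_half_sqrt)
    then have "\<kappa> * v t powr \<theta> \<le> \<kappa> * (sqrt M * exp (- \<beta> / (2 * c\<^sup>2) * t))" using \<kappa>(1) by (rule mult_left_mono)
    then show ?thesis using \<kappa>(2)[of t] t by (simp only: mult.assoc) simp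
  qed
  then show ?thesis
    by (intro bigoI[of _ "\<kappa> * sqrt M"] eventually_mono[OF eventually_ge_at_top[of "max s s1"]]) simp
qed

lemma flow_powr_rate:
  assumes "\<theta> < 1/2"
  shows "(\<lambda>t. norm (\<Phi> t y - p)) \<in> O[at_top](\<lambda>t. t powr (- \<theta> / (1 - 2 * \<theta>)))"
proof -
  obtain \<kappa> s where \<kappa>: "\<kappa> \<ge> 0" "\<And>t. t \<ge> s \<Longrightarrow> norm (\<Phi> t y - p) \<le> \<kappa> * v t powr \<theta>" using distance_bound by blast
  obtain s1 where s1: "\<And>t. s1 \<le> t \<Longrightarrow> grad V (\<Phi> t y) \<bullet> F (\<Phi> t y) \<le> - (\<beta> / c\<^sup>2) * v t powr (2 * (1 - \<theta>))"
    using v_decay by blast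
  define b where "b = \<beta> / c\<^sup>2"
  have b: "b > 0" using \<beta> c by (simp add: b_def)
  define q where "q = 1 - 2 * \<theta>"
  have q: "q > 0" using assms by (simp add: q_def)
  \<comment> \<open>The half allows \<open>t - s1\<close> to be replaced by \<open>t / 2\<close> for
    large \<open>t\<close>.\<close>
  define a where "a = q * b / 2"
  have a: "a > 0" using q b by (simp add: a_def)
  have "norm (\<Phi> t y - p) \<le> (\<kappa> * a powr (- \<theta> / q)) * t powr (- \<theta> / q)" if t: "max s (max 1 (2 * \<bar>s1\<bar> + 1)) \<le> t" for t
  proof -
    have t': "t \<ge> s" "t \<ge> 1" "t \<ge> 2 * \<bar>s1\<bar> + 1" using t by auto
    then have ts: "s1 < t" "t / 2 \<le> t - s1" by linarith+
    have "v t \<le> (q * b * (t - s1)) powr (- (1 / q))"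
      using powr_decay[of s1 v _ b \<theta> t, OF v_derivative v_nonneg less_imp_le[OF b] s1[folded b_def] \<theta>(1) assms b ts(1)]
      by (simp add: q_def)
    also have "\<dots> \<le> (a * t) powr (- (1 / q))"
    proof (rule powr_mono2')
      have "q * b * (t / 2) \<le> q * b * (t - s1)" using q b ts by (intro mult_left_mono) auto
      then show "a * t \<le> q * b * (t - s1)" by (simp add: a_def)
    qed (use q a t' in auto)
    finally have "v t powr \<theta> \<le> ((a * t) powr (- (1 / q))) powr \<theta>"
      using \<theta> v_nonneg[of t] by (intro powr_mono2) auto
    also have "\<dots> = a powr (- \<theta> / q) * t powr (- \<theta> / q)" using a t' by (simp add: powr_powr powr_mult)
    finally have "\<kappa> * v t powr \<theta> \<le> \<kappa> * (a powr (- \<theta> / q) * t powr (- \<theta> / q))" using \<kappa>(1) by (rule mult_left_mono)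
    then show ?thesis using \<kappa>(2)[OF t'(1)] by (simp only: mult.assoc)
  qed
  then show ?thesis unfolding q_def[symmetric]
    by (intro bigoI[of _ "\<kappa> * a powr (- \<theta> / q)"] eventually_mono[OF eventually_ge_at_top[of "max s (max 1 (2 * \<bar>s1\<bar> + 1))"]]) simp
qed

end

end

section \<open>Pseudotrajectories of gradient-like flows\<close>

text \<open>A real supremum is an upper bound only for sets bounded above; continuity on a compact
  interval provides this.\<close>

lemma shadow_error_upper:
  fixes X :: "real \<Rightarrow> 'a::euclidean_space"
  assumes "C1_map F" "global_flow F \<Phi>" and X: "continuous_on {0..} X" and t: "0 \<le> t" and h: "0 \<le> h" "h \<le> T"
  shows "norm (X (t + h) - \<Phi> h (X t)) \<le> shadow_error \<Phi> X T t"
proof -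
  interpret C1_flow F \<Phi> by standard (rule assms)+
  have "continuous_on {0..T} (\<lambda>h. X (t + h))"
    by (rule continuous_on_compose2[OF X]) (use t in \<open>auto intro!: continuous_intros\<close>)
  then have "compact ((\<lambda>h. norm (X (t + h) - \<Phi> h (X t))) ` {0..T})"
    by (intro compact_continuous_image continuous_intros continuous_on_flow_time) auto
  then have "bdd_above ((\<lambda>h. norm (X (t + h) - \<Phi> h (X t))) ` {0..T})"
    by (intro bounded_imp_bdd_above compact_imp_bounded)
  from cSUP_upper[OF _ this, of h] show ?thesis using h by (simp add: shadow_error_def)
qed

lemma error_rate_less_imp:
  fixes X :: "real \<Rightarrow> 'a::euclidean_space"
  assumes "C1_map F" "global_flow F \<Phi>" "continuous_on {0..} X" and T: "T > 0"
    and less: "error_rate \<Phi> T X < ereal \<mu>"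
  obtains \<nu> t0 where "\<nu> < \<mu>"
    "\<And>t h. \<lbrakk>0 \<le> t; t0 \<le> t; 0 \<le> h; h \<le> T\<rbrakk> \<Longrightarrow> norm (X (t + h) - \<Phi> h (X t)) \<le> exp (\<nu> * t)"
proof -
  obtain \<nu> where \<nu>: "error_rate \<Phi> T X < ereal \<nu>" "\<nu> < \<mu>" using ereal_dense2[OF less] by auto
  have "\<forall>\<^sub>F t in at_top. ereal (1 / t) * ext_log (shadow_error \<Phi> X T t) < ereal \<nu>"
    using \<nu>(1) unfolding error_rate_def by (rule Limsup_lessD)
  then obtain t0 where t0: "\<And>t. t0 \<le> t \<Longrightarrow> ereal (1 / t) * ext_log (shadow_error \<Phi> X T t) < ereal \<nu>"
    unfolding eventually_at_top_linorder by blast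
  show thesis
  proof (rule that[OF \<nu>(2), of "max t0 1"])
    fix t h assume t: "0 \<le> t" "max t0 1 \<le> t" and h: "0 \<le> h" "h \<le> T"
    have le: "norm (X (t + h) - \<Phi> h (X t)) \<le> shadow_error \<Phi> X T t" if "0 \<le> h" "h \<le> T" for h
      by (rule shadow_error_upper[OF assms(1-3)]) (use t that in auto)
    have "shadow_error \<Phi> X T t \<le> exp (\<nu> * t)"
    \<comment> \<open>A vanishing error, where \<open>ext_log\<close> is
      \<open>-\<infinity>\<close>, is bounded trivially; otherwise \<open>ln\<close> can be
      inverted.\<close>
    proof (cases "shadow_error \<Phi> X T t = 0")
      case False
      have "0 \<le> shadow_error \<Phi> X T t" using le[of 0] T norm_ge_zero order_trans by (metis less_imp_le order_refl)
      then have pos: "0 < shadow_error \<Phi> X T t" using False by simp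
      have "ln (shadow_error \<Phi> X T t) / t < \<nu>" using t0[of t] t False by (simp add: ext_log_def)
      then have "ln (shadow_error \<Phi> X T t) < \<nu> * t" using t by (simp add: pos_divide_less_eq)
      then have "exp (ln (shadow_error \<Phi> X T t)) < exp (\<nu> * t)" by (simp only: exp_less_mono)
      then show ?thesis using pos by simp
    qed simp
    then show "norm (X (t + h) - \<Phi> h (X t)) \<le> exp (\<nu> * t)" using le[OF h] by simp
  qed
qed

lemma limit_setD:
  fixes X :: "real \<Rightarrow> 'a::metric_space"
  assumes "z \<in> limit_set X" "\<epsilon> > 0"
  obtains t where "s \<le> t" "dist (X t) z < \<epsilon>"
proof -
  have "z \<in> closure {X (max 0 s + u) | u. u \<ge> 0}" using assms(1) by (simp add: limit_set_def)
  then obtain y where "y \<in> {X (max 0 s + u) | u. u \<ge> 0}" "dist y z < \<epsilon>"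
    using assms(2) unfolding closure_approachable by blast
  then obtain u where "u \<ge> 0" "dist (X (max 0 s + u)) z < \<epsilon>" by blast
  then show thesis by (intro that[of "max 0 s + u"]) auto
qed

lemma limit_set_subset:
  fixes X :: "real \<Rightarrow> 'a::metric_space"
  assumes "(X \<longlongrightarrow> p) at_top"
  shows "limit_set X \<subseteq> {p}"
proof
  fix z assume z: "z \<in> limit_set X"
  have "dist z p \<le> \<epsilon>" if \<epsilon>: "\<epsilon> > 0" for \<epsilon>
  proof -
    obtain s where s: "\<And>t. s \<le> t \<Longrightarrow> dist (X t) p < \<epsilon> / 2"
      using tendstoD[OF assms half_gt_zero[OF \<epsilon>]] unfolding eventually_at_top_linorder by blast
    obtain t where "s \<le> t" "dist (X t) z < \<epsilon> / 2" using limit_setD[OF z half_gt_zero[OF \<epsilon>]] .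
    then show ?thesis using s[of t] dist_triangle2[of z p "X t"] by (simp add: dist_commute)
  qed
  then have "dist z p \<le> 0" by (rule field_le_epsilon) simp
  then show "z \<in> {p}" by simp
qed

lemma Lojasiewicz_at_mono:
  assumes "Lojasiewicz_at V p \<theta> c" "c \<le> c'"
  shows "Lojasiewicz_at V p \<theta> c'"
proof -
  have "\<forall>\<^sub>F x in nhds p. \<bar>V x - V p\<bar> powr (1 - \<theta>) \<le> c * norm (grad V x)"
    using assms(1) by (simp add: Lojasiewicz_at_def)
  then have "\<forall>\<^sub>F x in nhds p. \<bar>V x - V p\<bar> powr (1 - \<theta>) \<le> c' * norm (grad V x)"
  proof eventually_elim
    case (elim x)
    also have "c * norm (grad V x) \<le> c' * norm (grad V x)" using assms(2) by (intro mult_right_mono) auto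
    finally show ?case .
  qed
  then show ?thesis using assms by (simp add: Lojasiewicz_at_def)
qed

lemma exp_bigo_mono: "a \<le> b \<Longrightarrow> (\<lambda>t::real. exp (a * t)) \<in> O[at_top](\<lambda>t. exp (b * t))"
  by (intro bigoI[of _ 1] eventually_mono[OF eventually_ge_at_top[of 0]]) (simp add: mult_right_mono)

lemma exp_bigo_powr:
  fixes \<mu> a :: real
  assumes "\<mu> < 0"
  shows "(\<lambda>t. exp (\<mu> * t)) \<in> O[at_top](\<lambda>t. t powr a)"
  using assms by real_asymp

locale gradient_like_pseudotrajectory =
  fixes F :: "'a::euclidean_space \<Rightarrow> 'a" and \<Phi> V X p \<theta> c\<^sub>0 and T :: real
  assumes C1_F: "C1_map F" and flow: "global_flow F \<Phi>"
    and C1_V: "C1_map V" and Lyapounov: "strict_Lyapounov F \<Phi> V"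
    and apt: "asymptotic_pseudotrajectory \<Phi> X" and bdd: "bounded (X ` {0..})"
    and T: "T > 0"
    and p: "p \<in> limit_set X"
    and Loj: "Lojasiewicz_at V p \<theta> c\<^sub>0" and angle: "angle_condition_at F V p"
begin

text \<open>The orbit inherits \<open>p\<close> as an accumulation point from \<open>X\<close>. The
  constant \<open>c\<close> stays free because \<open>c\<^sub>0\<close> may be 0.\<close>

lemma shadowed:
  assumes "\<mu> \<in> admissible_rates \<Phi> T X"
  obtains y where "(\<lambda>t. norm (X t - \<Phi> t y)) \<in> O[at_top](\<lambda>t. exp (\<mu> * t))"
    "((\<lambda>t. X t - \<Phi> t y) \<longlongrightarrow> 0) at_top"
    "\<And>c. c > 0 \<Longrightarrow> c\<^sub>0 \<le> c \<Longrightarrow> Lojasiewicz_trajectory F \<Phi> V p y \<theta> c"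
proof -
  have adm: "error_rate \<Phi> T X < ereal \<mu>" "\<mu> < 0" "\<mu> \<in> Sacker_Sell_resolvent \<Phi> (limit_set X)"
    using assms by (auto simp: admissible_rates_def)
  have X: "continuous_on {0..} X" using apt by (simp add: asymptotic_pseudotrajectory_def)
  obtain \<nu> t0 where err: "\<nu> < \<mu>"
    "\<And>t h. \<lbrakk>0 \<le> t; t0 \<le> t; 0 \<le> h; h \<le> T\<rbrakk> \<Longrightarrow> norm (X (t + h) - \<Phi> h (X t)) \<le> exp (\<nu> * t)"
    using error_rate_less_imp[OF C1_F flow X T adm(1)] by blast
  obtain r where r: "\<And>t. 0 \<le> t \<Longrightarrow> norm (X t) \<le> r" using bdd unfolding bounded_iff by auto
  interpret pseudotrajectory F \<Phi> X T \<mu> \<nu> t0 r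
    by standard (use C1_F flow T err adm r in auto)
  obtain y C where yC: "\<forall>\<^sub>F t in at_top. norm (X t - \<Phi> t y) \<le> C * exp (\<mu> * t)" using shadowing by blast
  have "((\<lambda>t. exp (\<mu> * t)) \<longlongrightarrow> 0) at_top" using adm(2) by real_asymp
  then have "((\<lambda>t. C * exp (\<mu> * t)) \<longlongrightarrow> C * 0) at_top" by (intro tendsto_mult tendsto_const)
  then have "((\<lambda>t. C * exp (\<mu> * t)) \<longlongrightarrow> 0) at_top" by simp
  with yC have lim: "((\<lambda>t. X t - \<Phi> t y) \<longlongrightarrow> 0) at_top" by (rule Lim_null_comparison)
  have near: "\<exists>t\<ge>s. dist (\<Phi> t y) p < \<epsilon>" if \<epsilon>: "\<epsilon> > 0" for \<epsilon> s
  proof -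
    obtain s1 where s1: "\<And>t. s1 \<le> t \<Longrightarrow> dist (X t) (\<Phi> t y) < \<epsilon> / 2"
      using tendstoD[OF lim half_gt_zero[OF \<epsilon>]] unfolding eventually_at_top_linorder by (auto simp: dist_norm)
    obtain t where t: "max s s1 \<le> t" "dist (X t) p < \<epsilon> / 2" using limit_setD[OF p half_gt_zero[OF \<epsilon>]] .
    then have "dist (\<Phi> t y) p < \<epsilon>" using s1[of t] dist_triangle3[of "\<Phi> t y" p "X t"] by simp
    then show ?thesis using t by auto
  qed
  show thesis
  proof (rule that)
    show "(\<lambda>t. norm (X t - \<Phi> t y)) \<in> O[at_top](\<lambda>t. exp (\<mu> * t))"
      using yC by (intro bigoI[of _ C]) simp
    show "((\<lambda>t. X t - \<Phi> t y) \<longlongrightarrow> 0) at_top" by (rule lim)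
    show "Lojasiewicz_trajectory F \<Phi> V p y \<theta> c" if "c > 0" "c\<^sub>0 \<le> c" for c
      by standard (use C1_V Lyapounov Lojasiewicz_at_mono[OF Loj] angle that near in auto)
  qed
qed

text \<open>The distance splits into the shadowing error and the distance of the orbit from
  \<open>p\<close>. Leaving \<open>f\<close> open serves the exponential and the power case
  alike.\<close>

lemma rate:
  assumes \<mu>: "\<mu> \<in> admissible_rates \<Phi> T X" and f: "(\<lambda>t. exp (\<mu> * t)) \<in> O[at_top](f)"
    and c: "c > 0" "c\<^sub>0 \<le> c"
    and true_rate: "\<And>y. Lojasiewicz_trajectory F \<Phi> V p y \<theta> c \<Longrightarrow> (\<lambda>t. norm (\<Phi> t y - p)) \<in> O[at_top](f)"
  shows "(\<lambda>t. norm (X t - p)) \<in> O[at_top](f)"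
proof -
  obtain y where y: "(\<lambda>t. norm (X t - \<Phi> t y)) \<in> O[at_top](\<lambda>t. exp (\<mu> * t))"
    "Lojasiewicz_trajectory F \<Phi> V p y \<theta> c"
    using shadowed[OF \<mu>] c by metis
  have "(\<lambda>t. norm (X t - \<Phi> t y) + norm (\<Phi> t y - p)) \<in> O[at_top](f)"
    by (rule sum_in_bigo[OF landau_o.big_trans[OF y(1) f] true_rate[OF y(2)]])
  moreover have "(\<lambda>t. norm (X t - p)) \<in> O[at_top](\<lambda>t. norm (X t - \<Phi> t y) + norm (\<Phi> t y - p))"
  proof (intro bigoI[of _ 1] always_eventually allI)
    fix t
    have "norm (X t - p) \<le> norm (X t - \<Phi> t y) + norm (\<Phi> t y - p)" by norm
    then show "norm (norm (X t - p)) \<le> 1 * norm (norm (X t - \<Phi> t y) + norm (\<Phi> t y - p))" by simp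
  qed
  ultimately show ?thesis by (rule landau_o.big_trans[rotated])
qed

lemma limit_set_eq:
  assumes "admissible_rates \<Phi> T X \<noteq> {}"
  shows "limit_set X = {p}"
proof -
  obtain \<mu> where \<mu>: "\<mu> \<in> admissible_rates \<Phi> T X" using assms by blast
  have "max c\<^sub>0 1 > 0" "c\<^sub>0 \<le> max c\<^sub>0 1" by auto
  with shadowed[OF \<mu>] obtain y where y: "((\<lambda>t. X t - \<Phi> t y) \<longlongrightarrow> 0) at_top"
    and traj: "Lojasiewicz_trajectory F \<Phi> V p y \<theta> (max c\<^sub>0 1)" by metis
  interpret Lojasiewicz_trajectory F \<Phi> V p y \<theta> "max c\<^sub>0 1" by (rule traj)
  from tendsto_add[OF y flow_tendsto] have "(X \<longlongrightarrow> p) at_top" by simp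
  then show ?thesis using limit_set_subset[of X p] p by blast
qed

context
  fixes \<beta> :: real
  assumes \<beta>: "\<beta> > 0" and \<beta>_bound: "\<forall>\<^sub>F x in nhds p. \<bar>grad V x \<bullet> F x\<bar> \<ge> \<beta> * (norm (grad V x))\<^sup>2"
begin

lemma exp_rate:
  assumes case_\<theta>: "\<theta> = 1/2" and \<mu>: "\<mu> \<in> admissible_rates \<Phi> T X" "\<mu> \<le> e"
    and const: "c > 0" "c\<^sub>0 \<le> c" "- \<beta> / (2 * c\<^sup>2) \<le> e"
  shows "(\<lambda>t. norm (X t - p)) \<in> O[at_top](\<lambda>t. exp (e * t))"
proof (rule rate[OF \<mu>(1) exp_bigo_mono[OF \<mu>(2)] const(1,2)])
  fix y assume "Lojasiewicz_trajectory F \<Phi> V p y \<theta> c"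
  then interpret Lojasiewicz_trajectory F \<Phi> V p y \<theta> c .
  show "(\<lambda>t. norm (\<Phi> t y - p)) \<in> O[at_top](\<lambda>t. exp (e * t))"
    by (rule landau_o.big_trans[OF flow_exp_rate[OF \<beta> \<beta>_bound case_\<theta>] exp_bigo_mono[OF const(3)]])
qed

lemma powr_rate:
  assumes case_\<theta>: "\<theta> < 1/2" and ne: "admissible_rates \<Phi> T X \<noteq> {}"
  shows "(\<lambda>t. norm (X t - p)) \<in> O[at_top](\<lambda>t. t powr (- \<theta> / (1 - 2 * \<theta>)))"
proof -
  obtain \<mu> where \<mu>: "\<mu> \<in> admissible_rates \<Phi> T X" using ne by blast
  then have "\<mu> < 0" by (simp add: admissible_rates_def)
  have "max c\<^sub>0 1 > 0" "c\<^sub>0 \<le> max c\<^sub>0 1" by auto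
  then show ?thesis
  proof (rule rate[OF \<mu> exp_bigo_powr[OF \<open>\<mu> < 0\<close>]])
    fix y assume "Lojasiewicz_trajectory F \<Phi> V p y \<theta> (max c\<^sub>0 1)"
    then interpret Lojasiewicz_trajectory F \<Phi> V p y \<theta> "max c\<^sub>0 1" .
    show "(\<lambda>t. norm (\<Phi> t y - p)) \<in> O[at_top](\<lambda>t. t powr (- \<theta> / (1 - 2 * \<theta>)))"
      by (rule flow_powr_rate[OF \<beta> \<beta>_bound case_\<theta>])
  qed
qed

lemma c0_nonneg: "c\<^sub>0 \<ge> 0"
  using Loj by (simp add: Lojasiewicz_at_def)

lemma gradient_exponent:
  "- ereal \<beta> / ereal (2 * c\<^sub>0\<^sup>2) = (if c\<^sub>0 = 0 then -\<infinity> else ereal (- \<beta> / (2 * c\<^sub>0\<^sup>2)))"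
  using \<beta> by (simp add: divide_ereal_def) (simp add: field_simps)

text \<open>An infimum strictly below the gradient exponent yields an admissible rate below it, so
  the shadowing error is dominated and the exponent is attained.\<close>

lemma attained_exp_rate:
  assumes \<theta>: "\<theta> = 1/2" and less: "(INF \<mu>\<in>admissible_rates \<Phi> T X. ereal \<mu>) < decay_exponent \<Phi> T X \<beta> c\<^sub>0"
  shows "(\<lambda>t. norm (X t - p)) \<in> O[at_top](\<lambda>t. exp (real_of_ereal (decay_exponent \<Phi> T X \<beta> c\<^sub>0) * t))"
proof -
  have less': "(INF \<mu>\<in>admissible_rates \<Phi> T X. ereal \<mu>) < - ereal \<beta> / ereal (2 * c\<^sub>0\<^sup>2)"
    using less unfolding decay_exponent_def less_max_iff_disj by simp
  \<comment> \<open>A zero constant would make the gradient exponent minus infinity, and nothing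
    lies strictly below that.\<close>
  have c0: "c\<^sub>0 \<noteq> 0"
  proof
    assume "c\<^sub>0 = 0"
    then have "- ereal \<beta> / ereal (2 * c\<^sub>0\<^sup>2) = - \<infinity>" unfolding gradient_exponent by simp
    with less' show False by simp
  qed
  have eq: "decay_exponent \<Phi> T X \<beta> c\<^sub>0 = ereal (- \<beta> / (2 * c\<^sub>0\<^sup>2))"
    using less' c0 unfolding decay_exponent_def gradient_exponent by (simp add: max_absorb1)
  obtain \<mu> where "\<mu> \<in> admissible_rates \<Phi> T X" "\<mu> < - \<beta> / (2 * c\<^sub>0\<^sup>2)"
    using less' c0 unfolding gradient_exponent INF_less_iff by auto
  then show ?thesis unfolding eq using exp_rate[OF \<theta>, of \<mu> "- \<beta> / (2 * c\<^sub>0\<^sup>2)" c\<^sub>0] c0 c0_nonneg by simp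
qed

text \<open>The slack provides an admissible rate below \<open>e\<close> even when the infimum is
  not attained, and room for a positive constant when \<open>c\<^sub>0\<close> is 0.\<close>

lemma approximate_exp_rate:
  assumes \<theta>: "\<theta> = 1/2" and less: "decay_exponent \<Phi> T X \<beta> c\<^sub>0 < ereal e"
  shows "(\<lambda>t. norm (X t - p)) \<in> O[at_top](\<lambda>t. exp (e * t))"
proof -
  have 1: "- ereal \<beta> / ereal (2 * c\<^sub>0\<^sup>2) < ereal e" and 2: "(INF \<mu>\<in>admissible_rates \<Phi> T X. ereal \<mu>) < ereal e"
    using less by (simp_all add: decay_exponent_def)
  obtain \<mu> where \<mu>: "\<mu> \<in> admissible_rates \<Phi> T X" "\<mu> < e" using 2 unfolding INF_less_iff by auto
  obtain c where c: "c > 0" "c\<^sub>0 \<le> c" "- \<beta> / (2 * c\<^sup>2) \<le> e"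
  proof (cases "c\<^sub>0 = 0")
    case True
    \<comment> \<open>if the inequality holds with constant \<open>0\<close>, it holds with every positive constant\<close>
    show thesis
    proof (rule that)
      have pos: "0 < \<beta> / (2 * (\<bar>e\<bar> + 1))" using \<beta> by simp
      then show "sqrt (\<beta> / (2 * (\<bar>e\<bar> + 1))) > 0" "c\<^sub>0 \<le> sqrt (\<beta> / (2 * (\<bar>e\<bar> + 1)))" using True by auto
      \<comment> \<open>The witness solves
        \<open>\<beta> / (2 * c\<^sup>2) = \<bar>e\<bar> + 1\<close>, which exceeds
        \<open>- e\<close>.\<close>
      have "- \<beta> / (2 * (sqrt (\<beta> / (2 * (\<bar>e\<bar> + 1))))\<^sup>2) = - (\<bar>e\<bar> + 1)" using pos \<beta> by (simp add: field_simps)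
      then show "- \<beta> / (2 * (sqrt (\<beta> / (2 * (\<bar>e\<bar> + 1))))\<^sup>2) \<le> e" by linarith
    qed
  next
    case False
    then show thesis using 1 c0_nonneg by (intro that[of c\<^sub>0]) (auto simp: gradient_exponent)
  qed
  then show ?thesis using exp_rate[OF \<theta> \<mu>(1) less_imp_le[OF \<mu>(2)]] by blast
qed

end

end

theorem theorem3p3:
  fixes F :: "real ^ 'm \<Rightarrow> real ^ 'm"
    and \<Phi> :: "real \<Rightarrow> real ^ 'm \<Rightarrow> real ^ 'm"
    and V :: "real ^ 'm \<Rightarrow> real"
    and X :: "real \<Rightarrow> real ^ 'm"
    and p :: "real ^ 'm"
    and \<theta> c\<^sub>0 T :: real
  assumes "C1_map F" and "global_flow F \<Phi>"
    and "C1_map V" and "strict_Lyapounov F \<Phi> V"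
    and "asymptotic_pseudotrajectory \<Phi> X" and "bounded (X ` {0..})"
    and "T > 0"
    and "p \<in> limit_set X \<inter> Eq F"
    and "Lojasiewicz_at V p \<theta> c\<^sub>0" and "angle_condition_at F V p"
    and "admissible_rates \<Phi> T X \<noteq> {}"
  shows "limit_set X = {p} \<and>
    (\<forall>\<beta>>0. (\<forall>\<^sub>F x in nhds p. \<bar>grad V x \<bullet> F x\<bar> \<ge> \<beta> * (norm (grad V x))\<^sup>2) \<longrightarrow>
       (let c = decay_exponent \<Phi> T X \<beta> c\<^sub>0 in
         (\<theta> = 1/2 \<longrightarrow>
            ((INF \<mu>\<in>admissible_rates \<Phi> T X. ereal \<mu>) < c \<longrightarrow>
               (\<lambda>t. norm (X t - p)) \<in> O[at_top](\<lambda>t. exp (real_of_ereal c * t))) \<and>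
            (\<forall>c'::real. c < ereal c' \<longrightarrow>
               (\<lambda>t. norm (X t - p)) \<in> O[at_top](\<lambda>t. exp (c' * t)))) \<and>
         (\<theta> < 1/2 \<longrightarrow>
            (\<lambda>t. norm (X t - p)) \<in> O[at_top](\<lambda>t. t powr (- \<theta> / (1 - 2 * \<theta>))))))"
proof -
  interpret gradient_like_pseudotrajectory F \<Phi> V X p \<theta> c\<^sub>0 T
    by standard (use assms in auto)
  show ?thesis
    unfolding Let_def
    using limit_set_eq[OF assms(11)] attained_exp_rate approximate_exp_rate powr_rate[OF _ _ _ assms(11)]
    by blast
qed

end
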